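(* Let $0<\alpha<1$, let $\Omega\subset(0,\alpha)$ be a finite set with a probability distribution $\mathbb P=(p_\beta)_{\beta\in\Omega}$, let $\nu=\mathbb P^{\otimes\mathbb N}$ on $\Sigma=\Omega^{\mathbb N}$, and let $\mu$ be the absolutely continuous stationary probability measure of the associated random system of intermittent maps $(T_\beta)_{\beta\in\Omega}$. Let $\varphi\in C^1([0,1])$ with $\mu(\varphi)=0$, and suppose that $\int\varphi\,d\mu_{\beta_1}\ne\int\varphi\,d\mu_{\beta_2}$ for two parameters $\beta_1,\beta_2\in\Omega$. Then it is not the case that $$\lim_{n\to\infty}\frac1{\sqrt n}\sum_{j=1}^n\varphi(\mathcal T^j_\omega\,\cdot)\to N(0,\sigma^2)$$ (convergence in distribution) for $\nu$-almost every $\omega\in\Sigma$, where $\sigma^2$ is the annealed variance. Hence, the Birkhoff sums need to be centered along each realization.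
   Context: For $\beta\in(0,1)$ the intermittent map $T_\beta:[0,1]\to[0,1]$ is $T_\beta(x)=x+2^\beta x^{1+\beta}$ for $0\le x\le 1/2$ and $T_\beta(x)=2x-1$ for $1/2<x\le1$; $\mu_\beta$ denotes its invariant probability measure absolutely continuous with respect to Lebesgue measure. For $\omega=(\omega_1,\omega_2,\dots)\in\Sigma$, $\mathcal T^j_\omega:=T_{\omega_j}\circ\cdots\circ T_{\omega_1}$, with $\mathcal T^0_\omega=\mathrm{Id}$. A probability measure $\mu$ on $[0,1]$ is stationary if $\mu(A)=\sum_{\beta\in\Omega}p_\beta\,\mu(T_\beta^{-1}A)$ for all Borel $A$; it is known that there is a unique stationary probability measure absolutely continuous with respect to Lebesgue measure, and $\mu$ denotes this measure, with $\mu(\varphi)=\int\varphi\,d\mu$. The annealed variance is $\sigma^2=\lim_{n\to\infty}\frac1n\int_\Sigma\int_0^1\big(\sum_{k=0}^{n-1}\varphi(\mathcal T^k_\omega x)\big)^2d\mu(x)\,d\nu(\omega)$. "Centered along each realization" means that each term $\varphi(\mathcal T^j_\omega\,\cdot)$ is replaced by $\varphi(\mathcal T^j_\omega\,\cdot)-m(\varphi\circ\mathcal T^j_\omega)$, where $m$ is Lebesgue measure on $[0,1]$ and $m(f)=\int_0^1 f\,dm$.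
   Formalization: All weights p_β are assumed positive: if p_{β1}=0, Ω={β1,β2} and β2<1/2, the ordinary CLT holds and the claim fails. The limit σ² is taken to exist and be finite, and convergence in distribution is with respect to Lebesgue measure m. *)

theory Defs
  imports "HOL-Probability.Probability"
begin

text \<open>Lebesgue measure on the Borel sets of the unit interval.\<close>

definition m01 :: "real measure" where
  "m01 = restrict_space lborel {0..1}"

text \<open>Only the values on \<open>{0..1}\<close> matter; note that \<open>0 powr (1 + \<beta>) = 0\<close>.\<close>

definition imap :: "real \<Rightarrow> real \<Rightarrow> real" where
  "imap \<beta> x = (if x \<le> 1/2 then x + 2 powr \<beta> * x powr (1 + \<beta>) else 2 * x - 1)"

text \<open>Sequences of parameters are indexed from \<open>0\<close>, so that \<open>\<omega> j\<close> stands for \<open>\<omega>\<^sub>j\<^sub>+\<^sub>1\<close> and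
  \<open>rcomp \<omega> j = T\<^bsub>\<omega>\<^sub>j\<^esub> \<circ> \<dots> \<circ> T\<^bsub>\<omega>\<^sub>1\<^esub>\<close>.\<close>

primrec rcomp :: "(nat \<Rightarrow> real) \<Rightarrow> nat \<Rightarrow> real \<Rightarrow> real" where
  "rcomp \<omega> 0 = id"
| "rcomp \<omega> (Suc j) = imap (\<omega> j) \<circ> rcomp \<omega> j"

text \<open>The product measure on the sequence space \<open>UNIV \<rightarrow>\<^sub>E \<Omega>\<close>.\<close>

definition seq_measure :: "real set \<Rightarrow> (real \<Rightarrow> real) \<Rightarrow> (nat \<Rightarrow> real) measure" where
  "seq_measure \<Omega> p = PiM UNIV (\<lambda>_. point_measure \<Omega> (\<lambda>\<beta>. ennreal (p \<beta>)))"

definition ac_prob :: "real measure \<Rightarrow> bool" where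
  "ac_prob \<mu> \<longleftrightarrow> prob_space \<mu> \<and> sets \<mu> = sets m01 \<and> absolutely_continuous m01 \<mu>"

definition ac_invariant :: "real \<Rightarrow> real measure \<Rightarrow> bool" where
  "ac_invariant \<beta> \<mu> \<longleftrightarrow> ac_prob \<mu> \<and>
     (\<forall>A\<in>sets m01. measure \<mu> A = measure \<mu> (imap \<beta> -` A \<inter> {0..1}))"

definition ac_stationary :: "real set \<Rightarrow> (real \<Rightarrow> real) \<Rightarrow> real measure \<Rightarrow> bool" where
  "ac_stationary \<Omega> p \<mu> \<longleftrightarrow> ac_prob \<mu> \<and>
     (\<forall>A\<in>sets m01. measure \<mu> A = (\<Sum>\<beta>\<in>\<Omega>. p \<beta> * measure \<mu> (imap \<beta> -` A \<inter> {0..1})))"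

text \<open>Continuous differentiability on the closed interval, one-sided at the end points (the
  library's \<open>C1_differentiable_on\<close> would ask for two-sided derivatives there).\<close>

definition C1_unit :: "(real \<Rightarrow> real) \<Rightarrow> bool" where
  "C1_unit \<phi> \<longleftrightarrow> (\<exists>\<phi>'. continuous_on {0..1} \<phi>' \<and>
     (\<forall>x\<in>{0..1}. (\<phi> has_real_derivative \<phi>' x) (at x within {0..1})))"

text \<open>The limit defining the variance need not be finite when the parameters reach \<open>1/2\<close>, so
  this is a relation: the limit exists in the reals and equals \<open>\<sigma>2\<close>.\<close>

definition annealed_variance ::
  "real set \<Rightarrow> (real \<Rightarrow> real) \<Rightarrow> real measure \<Rightarrow> (real \<Rightarrow> real) \<Rightarrow> real \<Rightarrow> bool" where
  "annealed_variance \<Omega> p \<mu> \<phi> \<sigma>2 \<longleftrightarrow>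
     (\<lambda>n. 1 / real n *
        (\<integral>\<omega>. (\<integral>x. (\<Sum>k<n. \<phi> (rcomp \<omega> k x))\<^sup>2 \<partial>\<mu>) \<partial>seq_measure \<Omega> p))
       \<longlonglongrightarrow> \<sigma>2"

text \<open>The Gaussian law with mean \<open>0\<close> and variance \<open>v \<ge> 0\<close>. The variance \<open>0\<close> has to be treated
  separately, since \<open>normal_density 0 0\<close> vanishes identically.\<close>

definition normal_law :: "real \<Rightarrow> real measure" where
  "normal_law v = (if v = 0 then return borel 0 else density lborel (normal_density 0 (sqrt v)))"

text \<open>Convergence in distribution to \<open>N(0, v)\<close> of the uncentered, normalized Birkhoff sums along
  the fixed realization \<open>\<omega>\<close>, as random variables on the unit interval with Lebesgue measure.\<close>

definition quenched_clt :: "(real \<Rightarrow> real) \<Rightarrow> (nat \<Rightarrow> real) \<Rightarrow> real \<Rightarrow> bool" where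
  "quenched_clt \<phi> \<omega> v \<longleftrightarrow>
     weak_conv_m
       (\<lambda>n. distr m01 borel (\<lambda>x. 1 / sqrt (real n) * (\<Sum>j=1..n. \<phi> (rcomp \<omega> j x))))
       (normal_law v)"

end

theory Submission
  imports Defs
begin

text \<open>
  Let \<open>c\<^sub>n(\<omega>)\<close> be the mean of the Birkhoff sum along \<open>\<omega>\<close> with respect to Lebesgue measure. A quenched
  central limit theorem with a centred limit and a bounded annealed variance force
  \<open>c\<^sub>n / \<surd>n \<rightarrow> 0\<close> in \<open>L\<^sup>1(\<nu>)\<close>. Test this against \<open>Z\<close>, the centred number of those disjoint blocks of
  fixed length \<open>L\<close> among the first \<open>n\<close> parameters that consist of a single parameter \<open>\<beta>\<close>. The moments
  \<open>E Z\<^sup>4 = O(n\<^sup>2)\<close> show that \<open>E(c\<^sub>n Z) = o(n)\<close>. On the other hand, conditioning on one such block changes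
  the mean of \<open>c\<^sub>n\<close> by \<open>L \<integral>\<phi> d\<mu>\<^sub>\<beta> + o(L)\<close>, uniformly in the position of the block, so that \<open>E(c\<^sub>n Z)\<close> is of order \<open>n\<close>
  unless \<open>\<integral>\<phi> d\<mu>\<^sub>\<beta> = 0\<close>. Hence all these integrals vanish.

  The error \<open>o(L)\<close> requires that the block influences the part of the sum after it only little. Summable
  decay of correlations is not available for all \<open>\<alpha> < 1\<close>. Instead, densities in a cone are coupled at their
  returns to the right half, without synchronizing the return times; this determines means of Birkhoff sums
  up to a bounded error and the time spent near the neutral fixed point. The latter is controlled by the
  finiteness of the variance when \<open>\<phi> 0 \<noteq> 0\<close>, and is harmless when \<open>\<phi> 0 = 0\<close>.
\<close>

section \<open>The branches and bounded measurable functions\<close>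

text \<open>Blocks must be long because conditioning on letters also changes everything after them:
  the contribution of the block itself grows like \<open>L\<close>, that change only like a bounded
  term plus a small multiple of \<open>L\<close>. The stationary mean of the entrance time may be
  infinite, so entrance times are cut off throughout (\<open>tau m\<close>,
  \<open>mean_tau m\<close>), and the quantity eventually bounded is
  \<open>\<bar>\<phi> 0\<bar> * mean_tau m\<close>.

  The stationary density is known only to be integrable. Estimates are therefore proved for Lebesgue
  measure pushed forward by \<open>s\<close> steps, whose density lies in the cone, uniformly in
  \<open>s\<close>; Cesaro averages carry them over to \<mu>. The same results applied to a
  one-point parameter set bring in the invariant measures of the single maps.

  Fourth moments of the test are used because the normalized mean is small only in the first moment
  and bounded in the second: against a test that is merely bounded in the second moment, the pairing
  need not be small.\<close>

definition lbr :: "real \<Rightarrow> real \<Rightarrow> real" where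
  "lbr \<beta> x = x * (1 + 2 powr \<beta> * \<bar>x\<bar> powr \<beta>)"

definition lbr_deriv :: "real \<Rightarrow> real \<Rightarrow> real" where
  "lbr_deriv \<beta> x = 1 + (1 + \<beta>) * (2 powr \<beta> * \<bar>x\<bar> powr \<beta>)"

text \<open>The factor \<open>\<bar>x\<bar> powr \<beta>\<close> makes \<open>lbr \<beta>\<close> an
  odd increasing bijection of the whole line, so this inverse is total and monotone, hence Borel,
  without any restriction of domains.\<close>

definition lbr_inv :: "real \<Rightarrow> real \<Rightarrow> real" where
  "lbr_inv \<beta> = inv (lbr \<beta>)"

lemma imap_left:
  assumes "0 \<le> x" "x \<le> 1/2"
  shows "imap \<beta> x = lbr \<beta> x"
  using assms by (cases "x = 0") (auto simp: imap_def lbr_def powr_add algebra_simps)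

lemma imap_right: "1/2 < x \<Longrightarrow> imap \<beta> x = 2 * x - 1"
  by (simp add: imap_def)

lemma lbr_half: "lbr \<beta> (1/2) = 1"
  by (simp add: lbr_def powr_divide)

lemma lbr_0 [simp]: "lbr \<beta> 0 = 0"
  by (simp add: lbr_def)

lemma lbr_minus: "lbr \<beta> (- x) = - lbr \<beta> x"
  by (simp add: lbr_def)

lemma lbr_ge: "0 \<le> x \<Longrightarrow> x \<le> lbr \<beta> x"
  by (simp add: lbr_def mult_le_cancel_left1)

lemma lbr_less_nonneg:
  assumes "0 < \<beta>" "0 \<le> x" "x < y"
  shows "lbr \<beta> x < lbr \<beta> y"
proof -
  have "x powr \<beta> \<le> y powr \<beta>" using assms by (intro powr_mono2) auto
  then have "x * (1 + 2 powr \<beta> * x powr \<beta>) < y * (1 + 2 powr \<beta> * y powr \<beta>)"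
    using assms by (intro mult_less_le_imp_less) (auto simp: add_pos_nonneg)
  then show ?thesis using assms by (simp add: lbr_def)
qed

lemma strict_mono_lbr:
  assumes "0 < \<beta>"
  shows "strict_mono (lbr \<beta>)"
proof (rule strict_monoI)
  fix x y :: real assume xy: "x < y"
  show "lbr \<beta> x < lbr \<beta> y"
  proof (cases "0 \<le> x")
    case True
    then show ?thesis using lbr_less_nonneg[OF assms _ xy] by simp
  next
    case x: False
    show ?thesis
    proof (cases "0 < y")
      case True
      have "lbr \<beta> x \<le> x" using lbr_ge[of "- x" \<beta>] x by (simp add: lbr_minus)
      also have "\<dots> < lbr \<beta> y" using lbr_ge[of y \<beta>] True x by simp
      finally show ?thesis .
    next
      case False
      then show ?thesis using lbr_less_nonneg[OF assms, of "- y" "- x"] xy by (simp add: lbr_minus)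
    qed
  qed
qed

lemma continuous_lbr_deriv: "0 < \<beta> \<Longrightarrow> continuous_on A (lbr_deriv \<beta>)"
  unfolding lbr_deriv_def by (intro continuous_on_powr' continuous_intros) auto

lemma continuous_lbr: "0 < \<beta> \<Longrightarrow> continuous_on A (lbr \<beta>)"
  unfolding lbr_def by (intro continuous_on_powr' continuous_intros) auto

lemma surj_lbr:
  assumes "0 < \<beta>"
  shows "surj (lbr \<beta>)"
proof -
  have "\<exists>x. lbr \<beta> x = y" if "0 \<le> y" for y
    using IVT'[of "lbr \<beta>" 0 y y] that lbr_ge[of y \<beta>] continuous_lbr[OF assms] by auto
  then have "\<exists>x. lbr \<beta> x = y" for y
    by (cases "0 \<le> y") (auto, metis lbr_minus minus_minus neg_0_le_iff_le nle_le)
  then show ?thesis by (metis surjI)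
qed

lemma lbr_has_derivative:
  assumes "0 < \<beta>" "0 \<le> x"
  shows "(lbr \<beta> has_real_derivative lbr_deriv \<beta> x) (at x)"
proof (cases "x = 0")
  case True
  \<comment> \<open>At the neutral fixed point the derivative is read off the difference quotient,
    which is this function of \<open>h\<close>.\<close>
  have "((\<lambda>h. 1 + 2 powr \<beta> * \<bar>h\<bar> powr \<beta>) \<longlongrightarrow> 1 + 2 powr \<beta> * \<bar>0\<bar> powr \<beta>) (at 0)"
    using assms by (intro tendsto_intros) auto
  then have "((\<lambda>h. (lbr \<beta> (0 + h) - lbr \<beta> 0) / h) \<longlongrightarrow> 1) (at 0)"
    using assms by (auto elim!: Lim_transform_eventually simp: lbr_def eventually_at_filter)
  then show ?thesis using True assms by (simp add: DERIV_def lbr_deriv_def)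
next
  case False
  then have x: "0 < x" using assms by simp
  have "((\<lambda>x. x * (1 + 2 powr \<beta> * x powr \<beta>)) has_real_derivative lbr_deriv \<beta> x) (at x)"
    using x by (auto intro!: derivative_eq_intros
        simp: lbr_deriv_def powr_diff field_simps)
  moreover have "\<forall>\<^sub>F y in nhds x. lbr \<beta> y = y * (1 + 2 powr \<beta> * y powr \<beta>)"
    using eventually_nhds_in_open[of "{0<..}" x] x
    by (auto elim!: eventually_mono simp: lbr_def)
  ultimately show ?thesis by (subst DERIV_cong_ev[OF refl _ refl])
qed

lemma lbr_deriv_ge1: "0 < \<beta> \<Longrightarrow> 1 \<le> lbr_deriv \<beta> x"
  by (simp add: lbr_deriv_def)

lemma lbr_deriv_mono:
  assumes "0 < \<beta>" "0 \<le> x" "x \<le> y"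
  shows "lbr_deriv \<beta> x \<le> lbr_deriv \<beta> y"
proof -
  have "x powr \<beta> \<le> y powr \<beta>" using assms by (intro powr_mono2) auto
  then show ?thesis using assms by (simp add: lbr_deriv_def)
qed

lemma lbr_inv_lbr [simp]: "0 < \<beta> \<Longrightarrow> lbr_inv \<beta> (lbr \<beta> x) = x"
  unfolding lbr_inv_def by (simp add: strict_mono_lbr strict_mono_imp_inj_on)

lemma lbr_lbr_inv [simp]: "0 < \<beta> \<Longrightarrow> lbr \<beta> (lbr_inv \<beta> x) = x"
  unfolding lbr_inv_def by (simp add: surj_lbr surj_f_inv_f)

lemma lbr_le_iff: "0 < \<beta> \<Longrightarrow> lbr \<beta> x \<le> lbr \<beta> y \<longleftrightarrow> x \<le> y"
  using strict_mono_lbr strict_mono_less_eq by blast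

lemma lbr_less_iff: "0 < \<beta> \<Longrightarrow> lbr \<beta> x < lbr \<beta> y \<longleftrightarrow> x < y"
  using strict_mono_lbr strict_mono_less by blast

lemma lbr_inv_mono: "0 < \<beta> \<Longrightarrow> x \<le> y \<Longrightarrow> lbr_inv \<beta> x \<le> lbr_inv \<beta> y"
  by (metis lbr_le_iff lbr_lbr_inv)

lemma lbr_inv_range:
  assumes "0 < \<beta>" "0 < x" "x \<le> 1"
  shows "0 < lbr_inv \<beta> x" "lbr_inv \<beta> x \<le> 1/2"
  using assms lbr_less_iff[of \<beta> 0 "lbr_inv \<beta> x"] lbr_le_iff[of \<beta> "lbr_inv \<beta> x" "1/2"]
  by (auto simp: lbr_half)

lemma measurable_lbr_inv [measurable]: "0 < \<beta> \<Longrightarrow> lbr_inv \<beta> \<in> borel_measurable borel"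
  by (rule borel_measurable_mono) (auto simp: mono_def lbr_inv_mono)

lemma measurable_lbr_deriv [measurable]: "lbr_deriv \<beta> \<in> borel_measurable borel"
  unfolding lbr_deriv_def by measurable

lemma measurable_imap [measurable]: "imap \<beta> \<in> borel_measurable borel"
  unfolding imap_def by measurable

lemma imap_unit:
  assumes "0 < \<beta>" "0 \<le> x" "x \<le> 1"
  shows "0 \<le> imap \<beta> x" "imap \<beta> x \<le> 1"
  using assms lbr_ge[of x \<beta>] lbr_le_iff[of \<beta> x "1/2"]
  by (cases "x \<le> 1/2"; simp add: imap_left imap_right lbr_half)+

lemma imap_pos:
  assumes "0 < \<beta>" "0 < x"
  shows "0 < imap \<beta> x"
  using assms lbr_ge[of x \<beta>]
  by (cases "x \<le> 1/2"; simp add: imap_left imap_right)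

lemma imap_left_mono:
  assumes "0 < \<beta>" "0 \<le> x" "x \<le> y" "y \<le> 1/2"
  shows "imap \<beta> x \<le> imap \<beta> y"
  using assms by (simp add: imap_left lbr_le_iff)

section \<open>Lebesgue measure on the unit interval and bounded Borel functions\<close>

lemma prob_space_m01: "prob_space m01"
  by (rule prob_spaceI) (simp add: m01_def emeasure_restrict_space space_restrict_space)

interpretation m01: prob_space m01 by (rule prob_space_m01)

lemma space_m01 [simp]: "space m01 = {0..1}"
  by (simp add: m01_def space_restrict_space)

lemma measurable_m01 [measurable (raw)]: "f \<in> borel_measurable borel \<Longrightarrow> f \<in> borel_measurable m01"
  by (simp add: m01_def measurable_restrict_space1)

lemma integral_m01:
  "f \<in> borel_measurable borel \<Longrightarrow> (\<integral>x. f x \<partial>m01) = (\<integral>x. indicator {0..1} x * f x \<partial>lborel)"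
  for f :: "real \<Rightarrow> real"
  unfolding m01_def by (subst integral_restrict_space) (auto simp: )

lemma AE_m01_pos: "AE x in m01. 0 < x"
proof -
  have "AE x in lborel. x \<noteq> (0::real)" by (rule AE_lborel_singleton)
  then have "AE x in lborel. x \<in> {0..1} \<longrightarrow> 0 < (x::real)" by eventually_elim auto
  then show ?thesis unfolding m01_def by (subst AE_restrict_space_iff) auto
qed

text \<open>Observables and densities are total functions bounded on the whole line, which makes
  integrability against finite measures on the unit interval automatic.\<close>

definition bdd_meas :: "(real \<Rightarrow> real) \<Rightarrow> bool" where
  "bdd_meas \<psi> \<longleftrightarrow> \<psi> \<in> borel_measurable borel \<and> (\<exists>M. \<forall>x. \<bar>\<psi> x\<bar> \<le> M)"

lemma bdd_measI: "\<psi> \<in> borel_measurable borel \<Longrightarrow> (\<And>x. \<bar>\<psi> x\<bar> \<le> M) \<Longrightarrow> bdd_meas \<psi>"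
  unfolding bdd_meas_def by blast

lemma bdd_meas_measurable [measurable_dest]: "bdd_meas \<psi> \<Longrightarrow> \<psi> \<in> borel_measurable borel"
  unfolding bdd_meas_def by blast

lemma bdd_measE:
  assumes "bdd_meas \<psi>"
  obtains M where "0 \<le> M" "\<And>x. \<bar>\<psi> x\<bar> \<le> M"
  using assms unfolding bdd_meas_def by (meson abs_ge_zero order_trans)

lemma bdd_meas_const [simp, intro]: "bdd_meas (\<lambda>x. c)"
  by (rule bdd_measI[of _ "\<bar>c\<bar>"]) auto

lemma bdd_meas_add [intro]:
  assumes "bdd_meas f" "bdd_meas g" shows "bdd_meas (\<lambda>x. f x + g x)"
proof -
  obtain M N where "\<And>x. \<bar>f x\<bar> \<le> M" "\<And>x. \<bar>g x\<bar> \<le> N" using assms by (metis bdd_measE)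
  then have "\<bar>f x + g x\<bar> \<le> M + N" for x
    by (meson abs_triangle_ineq add_mono order_trans)
  then show ?thesis using assms[THEN bdd_meas_measurable] by (intro bdd_measI) auto
qed

lemma bdd_meas_mult [intro]:
  assumes "bdd_meas f" "bdd_meas g" shows "bdd_meas (\<lambda>x. f x * g x)"
proof -
  obtain M N where "0 \<le> M" "\<And>x. \<bar>f x\<bar> \<le> M" "\<And>x. \<bar>g x\<bar> \<le> N" using assms by (metis bdd_measE)
  then have "\<bar>f x * g x\<bar> \<le> M * N" for x
    by (auto simp: abs_mult intro!: mult_mono)
  then show ?thesis using assms[THEN bdd_meas_measurable] by (intro bdd_measI) auto
qed

lemma bdd_meas_cmult [intro]: "bdd_meas f \<Longrightarrow> bdd_meas (\<lambda>x. c * f x)"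
  by (rule bdd_meas_mult) auto

lemma bdd_meas_uminus [intro]: "bdd_meas f \<Longrightarrow> bdd_meas (\<lambda>x. - f x)"
  using bdd_meas_cmult[of f "-1"] by simp

lemma bdd_meas_diff [intro]: "bdd_meas f \<Longrightarrow> bdd_meas g \<Longrightarrow> bdd_meas (\<lambda>x. f x - g x)"
  using bdd_meas_add[of f "\<lambda>x. - g x"] by auto

lemma bdd_meas_sum [intro]: "(\<And>i. i \<in> I \<Longrightarrow> bdd_meas (f i)) \<Longrightarrow> bdd_meas (\<lambda>x. \<Sum>i\<in>I. f i x)"
  by (induction I rule: infinite_finite_induct) auto

lemma bdd_meas_indicator [intro]: "A \<in> sets borel \<Longrightarrow> bdd_meas (indicator A)"
  by (rule bdd_measI[of _ 1]) (auto simp: indicator_def)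

lemma bdd_meas_comp: "bdd_meas f \<Longrightarrow> g \<in> borel_measurable borel \<Longrightarrow> bdd_meas (\<lambda>x. f (g x))"
  unfolding bdd_meas_def by (auto intro: measurable_compose[of g])

lemma bdd_meas_max: "bdd_meas f \<Longrightarrow> bdd_meas (\<lambda>x. max 0 (f x))"
proof -
  assume f: "bdd_meas f"
  then obtain M where M: "0 \<le> M" "\<And>x. \<bar>f x\<bar> \<le> M" by (metis bdd_measE)
  show ?thesis using M(1) M(2)[THEN abs_le_D1] bdd_meas_measurable[OF f]
    by (intro bdd_measI[of _ M]) auto
qed

lemma bdd_meas_integrable:
  assumes "bdd_meas f" "finite_measure M" "sets M = sets m01"
  shows "integrable M f"
proof -
  obtain B where B: "\<And>x. \<bar>f x\<bar> \<le> B" using assms by (metis bdd_measE)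
  have "f \<in> borel_measurable M" using measurable_m01[of f] assms
    by (metis bdd_meas_def measurable_cong_sets)
  then show ?thesis
    using B assms(2) by (intro finite_measure.integrable_const_bound[of _ _ B]) auto
qed

lemma bdd_meas_integrable_m01 [intro]: "bdd_meas f \<Longrightarrow> integrable m01 f"
  by (rule bdd_meas_integrable) (auto intro: m01.finite_measure_axioms)

lemmas bdd_meas_intros = bdd_meas_const bdd_meas_add bdd_meas_mult bdd_meas_uminus bdd_meas_diff
  bdd_meas_sum bdd_meas_indicator bdd_meas_max

section \<open>Cones of densities\<close>

abbreviation left_ind :: "real \<Rightarrow> real" where "left_ind \<equiv> indicator {..1/2}"
abbreviation right_ind :: "real \<Rightarrow> real" where "right_ind \<equiv> indicator {1/2<..}"

lemma left_plus_right: "left_ind x + right_ind x = 1"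
  by (auto simp: indicator_def)

lemma integral_right_ind: "(\<integral>x. right_ind x \<partial>m01) = 1/2"
proof -
  have "(\<integral>x. right_ind x \<partial>m01) = (\<integral>x. indicator {0..1} x * right_ind x \<partial>lborel)"
    by (rule integral_m01) auto
  also have "(\<lambda>x. indicator {0..1} x * right_ind x) = indicator {1/2<..1}"
    by (auto simp: fun_eq_iff split: split_indicator)
  finally show ?thesis by simp
qed

lemma integral_cmult_right_ind: "(\<integral>x. c * right_ind x \<partial>m01) = c / 2"
  using integral_right_ind by (simp del: Bochner_Integration.integral_indicator)

text \<open>Contribution of the left branch to the Perron-Frobenius operator of one map;
  \<open>rop\<close> is that of the right branch, which is the same for every parameter.\<close>

definition lop :: "real \<Rightarrow> (real \<Rightarrow> real) \<Rightarrow> real \<Rightarrow> real" where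
  "lop \<beta> f x = f (lbr_inv \<beta> x) / lbr_deriv \<beta> (lbr_inv \<beta> x)"

definition rop :: "(real \<Rightarrow> real) \<Rightarrow> real \<Rightarrow> real" where
  "rop f x = f ((1 + x) / 2) / 2"

lemma bdd_meas_lop:
  assumes "0 < \<beta>" "bdd_meas f"
  shows "bdd_meas (lop \<beta> f)"
proof -
  obtain M where M: "0 \<le> M" "\<And>x. \<bar>f x\<bar> \<le> M" using assms by (metis bdd_measE)
  have "lop \<beta> f \<in> borel_measurable borel"
    using assms(1) bdd_meas_measurable[OF assms(2)] unfolding lop_def by measurable
  moreover have "\<bar>lop \<beta> f x\<bar> \<le> M" for x
  proof -
    have "\<bar>f (lbr_inv \<beta> x)\<bar> / lbr_deriv \<beta> (lbr_inv \<beta> x) \<le> M / 1"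
      using M lbr_deriv_ge1[OF assms(1)] by (intro frac_le) auto
    then show ?thesis
      using lbr_deriv_ge1[OF assms(1), of "lbr_inv \<beta> x"] by (simp add: lop_def)
  qed
  ultimately show ?thesis by (rule bdd_measI)
qed

lemma bdd_meas_rop: "bdd_meas f \<Longrightarrow> bdd_meas (rop f)"
  using bdd_meas_cmult[OF bdd_meas_comp[of f "\<lambda>x. (1 + x) / 2"], of "1/2"]
  by (simp add: rop_def[abs_def])

lemma set_integrable_bdd_meas:
  assumes "bdd_meas f"
  shows "set_integrable lborel {a..b} f"
proof -
  obtain M where M: "0 \<le> M" "\<And>x. \<bar>f x\<bar> \<le> M" using assms by (metis bdd_measE)
  have "AE x in lborel. x \<in> {a..b} \<longrightarrow> norm (f x) \<le> M" using M by auto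
  then show ?thesis using bdd_meas_measurable[OF assms]
    unfolding set_integrable_def
    by (intro integrableI_bounded_set_indicator[of _ _ _ M]) (auto simp: emeasure_lborel_Icc_eq)
qed

text \<open>Substitution along \<open>lbr \<beta>\<close>, which maps \<open>{0..1/2}\<close> onto
  \<open>{0..1}\<close>; the Jacobian cancels the denominator in \<open>lop\<close>.\<close>

lemma lop_dual:
  assumes "0 < \<beta>" "bdd_meas f" "bdd_meas \<psi>"
  shows "(\<integral>x. lop \<beta> f x * \<psi> x \<partial>m01) = (\<integral>x. f x * (left_ind x * \<psi> (imap \<beta> x)) \<partial>m01)"
proof -
  note [measurable] = bdd_meas_measurable[OF assms(2)] bdd_meas_measurable[OF assms(3)]
  let ?F = "\<lambda>x. lop \<beta> f x * \<psi> x"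
  have F: "bdd_meas ?F" using assms by (intro bdd_meas_mult bdd_meas_lop)
  have "(\<integral>x. lop \<beta> f x * \<psi> x \<partial>m01) = (LBINT x. ?F x * indicator {lbr \<beta> 0..lbr \<beta> (1/2)} x)"
    using F bdd_meas_measurable by (subst integral_m01) (auto simp: lbr_half[unfolded] mult.commute)
  also have "\<dots> = (LBINT x. ?F (lbr \<beta> x) * lbr_deriv \<beta> x * indicator {0..1/2} x)"
    using assms F by (intro integral_substitution set_integrable_bdd_meas)
      (auto intro!: lbr_has_derivative continuous_lbr_deriv order_trans[OF _ lbr_deriv_ge1])
  also have "\<dots> = (LBINT x. indicator {0..1} x * (f x * (left_ind x * \<psi> (imap \<beta> x))))"
  proof (intro Bochner_Integration.integral_cong refl)
    fix x :: real
    have "lbr_deriv \<beta> x \<noteq> 0" using lbr_deriv_ge1[OF assms(1), of x] by auto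
    then show "?F (lbr \<beta> x) * lbr_deriv \<beta> x * indicator {0..1/2} x
        = indicator {0..1} x * (f x * (left_ind x * \<psi> (imap \<beta> x)))"
      using assms(1) by (auto simp: indicator_def lop_def imap_left)
  qed
  also have "\<dots> = (\<integral>x. f x * (left_ind x * \<psi> (imap \<beta> x)) \<partial>m01)"
    by (subst integral_m01) auto
  finally show ?thesis .
qed

lemma rop_dual:
  assumes "bdd_meas f" "bdd_meas \<psi>"
  shows "(\<integral>x. rop f x * \<psi> x \<partial>m01) = (\<integral>x. f x * (right_ind x * \<psi> (2 * x - 1)) \<partial>m01)"
proof -
  note [measurable] = bdd_meas_measurable[OF assms(1)] bdd_meas_measurable[OF assms(2)]
  let ?F = "\<lambda>x. rop f x * \<psi> x"
  let ?g = "\<lambda>x::real. 2 * x - 1"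
  have F: "bdd_meas ?F" using assms by (intro bdd_meas_mult bdd_meas_rop)
  have "(\<integral>x. rop f x * \<psi> x \<partial>m01) = (LBINT x. ?F x * indicator {?g (1/2)..?g 1} x)"
    using F bdd_meas_measurable by (subst integral_m01) (auto simp: mult.commute)
  also have "\<dots> = (LBINT x. ?F (?g x) * 2 * indicator {1/2..1} x)"
    using assms F by (intro integral_substitution set_integrable_bdd_meas)
      (auto intro!: derivative_eq_intros)
  also have "\<dots> = (LBINT x. indicator {0..1} x * (f x * (right_ind x * \<psi> (2 * x - 1))))"
  proof (rule integral_cong_AE)
    show "AE x in lborel. ?F (?g x) * 2 * indicator {1/2..1} x
       = indicator {0..1} x * (f x * (right_ind x * \<psi> (2 * x - 1)))"
      using AE_lborel_singleton[of "1/2"]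
      by eventually_elim (auto simp: indicator_def rop_def)
  qed (use bdd_meas_measurable[OF bdd_meas_rop[OF assms(1)]] in measurable)
  also have "\<dots> = (\<integral>x. f x * (right_ind x * \<psi> (2 * x - 1)) \<partial>m01)"
    by (subst integral_m01) auto
  finally show ?thesis .
qed

text \<open>The cone of Liverani, Saussol and Vaienti. The left branches preserve it for every exponent
  at least \<open>2\<close>; subtracting a constant raises the exponent from \<open>2\<close> to \<open>4\<close>, and the right
  branch brings it back to \<open>2\<close>.\<close>

definition dcone :: "nat \<Rightarrow> real set \<Rightarrow> (real \<Rightarrow> real) \<Rightarrow> bool" where
  "dcone \<kappa> J f \<longleftrightarrow> bdd_meas f \<and> (\<forall>x. 0 \<le> f x) \<and>
     (\<forall>x\<in>J. \<forall>y\<in>J. x \<le> y \<longrightarrow> f y \<le> f x \<and> x ^ \<kappa> * f x \<le> y ^ \<kappa> * f y)"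

lemma dconeD:
  assumes "dcone \<kappa> J f"
  shows "bdd_meas f" "0 \<le> f x"
    and "x \<in> J \<Longrightarrow> y \<in> J \<Longrightarrow> x \<le> y \<Longrightarrow> f y \<le> f x"
    and "x \<in> J \<Longrightarrow> y \<in> J \<Longrightarrow> x \<le> y \<Longrightarrow> x ^ \<kappa> * f x \<le> y ^ \<kappa> * f y"
  using assms unfolding dcone_def by auto

lemma dcone_subset: "dcone \<kappa> J f \<Longrightarrow> J' \<subseteq> J \<Longrightarrow> dcone \<kappa> J' f"
  unfolding dcone_def by blast

text \<open>Both monotonicity conditions are inherited by products of nonnegative quantities.
  Exponents add, which later lets a weight of exponent 2 be absorbed into a density of exponent
  2.\<close>

lemma dcone_mult:
  assumes "dcone \<kappa> J f" "dcone l J g" "J \<subseteq> {0..}"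
  shows "dcone (\<kappa> + l) J (\<lambda>x. f x * g x)"
  unfolding dcone_def
proof (intro conjI allI ballI impI)
  show "bdd_meas (\<lambda>x. f x * g x)" using assms by (auto intro: dconeD)
  show "0 \<le> f x * g x" for x
    using dconeD(2)[OF assms(1)] dconeD(2)[OF assms(2)] by simp
  fix x y assume xy: "x \<in> J" "y \<in> J" "x \<le> y"
  show "f y * g y \<le> f x * g x"
    using assms xy by (intro mult_mono) (auto intro: dconeD)
  have "(x ^ \<kappa> * f x) * (x ^ l * g x) \<le> (y ^ \<kappa> * f y) * (y ^ l * g y)"
    using xy assms(3)
    by (intro mult_mono[of "x ^ \<kappa> * f x" _ "x ^ l * g x"])
      (auto intro!: dconeD(4)[OF assms(1)] dconeD(4)[OF assms(2)] mult_nonneg_nonneg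
        dconeD(2)[OF assms(1)] dconeD(2)[OF assms(2)])
  then show "x ^ (\<kappa> + l) * (f x * g x) \<le> y ^ (\<kappa> + l) * (f y * g y)"
    by (simp add: power_add mult_ac)
qed

lemma dcone_const: "0 \<le> c \<Longrightarrow> J \<subseteq> {0..} \<Longrightarrow> dcone \<kappa> J (\<lambda>x. c)"
  unfolding dcone_def by (auto intro!: mult_right_mono power_mono)

lemma dcone_weaken:
  assumes "dcone \<kappa> J f" "\<kappa> \<le> l" "J \<subseteq> {0..}"
  shows "dcone l J f"
  using dcone_mult[OF assms(1) dcone_const[of 1 J "l - \<kappa>"]] assms by simp

lemma dcone_cmult: "dcone \<kappa> J f \<Longrightarrow> 0 \<le> c \<Longrightarrow> J \<subseteq> {0..} \<Longrightarrow> dcone \<kappa> J (\<lambda>x. c * f x)"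
  using dcone_mult[OF dcone_const, of c J \<kappa> f 0] by simp

lemma dcone_add:
  assumes "dcone \<kappa> J f" "dcone \<kappa> J g"
  shows "dcone \<kappa> J (\<lambda>x. f x + g x)"
  using assms unfolding dcone_def by (auto simp: distrib_left intro!: add_mono)

lemma dcone_sum:
  assumes "\<And>i. i \<in> I \<Longrightarrow> dcone \<kappa> J (f i)" "J \<subseteq> {0..}"
  shows "dcone \<kappa> J (\<lambda>x. \<Sum>i\<in>I. f i x)"
  using assms by (induction I rule: infinite_finite_induct) (auto intro: dcone_const dcone_add)

text \<open>The loss \<open>x * (f x - f y)\<close> is at most \<open>\<Lambda> * (y - x)\<close>,
  and the gain \<open>(y - x) * f y\<close> covers it once \<open>f\<close> dominates its Lipschitz
  constant. So a decreasing Lipschitz function enters the cone after adding a constant.\<close>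

lemma lipschitz_dcone:
  assumes f: "bdd_meas f" "\<And>x. 0 \<le> f x"
    and mono: "\<And>x y. 0 < x \<Longrightarrow> x \<le> y \<Longrightarrow> y \<le> 1 \<Longrightarrow> f y \<le> f x"
    and lip: "\<And>x y. 0 < x \<Longrightarrow> x \<le> y \<Longrightarrow> y \<le> 1 \<Longrightarrow> f x - f y \<le> \<Lambda> * (y - x)"
    and lower: "\<And>x. 0 < x \<Longrightarrow> x \<le> 1 \<Longrightarrow> \<Lambda> \<le> f x" and "0 \<le> \<Lambda>"
  shows "dcone 1 {0<..1} f"
  unfolding dcone_def
proof (intro conjI allI ballI impI)
  fix x y :: real assume xy: "x \<in> {0<..1}" "y \<in> {0<..1}" "x \<le> y"
  show "f y \<le> f x" using mono xy by auto
  have "x * (f x - f y) \<le> 1 * (\<Lambda> * (y - x))"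
    using xy lip[of x y] mono[of x y] by (intro mult_mono) auto
  also have "\<dots> \<le> (y - x) * f y" using xy lower[of y] by (auto simp: mult.commute intro: mult_right_mono)
  finally show "x ^ 1 * f x \<le> y ^ 1 * f y" by (simp add: algebra_simps)
qed (use f in auto)

text \<open>Used with \<open>c = 1 + \<beta>\<close>: if \<open>x = lbr \<beta> u\<close> and
  \<open>a = (2 * u) powr \<beta>\<close>, then \<open>x ^ \<kappa> * lop \<beta> f x\<close> is
  \<open>u ^ \<kappa> * f u\<close> times \<open>(1 + a) ^ \<kappa> / (1 + c * a)\<close>. Exponent
  1 would fail for \<open>c > 1\<close>; for exponent 2 the condition \<open>c \<le> 2\<close> is
  what small \<open>a\<close> and \<open>b\<close> demand.\<close>

lemma dcone_lop_ratio:
  fixes a b c :: real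
  assumes "0 \<le> a" "a \<le> b" "1 \<le> c" "c \<le> 2" "2 \<le> \<kappa>"
  shows "(1 + a) ^ \<kappa> * (1 + c * b) \<le> (1 + b) ^ \<kappa> * (1 + c * a)"
proof -
  have "(1 + b)\<^sup>2 * (1 + c * a) - (1 + a)\<^sup>2 * (1 + c * b) = (b - a) * (2 + a + b - c + c * (a * b))"
    by (simp add: power2_eq_square algebra_simps)
  also have "\<dots> \<ge> 0" using assms by (intro mult_nonneg_nonneg add_nonneg_nonneg) auto
  finally have "(1 + a)\<^sup>2 * (1 + c * b) \<le> (1 + b)\<^sup>2 * (1 + c * a)" by simp
  then have "(1 + a) ^ (\<kappa> - 2) * ((1 + a)\<^sup>2 * (1 + c * b)) \<le> (1 + b) ^ (\<kappa> - 2) * ((1 + b)\<^sup>2 * (1 + c * a))"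
    using assms by (intro mult_mono[of "(1 + a) ^ (\<kappa> - 2)"] power_mono add_nonneg_nonneg mult_nonneg_nonneg zero_le_power) auto
  moreover have "(1 + t) ^ \<kappa> = (1 + t) ^ (\<kappa> - 2) * (1 + t)\<^sup>2" for t :: real
    using assms power_add[of "1 + t" "\<kappa> - 2" 2] by (simp only: le_add_diff_inverse2)
  ultimately show ?thesis by (simp only: mult.assoc)
qed

lemma dcone_lop:
  assumes \<beta>: "0 < \<beta>" "\<beta> \<le> 1" and "2 \<le> \<kappa>" and f: "dcone \<kappa> {0<..1} f"
  shows "dcone \<kappa> {0<..1} (lop \<beta> f)"
  unfolding dcone_def
proof (intro conjI allI ballI impI)
  show "bdd_meas (lop \<beta> f)" using assms by (auto intro: bdd_meas_lop dconeD)
  show "0 \<le> lop \<beta> f x" for x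
    using lbr_deriv_ge1[OF \<beta>(1), of "lbr_inv \<beta> x"] dconeD(2)[OF f] by (simp add: lop_def)
  fix x y :: real assume xy: "x \<in> {0<..1}" "y \<in> {0<..1}" "x \<le> y"
  define u where "u = lbr_inv \<beta> x"
  define v where "v = lbr_inv \<beta> y"
  have uv: "0 < u" "u \<le> v" "v \<le> 1/2" "lbr \<beta> u = x" "lbr \<beta> v = y"
    using xy \<beta> lbr_inv_range[OF \<beta>(1)] by (auto simp: u_def v_def lbr_inv_mono)
  have uv': "u \<in> {0<..1}" "v \<in> {0<..1}" using uv by auto
  have d: "1 \<le> lbr_deriv \<beta> u" "lbr_deriv \<beta> u \<le> lbr_deriv \<beta> v"
    using uv \<beta> by (auto intro: lbr_deriv_ge1 lbr_deriv_mono)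
  have "f v / lbr_deriv \<beta> v \<le> f u / lbr_deriv \<beta> u"
    using d uv uv' f by (intro frac_le) (auto intro: dconeD)
  then show "lop \<beta> f y \<le> lop \<beta> f x" by (simp add: lop_def u_def v_def)
  define a where "a = 2 powr \<beta> * u powr \<beta>"
  define b where "b = 2 powr \<beta> * v powr \<beta>"
  have ab: "0 \<le> a" "a \<le> b" using uv \<beta> by (auto simp: a_def b_def intro!: powr_mono2)
  have x: "x = u * (1 + a)" and y: "y = v * (1 + b)"
    and du: "lbr_deriv \<beta> u = 1 + (1 + \<beta>) * a" and dv: "lbr_deriv \<beta> v = 1 + (1 + \<beta>) * b"
    using uv unfolding a_def b_def by (auto simp: lbr_def lbr_deriv_def)
  have "(1 + a) ^ \<kappa> / lbr_deriv \<beta> u \<le> (1 + b) ^ \<kappa> / lbr_deriv \<beta> v"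
    unfolding du dv using dcone_lop_ratio[of a b "1 + \<beta>" \<kappa>] ab assms
    by (simp add: divide_simps add_pos_nonneg)
  then have "(u ^ \<kappa> * f u) * ((1 + a) ^ \<kappa> / lbr_deriv \<beta> u)
      \<le> (v ^ \<kappa> * f v) * ((1 + b) ^ \<kappa> / lbr_deriv \<beta> v)"
    using uv uv' ab d by (intro mult_mono[of "u ^ \<kappa> * f u"])
      (auto intro!: dconeD(4)[OF f] mult_nonneg_nonneg dconeD(2)[OF f] divide_nonneg_nonneg)
  then show "x ^ \<kappa> * lop \<beta> f x \<le> y ^ \<kappa> * lop \<beta> f y"
    by (simp add: lop_def flip: u_def v_def) (simp add: x y power_mult_distrib mult_ac)
qed

text \<open>The right branch halves the exponent; this is what pays for @\<close>

lemma dcone_rop: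
  assumes f: "dcone 4 {1/2<..1} f"
  shows "dcone 2 {0<..1} (rop f)"
  unfolding dcone_def
proof (intro conjI allI ballI impI)
  show "bdd_meas (rop f)" using assms by (auto intro: bdd_meas_rop dconeD)
  show "0 \<le> rop f x" for x using dconeD(2)[OF f] by (simp add: rop_def)
  fix x y :: real assume xy: "x \<in> {0<..1}" "y \<in> {0<..1}" "x \<le> y"
  define u where "u = (1 + x) / 2"
  define v where "v = (1 + y) / 2"
  have uv: "u \<in> {1/2<..1}" "v \<in> {1/2<..1}" "u \<le> v" and x: "x = 2 * u - 1" and y: "y = 2 * v - 1"
    using xy by (auto simp: u_def v_def field_simps)
  have "rop f x = f u / 2" "rop f y = f v / 2" by (auto simp: rop_def u_def v_def)
  moreover have "f v \<le> f u" using uv f by (auto intro: dconeD)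
  ultimately show "rop f y \<le> rop f x" by simp
  \<comment> \<open>This identity makes \<open>(2 * u - 1) / u\<^sup>2\<close> increasing on the
    right half. Its square times \<open>u ^ 4 * f u\<close> is \<open>x\<^sup>2 * f u\<close>, which
    is how exponent 4 turns into exponent 2.\<close>
  have "y * u\<^sup>2 - x * v\<^sup>2 = (v - u) * (u + v - 2 * (u * v))"
    unfolding x y by (simp add: power2_eq_square algebra_simps)
  moreover have "u * v \<le> u" "u * v \<le> v" using uv by (auto simp: mult_left_le_one_le mult_left_le)
  moreover have "0 \<le> (v - u) * (u + v - 2 * (u * v))"
    using uv \<open>u * v \<le> u\<close> \<open>u * v \<le> v\<close> by (intro mult_nonneg_nonneg) linarith+
  ultimately have "x * v\<^sup>2 \<le> y * u\<^sup>2" by linarith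
  then have "x / u\<^sup>2 \<le> y / v\<^sup>2" using uv by (simp add: divide_simps)
  then have "(x / u\<^sup>2)\<^sup>2 \<le> (y / v\<^sup>2)\<^sup>2" using xy by (intro power_mono) auto
  then have "(x / u\<^sup>2)\<^sup>2 * (u ^ 4 * f u) \<le> (y / v\<^sup>2)\<^sup>2 * (v ^ 4 * f v)"
    using uv by (intro mult_mono[of _ _ "u ^ 4 * f u"])
      (auto intro!: dconeD(4)[OF f] mult_nonneg_nonneg dconeD(2)[OF f])
  moreover have "(x / u\<^sup>2)\<^sup>2 * (u ^ 4 * f u) = x\<^sup>2 * f u" "(y / v\<^sup>2)\<^sup>2 * (v ^ 4 * f v) = y\<^sup>2 * f v"
    using uv by (auto simp: power_divide)
  ultimately have "x\<^sup>2 * f u \<le> y\<^sup>2 * f v" by (simp only:)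
  then show "x ^ 2 * rop f x \<le> y ^ 2 * rop f y"
    unfolding \<open>rop f x = f u / 2\<close> \<open>rop f y = f v / 2\<close> by simp
qed

text \<open>Raising the exponent creates a surplus: with \<open>X = x\<^sup>2\<close> and
  \<open>Y = y\<^sup>2\<close>, the exponent-4 inequality for \<open>f\<close> has room
  \<open>(Y - X) * (Y * f y)\<close>, and this covers the amount
  \<open>(Y\<^sup>2 - X\<^sup>2) * c\<close> lost by subtracting \<open>c\<close> as soon as
  \<open>f\<close> is at least \<open>2 * c\<close>. The \<open>max 0\<close> matters only off the
  right half, where \<open>f - c\<close> may be negative.\<close>

lemma dcone_minus_const:
  assumes f: "dcone 2 {1/2<..1} f" and c: "0 \<le> c" "\<And>x. x \<in> {1/2<..1} \<Longrightarrow> 2 * c \<le> f x"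
  shows "dcone 4 {1/2<..1} (\<lambda>x. max 0 (f x - c))"
  unfolding dcone_def
proof (intro conjI allI ballI impI)
  show "bdd_meas (\<lambda>x. max 0 (f x - c))" 
    by (rule bdd_meas_max, rule bdd_meas_diff) (use dconeD(1)[OF f] in auto)
  show "0 \<le> max 0 (f x - c)" for x by simp
  fix x y :: real assume xy: "x \<in> {1/2<..1}" "y \<in> {1/2<..1}" "x \<le> y"
  have fx: "max 0 (f x - c) = f x - c" and fy: "max 0 (f y - c) = f y - c"
    using c(1) c(2)[OF xy(1)] c(2)[OF xy(2)] by auto
  show "max 0 (f y - c) \<le> max 0 (f x - c)" using dconeD(3)[OF f, of x y] xy by simp
  define X where "X = x\<^sup>2"
  define Y where "Y = y\<^sup>2"
  have XY: "0 \<le> X" "X \<le> Y" using xy by (auto simp: X_def Y_def intro: power_mono)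
  have "X * (X * f x) \<le> X * (Y * f y)"
    using dconeD(4)[OF f, of x y] xy XY by (intro mult_left_mono) (auto simp: X_def Y_def)
  moreover have "0 \<le> (Y - X) * (Y * f y - (X + Y) * c)"
  proof (rule mult_nonneg_nonneg)
    have "(X + Y) * c \<le> (2 * Y) * c" using XY c by (intro mult_right_mono) auto
    also have "\<dots> = Y * (2 * c)" by simp
    also have "\<dots> \<le> Y * f y" using XY c xy by (intro mult_left_mono) auto
    finally show "0 \<le> Y * f y - (X + Y) * c" by simp
  qed (use XY in auto)
  ultimately have "X * X * (f x - c) \<le> Y * Y * (f y - c)" by (simp add: algebra_simps)
  moreover have "x ^ 4 = X * X" "y ^ 4 = Y * Y" by (auto simp: X_def Y_def simp flip: power_add)
  ultimately show "x ^ 4 * max 0 (f x - c) \<le> y ^ 4 * max 0 (f y - c)"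
    by (simp only: fx fy)
qed

section \<open>Pointwise bounds from the mass on the right half\<close>

lemma integral_m01_mono:
  "bdd_meas f \<Longrightarrow> bdd_meas g \<Longrightarrow> (\<And>x. 0 < x \<Longrightarrow> x \<le> 1 \<Longrightarrow> f x \<le> g x)
    \<Longrightarrow> (\<integral>x. f x \<partial>m01) \<le> (\<integral>x. g x \<partial>m01)"
  using AE_m01_pos AE_space by (intro integral_mono_AE) (auto elim!: eventually_elim2)

text \<open>On the right half \<open>f\<close> is at least \<open>f 1\<close> and at most
  \<open>2 ^ 4 * f 1\<close>; the length 1/2 doubles the constant.\<close>

lemma dcone_upper:
  assumes f: "dcone 4 {1/2<..1} f" and x: "x \<in> {1/2<..1}"
  shows "f x \<le> 32 * (\<integral>x. f x * right_ind x \<partial>m01)"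
proof -
  have "f x / 16 \<le> f 1"
  proof -
    have "(1/2)^4 * f x \<le> x ^ 4 * f x" using x dconeD(2)[OF f] by (intro mult_right_mono power_mono) auto
    also have "\<dots> \<le> f 1" using dconeD(4)[OF f, of x 1] x by simp
    finally show ?thesis by (simp add: power_divide)
  qed
  moreover have "(\<integral>y. f 1 * right_ind y \<partial>m01) \<le> (\<integral>x. f x * right_ind x \<partial>m01)"
    using dconeD(3)[OF f, of _ 1] dconeD(1)[OF f]
    by (intro integral_m01_mono bdd_meas_intros) (auto split: split_indicator)
  ultimately show ?thesis unfolding integral_cmult_right_ind by simp
qed

text \<open>On the right half \<open>f y \<le> 2 ^ 2 * f 1 \<le> 4 * f x\<close>, integrated over
  length 1/2.\<close>

lemma dcone_lower:
  assumes f: "dcone 2 {1/2<..1} f" and x: "x \<in> {1/2<..1}"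
  shows "(\<integral>x. f x * right_ind x \<partial>m01) \<le> 2 * f x"
proof -
  have "(\<integral>x. f x * right_ind x \<partial>m01) \<le> (\<integral>y. (4 * f x) * right_ind y \<partial>m01)"
  proof (intro integral_m01_mono)
    fix y :: real assume y: "0 < y" "y \<le> 1"
    show "f y * right_ind y \<le> 4 * f x * right_ind y"
    proof (cases "1/2 < y")
      case True
      have "(1/2)^2 * f y \<le> y ^ 2 * f y" using True dconeD(2)[OF f] by (intro mult_right_mono power_mono) auto
      also have "\<dots> \<le> f 1" using dconeD(4)[OF f, of y 1] True y by simp
      also have "\<dots> \<le> f x" using dconeD(3)[OF f, of x 1] x by simp
      finally show ?thesis using True by (simp add: power_divide)
    qed simp
  qed (use dconeD(1)[OF f] in \<open>auto intro!: bdd_meas_intros\<close>)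
  then show ?thesis unfolding integral_cmult_right_ind by simp
qed

section \<open>The annealed transfer operator\<close>

text \<open>The locale is also instantiated with the parameter set \<open>{\<beta>}\<close> and
  weight 1, so that everything proved in it holds for each single map with the same
  \<alpha>.\<close>

locale intermittent_system =
  fixes \<Omega> :: "real set" and p :: "real \<Rightarrow> real" and \<alpha> :: real
  assumes finite_Omega: "finite \<Omega>"
    and Omega_subset: "\<Omega> \<subseteq> {0<..<\<alpha>}"
    and alpha_less_1: "\<alpha> < 1"
    and p_nonneg: "\<And>\<beta>. \<beta> \<in> \<Omega> \<Longrightarrow> 0 \<le> p \<beta>"
    and p_sum: "(\<Sum>\<beta>\<in>\<Omega>. p \<beta>) = 1"
begin

lemma Omega_bounds: "\<beta> \<in> \<Omega> \<Longrightarrow> 0 < \<beta> \<and> \<beta> < \<alpha> \<and> \<beta> < 1"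
  using Omega_subset alpha_less_1 by force

lemma alpha_pos: "0 < \<alpha>"
  using p_sum Omega_bounds by (cases "\<Omega> = {}") fastforce+

text \<open>\<open>koop\<close> is the transition operator of the annealed Markov chain, \<open>kleft\<close> that of the chain killed
  on the right half, and \<open>tau m x\<close> the expected time, cut off at \<open>m\<close>, that the chain from \<open>x\<close> needs
  to enter the right half.\<close>

definition koop :: "(real \<Rightarrow> real) \<Rightarrow> real \<Rightarrow> real" where
  "koop \<psi> x = (\<Sum>\<beta>\<in>\<Omega>. p \<beta> * \<psi> (imap \<beta> x))"

definition kleft :: "(real \<Rightarrow> real) \<Rightarrow> real \<Rightarrow> real" where
  "kleft \<psi> x = left_ind x * koop \<psi> x"

text \<open>Transfer operator of the chain killed on the right half, dual to \<open>kleft\<close>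
  with respect to Lebesgue measure.\<close>

definition eop :: "(real \<Rightarrow> real) \<Rightarrow> real \<Rightarrow> real" where
  "eop f x = (\<Sum>\<beta>\<in>\<Omega>. p \<beta> * lop \<beta> f x)"

text \<open>The expected Birkhoff sum of the annealed chain started at \<open>x\<close>; see
  \<open>integral_bsum\<close>.\<close>

definition birk :: "(real \<Rightarrow> real) \<Rightarrow> nat \<Rightarrow> real \<Rightarrow> real" where
  "birk \<psi> m x = (\<Sum>i<m. (koop ^^ i) \<psi> x)"

definition tau :: "nat \<Rightarrow> real \<Rightarrow> real" where
  "tau m x = (\<Sum>n<m. (kleft ^^ n) left_ind x)"

section \<open>Linearity, positivity and boundedness of the operators\<close>

lemma koop_linear:
  "koop (\<lambda>x. f x + g x) = (\<lambda>x. koop f x + koop g x)"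
  "koop (\<lambda>x. f x - g x) = (\<lambda>x. koop f x - koop g x)"
  "koop (\<lambda>x. c * f x) = (\<lambda>x. c * koop f x)"
  "koop (\<lambda>x. c) = (\<lambda>x. c)"
  by (auto simp: koop_def fun_eq_iff distrib_left right_diff_distrib sum.distrib sum_subtractf
      sum_distrib_left mult_ac) (simp add: p_sum flip: sum_distrib_left)

lemma koop_sum: "koop (\<lambda>x. \<Sum>i\<in>I. f i x) = (\<lambda>x. \<Sum>i\<in>I. koop (f i) x)"
  using koop_linear(4)[of 0]
  by (induction I rule: infinite_finite_induct) (simp_all add: koop_linear)

lemma kleft_linear:
  "kleft (\<lambda>x. f x + g x) = (\<lambda>x. kleft f x + kleft g x)"
  "kleft (\<lambda>x. f x - g x) = (\<lambda>x. kleft f x - kleft g x)"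
  "kleft (\<lambda>x. c * f x) = (\<lambda>x. c * kleft f x)"
  by (auto simp: kleft_def fun_eq_iff koop_linear algebra_simps)

lemma kleft_sum: "kleft (\<lambda>x. \<Sum>i\<in>I. f i x) = (\<lambda>x. \<Sum>i\<in>I. kleft (f i) x)"
  by (auto simp: kleft_def koop_sum sum_distrib_left)

lemma koop_pow_linear:
  "(koop ^^ n) (\<lambda>x. f x + g x) = (\<lambda>x. (koop ^^ n) f x + (koop ^^ n) g x)"
  "(koop ^^ n) (\<lambda>x. f x - g x) = (\<lambda>x. (koop ^^ n) f x - (koop ^^ n) g x)"
  "(koop ^^ n) (\<lambda>x. c * f x) = (\<lambda>x. c * (koop ^^ n) f x)"
  "(koop ^^ n) (\<lambda>x. c) = (\<lambda>x. c)"
  by (induction n) (simp_all add: koop_linear)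

lemma kleft_pow_linear:
  "(kleft ^^ n) (\<lambda>x. f x + g x) = (\<lambda>x. (kleft ^^ n) f x + (kleft ^^ n) g x)"
  "(kleft ^^ n) (\<lambda>x. f x - g x) = (\<lambda>x. (kleft ^^ n) f x - (kleft ^^ n) g x)"
  "(kleft ^^ n) (\<lambda>x. c * f x) = (\<lambda>x. c * (kleft ^^ n) f x)"
  by (induction n) (simp_all add: kleft_linear)

lemma koop_mono:
  assumes "\<And>y. 0 < y \<Longrightarrow> y \<le> 1 \<Longrightarrow> f y \<le> g y" "0 < x" "x \<le> 1"
  shows "koop f x \<le> koop g x"
  unfolding koop_def
proof (intro sum_mono mult_left_mono)
  fix \<beta> assume "\<beta> \<in> \<Omega>"
  then show "f (imap \<beta> x) \<le> g (imap \<beta> x)" "0 \<le> p \<beta>"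
    using assms p_nonneg Omega_bounds[of \<beta>] imap_unit[of \<beta> x] imap_pos[of \<beta> x] by auto
qed

lemma koop_nonneg: "(\<And>y. 0 \<le> f y) \<Longrightarrow> 0 \<le> koop f x"
  unfolding koop_def using p_nonneg by (auto intro!: sum_nonneg mult_nonneg_nonneg)

lemma koop_pow_nonneg: "(\<And>y. 0 \<le> f y) \<Longrightarrow> 0 \<le> (koop ^^ n) f x"
  by (induction n arbitrary: x) (auto intro!: koop_nonneg)

lemma kleft_nonneg: "(\<And>y. 0 \<le> f y) \<Longrightarrow> 0 \<le> kleft f x"
  unfolding kleft_def by (auto intro!: mult_nonneg_nonneg koop_nonneg)

lemma kleft_pow_nonneg: "(\<And>y. 0 \<le> f y) \<Longrightarrow> 0 \<le> (kleft ^^ n) f x"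
  by (induction n arbitrary: x) (auto intro!: kleft_nonneg)

lemma koop_abs_le:
  assumes "\<And>y. \<bar>f y\<bar> \<le> M"
  shows "\<bar>koop f x\<bar> \<le> M"
proof -
  have "0 \<le> koop (\<lambda>y. M - f y) x" "0 \<le> koop (\<lambda>y. M + f y) x"
    using assms by (auto intro!: koop_nonneg simp: abs_le_iff) (smt (verit))+
  then show ?thesis by (simp add: koop_linear)
qed

lemma koop_pow_abs_le: "(\<And>y. \<bar>f y\<bar> \<le> M) \<Longrightarrow> \<bar>(koop ^^ n) f x\<bar> \<le> M"
  by (induction n arbitrary: x) (auto intro!: koop_abs_le)

lemma bdd_meas_koop [intro]: "bdd_meas f \<Longrightarrow> bdd_meas (koop f)"
  unfolding koop_def[abs_def]
  by (rule bdd_meas_sum, rule bdd_meas_cmult, rule bdd_meas_comp) auto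

lemma bdd_meas_koop_pow [intro]: "bdd_meas f \<Longrightarrow> bdd_meas ((koop ^^ n) f)"
  by (induction n) auto

lemma bdd_meas_kleft [intro]: "bdd_meas f \<Longrightarrow> bdd_meas (kleft f)"
  unfolding kleft_def[abs_def] by (intro bdd_meas_mult bdd_meas_indicator bdd_meas_koop) simp_all

lemma bdd_meas_kleft_pow [intro]: "bdd_meas f \<Longrightarrow> bdd_meas ((kleft ^^ n) f)"
  by (induction n) auto

lemma bdd_meas_birk [intro]: "bdd_meas f \<Longrightarrow> bdd_meas (birk f m)"
  unfolding birk_def[abs_def] by (intro bdd_meas_sum bdd_meas_koop_pow)

lemma bdd_meas_tau [intro]: "bdd_meas (tau m)"
  unfolding tau_def[abs_def] by (intro bdd_meas_sum bdd_meas_kleft_pow bdd_meas_indicator) simp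

lemma bdd_meas_eop [intro]: "bdd_meas f \<Longrightarrow> bdd_meas (eop f)"
  unfolding eop_def[abs_def] by (intro bdd_meas_sum bdd_meas_cmult bdd_meas_lop) (auto dest: Omega_bounds)

lemmas bdd_meas_ops = bdd_meas_intros bdd_meas_koop_pow bdd_meas_kleft_pow bdd_meas_birk
  bdd_meas_tau bdd_meas_eop bdd_meas_rop bdd_meas_koop bdd_meas_kleft

text \<open>The right branch does not depend on the parameter, so the average over \<Omega>
  collapses there.\<close>

lemma koop_split: "koop f x = kleft f x + right_ind x * f (2 * x - 1)"
proof (cases "x \<le> 1/2")
  case False
  then have "koop f x = (\<Sum>\<beta>\<in>\<Omega>. p \<beta>) * f (2 * x - 1)"
    unfolding koop_def sum_distrib_right by (intro sum.cong) (auto simp: imap_right)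
  then show ?thesis using False unfolding p_sum kleft_def by simp
next
  case True
  then show ?thesis unfolding kleft_def by simp
qed

lemma eop_dual:
  assumes "bdd_meas f" "bdd_meas \<psi>"
  shows "(\<integral>x. eop f x * \<psi> x \<partial>m01) = (\<integral>x. f x * kleft \<psi> x \<partial>m01)"
proof -
  have c: "bdd_meas (\<lambda>x. \<psi> (imap \<beta> x))" for \<beta>
    using assms by - (rule bdd_meas_comp, auto)
  have i1: "integrable m01 (\<lambda>x. p \<beta> * (lop \<beta> f x * \<psi> x))" if "\<beta> \<in> \<Omega>" for \<beta>
    using assms Omega_bounds[OF that]
    by (intro bdd_meas_integrable_m01 bdd_meas_cmult bdd_meas_mult bdd_meas_lop) simp_all
  have i2: "integrable m01 (\<lambda>x. p \<beta> * (f x * (left_ind x * \<psi> (imap \<beta> x))))" for \<beta>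
    using assms c by (intro bdd_meas_integrable_m01 bdd_meas_cmult bdd_meas_mult bdd_meas_indicator) simp_all
  have "(\<integral>x. eop f x * \<psi> x \<partial>m01) = (\<Sum>\<beta>\<in>\<Omega>. p \<beta> * (\<integral>x. lop \<beta> f x * \<psi> x \<partial>m01))"
    unfolding eop_def sum_distrib_right mult.assoc
    using i1 by (subst Bochner_Integration.integral_sum) simp_all
  also have "\<dots> = (\<Sum>\<beta>\<in>\<Omega>. p \<beta> * (\<integral>x. f x * (left_ind x * \<psi> (imap \<beta> x)) \<partial>m01))"
    using assms Omega_bounds by (intro sum.cong refl) (simp add: lop_dual)
  also have "\<dots> = (\<integral>x. (\<Sum>\<beta>\<in>\<Omega>. p \<beta> * (f x * (left_ind x * \<psi> (imap \<beta> x)))) \<partial>m01)"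
    using i2 by (subst Bochner_Integration.integral_sum) simp_all
  also have "(\<lambda>x. (\<Sum>\<beta>\<in>\<Omega>. p \<beta> * (f x * (left_ind x * \<psi> (imap \<beta> x))))) = (\<lambda>x. f x * kleft \<psi> x)"
    by (simp add: fun_eq_iff kleft_def koop_def sum_distrib_left mult_ac)
  finally show ?thesis .
qed

lemma bdd_meas_eop_pow [intro]: "bdd_meas f \<Longrightarrow> bdd_meas ((eop ^^ n) f)"
  by (induction n) auto

lemma eop_pow_dual:
  assumes "bdd_meas f" "bdd_meas \<psi>"
  shows "(\<integral>x. (eop ^^ n) f x * \<psi> x \<partial>m01) = (\<integral>x. f x * (kleft ^^ n) \<psi> x \<partial>m01)"
  using assms by (induction n arbitrary: \<psi>) (simp_all add: eop_dual bdd_meas_eop_pow bdd_meas_kleft flip: funpow_swap1)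

section \<open>The full annealed transfer operator\<close>

definition pf :: "(real \<Rightarrow> real) \<Rightarrow> real \<Rightarrow> real" where
  "pf f x = eop f x + rop f x"

lemma bdd_meas_pf [intro]: "bdd_meas f \<Longrightarrow> bdd_meas (pf f)"
  unfolding pf_def[abs_def] by (intro bdd_meas_add bdd_meas_eop bdd_meas_rop)

lemma bdd_meas_pf_pow [intro]: "bdd_meas f \<Longrightarrow> bdd_meas ((pf ^^ n) f)"
  by (induction n) auto

lemma pf_dual:
  assumes "bdd_meas f" "bdd_meas \<psi>"
  shows "(\<integral>x. pf f x * \<psi> x \<partial>m01) = (\<integral>x. f x * koop \<psi> x \<partial>m01)"
proof -
  have b: "bdd_meas (\<lambda>x. \<psi> (2 * x - 1))" using assms by - (rule bdd_meas_comp, auto)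
  have "(\<integral>x. pf f x * \<psi> x \<partial>m01) = (\<integral>x. eop f x * \<psi> x \<partial>m01) + (\<integral>x. rop f x * \<psi> x \<partial>m01)"
    unfolding pf_def distrib_right using assms
    by (intro Bochner_Integration.integral_add bdd_meas_integrable_m01 bdd_meas_ops)
  also have "\<dots> = (\<integral>x. f x * koop \<psi> x \<partial>m01)"
    unfolding koop_split distrib_left eop_dual[OF assms] rop_dual[OF assms] using assms b
    by (intro Bochner_Integration.integral_add[symmetric] bdd_meas_integrable_m01 bdd_meas_ops) auto
  finally show ?thesis .
qed

lemma pf_pow_dual:
  assumes "bdd_meas f" "bdd_meas \<psi>"
  shows "(\<integral>x. (pf ^^ n) f x * \<psi> x \<partial>m01) = (\<integral>x. f x * (koop ^^ n) \<psi> x \<partial>m01)"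
  using assms by (induction n arbitrary: \<psi>) (simp_all add: pf_dual bdd_meas_pf_pow bdd_meas_koop flip: funpow_swap1)

lemma dcone_eop: "2 \<le> \<kappa> \<Longrightarrow> dcone \<kappa> {0<..1} f \<Longrightarrow> dcone \<kappa> {0<..1} (eop f)"
  unfolding eop_def[abs_def]
  by (intro dcone_sum dcone_cmult dcone_lop) (auto dest: Omega_bounds p_nonneg)

lemma dcone_eop_pow: "2 \<le> \<kappa> \<Longrightarrow> dcone \<kappa> {0<..1} f \<Longrightarrow> dcone \<kappa> {0<..1} ((eop ^^ n) f)"
  by (induction n) (auto intro: dcone_eop)

text \<open>On the right half exponent 2 may be weakened to 4, which \<open>rop\<close> turns back
  into 2.\<close>

lemma dcone_pf:
  assumes f: "dcone 2 {0<..1} f"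
  shows "dcone 2 {0<..1} (pf f)"
proof -
  have "dcone 4 {1/2<..1} f" by (rule dcone_weaken[OF dcone_subset[OF f]]) auto
  then show ?thesis unfolding pf_def[abs_def] using f by (intro dcone_add dcone_eop dcone_rop) auto
qed

lemma dcone_pf_pow: "dcone 2 {0<..1} f \<Longrightarrow> dcone 2 {0<..1} ((pf ^^ n) f)"
  by (induction n) (auto intro: dcone_pf)

section \<open>Birkhoff means and the first entrance into the right half\<close>

lemma birk_0 [simp]: "birk f 0 x = 0"
  by (simp add: birk_def)

lemma birk_Suc: "birk f (Suc m) x = f x + koop (birk f m) x"
proof -
  have "koop (birk f m) = (\<lambda>x. \<Sum>i<m. koop ((koop ^^ i) f) x)"
    unfolding birk_def[abs_def] by (rule koop_sum)
  then show ?thesis by (simp add: birk_def sum.lessThan_Suc_shift del: sum.lessThan_Suc)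
qed

lemma birk_diff_le:
  assumes "\<And>y. \<bar>f y\<bar> \<le> M" "k \<le> m"
  shows "\<bar>birk f m x - birk f k x\<bar> \<le> real (m - k) * M"
proof -
  have "birk f m x - birk f k x = (\<Sum>i\<in>{k..<m}. (koop ^^ i) f x)"
    unfolding birk_def using assms(2) by (simp add: sum_diff_nat_ivl lessThan_atLeast0)
  also have "\<bar>\<dots>\<bar> \<le> (\<Sum>i\<in>{k..<m}. \<bar>(koop ^^ i) f x\<bar>)" by (rule sum_abs)
  also have "\<dots> \<le> (\<Sum>i\<in>{k..<m}. M)" by (intro sum_mono koop_pow_abs_le assms(1))
  finally show ?thesis by simp
qed

lemma birk_abs_le: "(\<And>y. \<bar>f y\<bar> \<le> M) \<Longrightarrow> \<bar>birk f m x\<bar> \<le> real m * M"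
  using birk_diff_le[of f M 0 m x] by simp

text \<open>Since \<open>kleft ^^ n\<close> keeps only paths that are on the left at all times
  before \<open>n\<close>, the first sum collects the terms up to the first entrance and the second
  restarts the Birkhoff sum at an entrance at time \<open>n\<close> with \<open>m - n\<close> terms
  to go.\<close>

lemma birk_entrance:
  "birk f m x = (\<Sum>n<m. (kleft ^^ n) (\<lambda>x. left_ind x * f x) x)
     + (\<Sum>n<m. (kleft ^^ n) (\<lambda>x. right_ind x * birk f (m - n) x) x)"
proof (induction m arbitrary: x)
  case (Suc m)
  have "kleft (birk f m) = (\<lambda>x. (\<Sum>n<m. kleft ((kleft ^^ n) (\<lambda>x. left_ind x * f x)) x)
     + (\<Sum>n<m. kleft ((kleft ^^ n) (\<lambda>x. right_ind x * birk f (m - n) x)) x))"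
    unfolding Suc[abs_def] by (simp add: kleft_linear kleft_sum)
  then have "left_ind x * birk f (Suc m) x = left_ind x * f x
     + ((\<Sum>n<m. kleft ((kleft ^^ n) (\<lambda>x. left_ind x * f x)) x)
     + (\<Sum>n<m. kleft ((kleft ^^ n) (\<lambda>x. right_ind x * birk f (m - n) x)) x))"
    by (simp add: birk_Suc distrib_left kleft_def fun_eq_iff)
  moreover have "birk f (Suc m) x = left_ind x * birk f (Suc m) x + right_ind x * birk f (Suc m) x"
    using left_plus_right[of x] by (simp flip: distrib_right)
  ultimately show ?case by (simp add: sum.lessThan_Suc_shift del: sum.lessThan_Suc)
qed simp

lemma tau_0 [simp]: "tau 0 x = 0"
  by (simp add: tau_def)

lemma tau_Suc: "tau (Suc m) x = left_ind x + kleft (tau m) x"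
proof -
  have "kleft (tau m) = (\<lambda>x. \<Sum>n<m. kleft ((kleft ^^ n) left_ind) x)"
    unfolding tau_def[abs_def] by (rule kleft_sum)
  then show ?thesis by (simp add: tau_def sum.lessThan_Suc_shift del: sum.lessThan_Suc)
qed

lemma tau_nonneg: "0 \<le> tau m x"
  unfolding tau_def by (auto intro!: sum_nonneg kleft_pow_nonneg)

lemma kleft_mono:
  assumes "\<And>y. 0 < y \<Longrightarrow> y \<le> 1 \<Longrightarrow> f y \<le> g y" "0 < x" "x \<le> 1"
  shows "kleft f x \<le> kleft g x"
  unfolding kleft_def using koop_mono[OF assms] by (auto simp: indicator_def)

lemma kleft_pow_mono:
  assumes "\<And>y. 0 < y \<Longrightarrow> y \<le> 1 \<Longrightarrow> f y \<le> g y" "0 < x" "x \<le> 1"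
  shows "(kleft ^^ n) f x \<le> (kleft ^^ n) g x"
  using assms by (induction n arbitrary: x) (auto intro!: kleft_mono)

text \<open>A nonnegative \<open>V\<close> that drops by at least \<open>g\<close> in every step
  from the left half pays for the expected total of \<open>g\<close> before the entrance.\<close>

lemma lyapunov_bound:
  assumes V: "\<And>x. 0 < x \<Longrightarrow> x \<le> 1 \<Longrightarrow> 0 \<le> V x"
    and drift: "\<And>\<beta> x. \<beta> \<in> \<Omega> \<Longrightarrow> 0 < x \<Longrightarrow> x \<le> 1/2 \<Longrightarrow> V (imap \<beta> x) \<le> V x - g x"
    and x: "0 < x" "x \<le> 1"
  shows "(\<Sum>n<m. (kleft ^^ n) (\<lambda>x. left_ind x * g x) x) \<le> V x"
  using x
proof (induction m arbitrary: x)
  case (Suc m)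
  let ?S = "\<lambda>x. \<Sum>n<m. (kleft ^^ n) (\<lambda>x. left_ind x * g x) x"
  have eq: "(\<Sum>n<Suc m. (kleft ^^ n) (\<lambda>x. left_ind x * g x) x) = left_ind x * g x + kleft ?S x"
    by (simp add: sum.lessThan_Suc_shift kleft_sum del: sum.lessThan_Suc)
  show ?case
  proof (cases "x \<le> 1/2")
    case True
    have "koop ?S x \<le> koop V x" using Suc by (intro koop_mono) auto
    also have "\<dots> \<le> (\<Sum>\<beta>\<in>\<Omega>. p \<beta> * (V x - g x))"
      unfolding koop_def using Suc True p_nonneg drift by (intro sum_mono mult_left_mono) auto
    also have "\<dots> = V x - g x" by (simp add: p_sum flip: sum_distrib_right)
    finally have "koop ?S x \<le> V x - g x" .
    moreover have "kleft ?S x = koop ?S x" using True by (simp add: kleft_def)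
    ultimately show ?thesis unfolding eq using True by simp
  next
    case False
    then have "kleft ?S x = 0" by (simp add: kleft_def)
    then show ?thesis unfolding eq using V[OF Suc.prems] False by simp
  qed
qed (use V in simp)

text \<open>The factor \<open>4 / \<alpha>\<close> normalizes the loss per step in
  \<open>lyap_drift\<close> to at least 1; the exponent is integrable because
  \<open>\<alpha> < 1\<close>.\<close>

definition lyap :: "real \<Rightarrow> real" where
  "lyap x = 4 / \<alpha> * x powr (- \<alpha>)"

text \<open>Follows from \<open>ln (1 + z) \<ge> z / (1 + z) \<ge> z / 2\<close>; giving up half of
  the slope covers all exponents \<open>s \<ge> 0\<close> at once.\<close>

lemma one_plus_powr_ge:
  fixes z s :: real
  assumes "0 \<le> z" "z \<le> 1" "0 \<le> s"
  shows "1 + s * z / 2 \<le> (1 + z) powr s"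
proof -
  have "z / 2 \<le> z / (1 + z)" using assms by (intro divide_left_mono) auto
  also have "\<dots> \<le> ln (1 + z)"
    using ln_le_minus_one[of "1 / (1 + z)"] assms by (simp add: ln_div field_simps)
  finally have "s * (z / 2) \<le> s * ln (1 + z)" using assms by (intro mult_left_mono)
  then have "1 + s * z / 2 \<le> 1 + s * ln (1 + z)" by simp
  also have "\<dots> \<le> exp (s * ln (1 + z))" by (rule exp_ge_add_one_self)
  finally show ?thesis using assms by (simp add: powr_def)
qed

lemma imap_lower:
  assumes "\<beta> \<in> \<Omega>" "0 < x" "x \<le> 1/2"
  shows "x * (1 + (2 * x) powr \<alpha>) \<le> imap \<beta> x"
proof -
  have "(2 * x) powr \<alpha> \<le> (2 * x) powr \<beta>"
    using assms Omega_bounds[of \<beta>] by (intro powr_mono') auto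
  then show ?thesis using assms by (simp add: imap_left lbr_def powr_mult)
qed

lemma lyap_drift:
  assumes "\<beta> \<in> \<Omega>" "0 < x" "x \<le> 1/2"
  shows "lyap (imap \<beta> x) \<le> lyap x - 1"
proof -
  define z where "z = (2 * x) powr \<alpha>"
  have z: "0 \<le> z" "z \<le> 1" using assms alpha_pos by (auto simp: z_def powr_le1)
  \<comment> \<open>Inverts the lower bound \<open>1 + \<alpha> * z / 2\<close> for
    \<open>(1 + z) powr \<alpha>\<close> at the price of another factor 2, whence the 4 in
    \<open>lyap\<close>.\<close>
  have "(1 - \<alpha> * z / 4) * (1 + \<alpha> * z / 2) - 1 = \<alpha> * z / 4 * (1 - \<alpha> * z / 2)"
    by (simp add: field_simps)
  moreover have "\<alpha> * z \<le> 1" using z alpha_less_1 alpha_pos mult_le_one[of \<alpha> z] by simp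
  moreover from this have "0 \<le> \<alpha> * z / 4 * (1 - \<alpha> * z / 2)"
    using z alpha_pos by (intro mult_nonneg_nonneg) simp_all
  ultimately have "1 \<le> (1 - \<alpha> * z / 4) * (1 + \<alpha> * z / 2)" by linarith
  also have "\<dots> \<le> (1 - \<alpha> * z / 4) * (1 + z) powr \<alpha>"
    using z \<open>\<alpha> * z \<le> 1\<close> alpha_pos by (intro mult_left_mono one_plus_powr_ge) auto
  finally have inv: "(1 + z) powr (- \<alpha>) \<le> 1 - \<alpha> * z / 4"
    using z by (simp add: powr_minus field_simps)
  have "imap \<beta> x powr (- \<alpha>) \<le> (x * (1 + z)) powr (- \<alpha>)"
    using imap_lower[OF assms] assms z alpha_pos unfolding z_def[symmetric]
    by (intro powr_mono2') auto
  also have "\<dots> = x powr (- \<alpha>) * (1 + z) powr (- \<alpha>)" using assms z by (simp add: powr_mult)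
  also have "\<dots> \<le> x powr (- \<alpha>) * (1 - \<alpha> * z / 4)" using inv by (intro mult_left_mono) auto
  also have "\<dots> = x powr (- \<alpha>) - \<alpha> / 4 * 2 powr \<alpha>"
    using assms by (simp add: z_def powr_mult powr_minus field_simps)
  also have "\<dots> \<le> x powr (- \<alpha>) - \<alpha> / 4" using alpha_pos by (simp add: ge_one_powr_ge_zero)
  finally show ?thesis using alpha_pos by (simp add: lyap_def field_simps)
qed

lemma lyap_nonneg: "0 \<le> lyap x"
  using alpha_pos by (simp add: lyap_def)

lemma tau_le_lyap: "0 < x \<Longrightarrow> x \<le> 1 \<Longrightarrow> tau m x \<le> lyap x"
  using lyapunov_bound[of lyap "\<lambda>_. 1" x m] lyap_drift lyap_nonneg by (simp add: tau_def)

text \<open>In contrast to the entrance time, the sum of the positions during a stay on the left is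
  bounded uniformly in the starting point: \<open>x powr (1 - \<alpha>)\<close> grows by at least
  \<open>(1 - \<alpha>) / 2 * x\<close> per step and cannot exceed 1. This sums the error in
  replacing a Lipschitz function by its value at 0.\<close>

lemma drift_bound:
  assumes "0 < x" "x \<le> 1"
  shows "(\<Sum>n<m. (kleft ^^ n) (\<lambda>x. left_ind x * x) x) \<le> 2 / (1 - \<alpha>)"
proof -
  let ?V = "\<lambda>x. 2 / (1 - \<alpha>) * (1 - x powr (1 - \<alpha>))"
  have "(\<Sum>n<m. (kleft ^^ n) (\<lambda>x. left_ind x * x) x) \<le> ?V x"
  proof (rule lyapunov_bound[OF _ _ assms])
    show "0 \<le> ?V x" if "0 < x" "x \<le> 1" for x
      using that alpha_less_1 powr_le1[of "1 - \<alpha>" x] by (intro mult_nonneg_nonneg) auto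
    fix \<beta> x :: real assume x: "\<beta> \<in> \<Omega>" "0 < x" "x \<le> 1/2"
    define z where "z = (2 * x) powr \<alpha>"
    have z: "0 \<le> z" "z \<le> 1" using x alpha_pos by (auto simp: z_def powr_le1)
    have "x powr (1 - \<alpha>) + (1 - \<alpha>) / 2 * x \<le> x powr (1 - \<alpha>) + (1 - \<alpha>) / 2 * (x * 2 powr \<alpha>)"
      using x alpha_less_1 alpha_pos by (simp add: ge_one_powr_ge_zero)
    also have "\<dots> = x powr (1 - \<alpha>) * (1 + (1 - \<alpha>) * z / 2)"
      using x by (simp add: z_def powr_mult powr_diff field_simps)
    also have "\<dots> \<le> x powr (1 - \<alpha>) * (1 + z) powr (1 - \<alpha>)"
      using z alpha_less_1 by (intro mult_left_mono one_plus_powr_ge) auto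
    also have "\<dots> = (x * (1 + z)) powr (1 - \<alpha>)" using x z by (simp add: powr_mult)
    also have "\<dots> \<le> imap \<beta> x powr (1 - \<alpha>)"
      using imap_lower[OF x] x z alpha_less_1 unfolding z_def[symmetric] by (intro powr_mono2) auto
    finally have "2 / (1 - \<alpha>) * (x powr (1 - \<alpha>) + (1 - \<alpha>) / 2 * x)
        \<le> 2 / (1 - \<alpha>) * (imap \<beta> x powr (1 - \<alpha>))"
      using alpha_less_1 by (intro mult_left_mono) auto
    moreover have "2 / (1 - \<alpha>) * ((1 - \<alpha>) / 2 * x) = x" using alpha_less_1 by simp
    ultimately show "?V (imap \<beta> x) \<le> ?V x - x" by (simp only: distrib_left right_diff_distrib)
  qed
  also have "\<dots> \<le> 2 / (1 - \<alpha>)" using alpha_less_1 by (simp add: divide_simps)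
  finally show ?thesis .
qed

end

section \<open>Coupling at returns to the right half\<close>

text \<open>Summation by parts, moving differences from the survival probabilities \<open>r\<close>
  to the reference means \<open>k\<close>, whose increments are bounded.\<close>

lemma abel_telescope:
  fixes r k :: "nat \<Rightarrow> real"
  assumes "k 0 = 0"
  shows "(\<Sum>n<M. (r n - r (Suc n)) * k (M - n))
    = r 0 * k M - (\<Sum>n<M. r (Suc n) * (k (M - n) - k (M - Suc n)))"
proof -
  have "(\<Sum>n<M. (r n - r (Suc n)) * k (M - n)) + (\<Sum>n<M. r (Suc n) * (k (M - n) - k (M - Suc n)))
      = (\<Sum>n<M. r n * k (M - n) - r (Suc n) * k (M - Suc n))"
    by (simp add: algebra_simps flip: sum.distrib)
  also have "\<dots> = r 0 * k (M - 0) - r M * k (M - M)"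
    by (rule sum_lessThan_telescope')
  finally show ?thesis using assms by simp
qed

lemma bdd_meas_abs:
  assumes "bdd_meas f" shows "bdd_meas (\<lambda>x. \<bar>f x\<bar>)"
proof -
  obtain M where "\<And>x. \<bar>f x\<bar> \<le> M" using assms by (metis bdd_measE)
  then show ?thesis using bdd_meas_measurable[OF assms] by (intro bdd_measI[of _ M]) auto
qed

lemma integrable_m01_mono:
  assumes "integrable m01 g" "bdd_meas f" "\<And>x. 0 < x \<Longrightarrow> x \<le> 1 \<Longrightarrow> f x \<le> g x"
  shows "(\<integral>x. f x \<partial>m01) \<le> (\<integral>x. g x \<partial>m01)"
  using AE_m01_pos AE_space assms
  by (intro integral_mono_AE) (auto elim!: eventually_elim2)

context intermittent_system
begin

lemma lyap_integrable: "integrable m01 lyap"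
proof -
  have "(\<lambda>x. x powr (- \<alpha>)) integrable_on {0..1::real}"
    using alpha_less_1 by (intro integrable_on_powr_from_0) auto
  then have "(\<lambda>x. x powr (- \<alpha>)) absolutely_integrable_on {0..1::real}"
    by (intro nonnegative_absolutely_integrable_1) auto
  then have "set_integrable lborel {0..1} (\<lambda>x::real. x powr (- \<alpha>))"
    unfolding set_integrable_def by (subst (asm) integrable_completion) auto
  then have "integrable m01 (\<lambda>x::real. x powr (- \<alpha>))"
    unfolding m01_def by (subst integrable_restrict_space) (auto simp: set_integrable_def)
  then show ?thesis unfolding lyap_def by simp
qed

definition lyap_mass :: real where "lyap_mass = (\<integral>x. lyap x \<partial>m01)"

lemma lyap_mass_nonneg: "0 \<le> lyap_mass"
  unfolding lyap_mass_def by (intro integral_nonneg_AE) (simp add: lyap_nonneg)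

text \<open>\<open>refK \<psi> m\<close> is the mean of the Birkhoff sum started from the uniform distribution on the right
  half, and \<open>ent \<psi> m\<close> approximates \<open>birk \<psi> m\<close> by restarting from that distribution at the first
  entrance. The approximation is only valid after integration against a density from the cone.\<close>

definition refK :: "(real \<Rightarrow> real) \<Rightarrow> nat \<Rightarrow> real" where
  "refK \<psi> m = 2 * (\<integral>x. right_ind x * birk \<psi> m x \<partial>m01)"

definition ent :: "(real \<Rightarrow> real) \<Rightarrow> nat \<Rightarrow> real \<Rightarrow> real" where
  "ent \<psi> m x = (\<Sum>n<m. (kleft ^^ n) (\<lambda>x. left_ind x * \<psi> x) x)
     + (\<Sum>n<m. refK \<psi> (m - n) * (kleft ^^ n) right_ind x)"

lemma bdd_meas_ent: "bdd_meas \<psi> \<Longrightarrow> bdd_meas (ent \<psi> m)"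
  unfolding ent_def[abs_def]
  by (intro bdd_meas_add bdd_meas_sum bdd_meas_cmult bdd_meas_kleft_pow bdd_meas_mult bdd_meas_indicator) auto

lemma refK_0 [simp]: "refK \<psi> 0 = 0"
  by (simp add: refK_def)

lemma refK_diff_le:
  assumes \<psi>: "bdd_meas \<psi>" "\<And>y. \<bar>\<psi> y\<bar> \<le> \<Psi>" and "k \<le> m"
  shows "\<bar>refK \<psi> m - refK \<psi> k\<bar> \<le> real (m - k) * \<Psi>"
proof -
  let ?D = "\<lambda>x. right_ind x * birk \<psi> m x - right_ind x * birk \<psi> k x"
  have b: "bdd_meas (\<lambda>x. right_ind x * birk \<psi> j x)" for j
    using \<psi> by (intro bdd_meas_mult bdd_meas_indicator bdd_meas_birk) auto
  have le: "\<bar>?D x\<bar> \<le> real (m - k) * \<Psi> * right_ind x" for x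
    using birk_diff_le[OF \<psi>(2) \<open>k \<le> m\<close>, where x = x] by (auto simp: indicator_def)
  have "\<bar>\<integral>x. ?D x \<partial>m01\<bar> \<le> (\<integral>x. real (m - k) * \<Psi> * right_ind x \<partial>m01)"
    using le b
    by (intro order_trans[OF integral_abs_bound] integral_mono)
      (auto intro!: bdd_meas_integrable_m01 integrable_abs bdd_meas_diff bdd_meas_cmult bdd_meas_indicator)
  also have "\<dots> = real (m - k) * \<Psi> / 2" by (rule integral_cmult_right_ind)
  finally have "\<bar>\<integral>x. ?D x \<partial>m01\<bar> \<le> real (m - k) * \<Psi> / 2" .
  moreover have "(\<integral>x. ?D x \<partial>m01) = (refK \<psi> m - refK \<psi> k) / 2"
    using b by (subst Bochner_Integration.integral_diff)
      (auto intro!: bdd_meas_integrable_m01 simp: refK_def)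
  ultimately show ?thesis by simp
qed

lemma refK_abs_le:
  assumes "bdd_meas \<psi>" "\<And>y. \<bar>\<psi> y\<bar> \<le> \<Psi>"
  shows "\<bar>refK \<psi> m\<bar> \<le> real m * \<Psi>"
  using refK_diff_le[OF assms, of 0 m] by simp

text \<open>As \<open>(kleft ^^ n) (\<lambda>_. 1) x\<close> is the probability that the entrance
  time is at least \<open>n\<close>, the difference is the probability that it equals
  \<open>n\<close>.\<close>

lemma kleft_pow_right_ind:
  "(kleft ^^ n) right_ind x = (kleft ^^ n) (\<lambda>_. 1) x - (kleft ^^ Suc n) (\<lambda>_. 1) x"
proof -
  have l: "kleft (\<lambda>_. 1) = left_ind" by (simp add: kleft_def[abs_def] koop_linear)
  have "(right_ind :: real \<Rightarrow> real) = (\<lambda>x. 1 - left_ind x)" by (auto simp: indicator_def fun_eq_iff)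
  then show ?thesis
    by (simp only: kleft_pow_linear(2) funpow_Suc_right o_def l)
qed

lemma kleft_pow_Suc_one: "(kleft ^^ Suc n) (\<lambda>_. 1) = (kleft ^^ n) left_ind"
proof -
  have "kleft (\<lambda>_. 1) = left_ind" by (simp add: kleft_def[abs_def] koop_linear)
  then show ?thesis by (simp only: funpow_Suc_right o_def)
qed

lemma sum_kleft_pow_right_ind:
  "(\<Sum>n<m. (kleft ^^ n) right_ind x) = 1 - (kleft ^^ m) (\<lambda>_. 1) x"
  unfolding kleft_pow_right_ind by (subst sum_lessThan_telescope') simp

lemma sum_kleft_pow_right_ind_le: "(\<Sum>n<m. (kleft ^^ n) right_ind x) \<le> 1"
  unfolding sum_kleft_pow_right_ind using kleft_pow_nonneg[of "\<lambda>_. 1" m x] by simp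

lemma sum_kleft_left_abs_le:
  assumes "\<And>y. \<bar>\<psi> y\<bar> \<le> \<Psi> * g y"
  shows "\<bar>\<Sum>n<m. (kleft ^^ n) (\<lambda>x. left_ind x * \<psi> x) x\<bar>
    \<le> \<Psi> * (\<Sum>n<m. (kleft ^^ n) (\<lambda>x. left_ind x * g x) x)"
proof -
  have "\<bar>(kleft ^^ n) (\<lambda>x. left_ind x * \<psi> x) x\<bar> \<le> \<Psi> * (kleft ^^ n) (\<lambda>x. left_ind x * g x) x" for n
  proof -
    have "0 \<le> (kleft ^^ n) (\<lambda>x. \<Psi> * (left_ind x * g x) - left_ind x * \<psi> x) x"
      "0 \<le> (kleft ^^ n) (\<lambda>x. \<Psi> * (left_ind x * g x) + left_ind x * \<psi> x) x"
      using assms by (auto intro!: kleft_pow_nonneg simp: abs_le_iff indicator_def) (smt (verit))+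
    then show ?thesis by (simp add: kleft_pow_linear)
  qed
  then show ?thesis unfolding sum_distrib_left by (intro order_trans[OF sum_abs sum_mono])
qed

text \<open>An entrance at time \<open>n\<close> costs \<open>n\<close> steps of the reference sum,
  each worth at most \<Psi>; after summation by parts the total is \<Psi> times the truncated mean
  entrance time. The terms before the entrance cost the same once more, hence the 2.\<close>

lemma ent_refK_le:
  assumes \<psi>: "bdd_meas \<psi>" "\<And>y. \<bar>\<psi> y\<bar> \<le> \<Psi>"
  shows "\<bar>(\<Sum>n<m. refK \<psi> (m - n) * (kleft ^^ n) right_ind x) - refK \<psi> m\<bar> \<le> \<Psi> * tau m x"
    and "\<bar>ent \<psi> m x - refK \<psi> m\<bar> \<le> 2 * \<Psi> * tau m x"
proof -
  let ?r = "\<lambda>n. (kleft ^^ n) (\<lambda>_. 1) x"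
  have "(\<Sum>n<m. refK \<psi> (m - n) * (kleft ^^ n) right_ind x)
      = (\<Sum>n<m. (?r n - ?r (Suc n)) * refK \<psi> (m - n))"
    by (simp only: kleft_pow_right_ind mult.commute)
  also have "\<dots> = refK \<psi> m - (\<Sum>n<m. ?r (Suc n) * (refK \<psi> (m - n) - refK \<psi> (m - Suc n)))"
    by (subst abel_telescope) auto
  finally have "\<bar>(\<Sum>n<m. refK \<psi> (m - n) * (kleft ^^ n) right_ind x) - refK \<psi> m\<bar>
      = \<bar>\<Sum>n<m. ?r (Suc n) * (refK \<psi> (m - n) - refK \<psi> (m - Suc n))\<bar>" by simp
  also have "\<dots> \<le> (\<Sum>n<m. ?r (Suc n) * \<Psi>)"
  proof (rule order_trans[OF sum_abs sum_mono])
    fix n assume n: "n \<in> {..<m}"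
    have r: "0 \<le> ?r (Suc n)" by (rule kleft_pow_nonneg) simp
    have "m - n - (m - Suc n) = 1" using n by auto
    then have "\<bar>refK \<psi> (m - n) - refK \<psi> (m - Suc n)\<bar> \<le> \<Psi>"
      using refK_diff_le[OF \<psi>, of "m - Suc n" "m - n"] by simp
    then show "\<bar>?r (Suc n) * (refK \<psi> (m - n) - refK \<psi> (m - Suc n))\<bar> \<le> ?r (Suc n) * \<Psi>"
      using r unfolding abs_mult by (intro mult_mono) simp_all
  qed
  also have "\<dots> = \<Psi> * tau m x"
    unfolding kleft_pow_Suc_one tau_def sum_distrib_left by (simp add: mult.commute)
  finally show 1: "\<bar>(\<Sum>n<m. refK \<psi> (m - n) * (kleft ^^ n) right_ind x) - refK \<psi> m\<bar> \<le> \<Psi> * tau m x" .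
  have "\<bar>\<Sum>n<m. (kleft ^^ n) (\<lambda>x. left_ind x * \<psi> x) x\<bar> \<le> \<Psi> * tau m x"
    using sum_kleft_left_abs_le[of \<psi> \<Psi> "\<lambda>_. 1"] \<psi>(2) by (simp add: tau_def)
  with 1 show "\<bar>ent \<psi> m x - refK \<psi> m\<bar> \<le> 2 * \<Psi> * tau m x"
    unfolding ent_def by linarith
qed

text \<open>On the right half, \<open>(eop ^^ n) f\<close> is the distribution of the entrances at
  time \<open>n\<close>. Entrances at different times are disjoint events, so errors proportional to
  their masses add up to one proportional to the total mass.\<close>

lemma entrance_estimate:
  assumes f: "bdd_meas f" "\<And>x. 0 \<le> f x" and \<psi>: "bdd_meas \<psi>" and "0 \<le> c"
    and pieces: "\<And>n. n < m \<Longrightarrow>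
      \<bar>(\<integral>x. (eop ^^ n) f x * (right_ind x * birk \<psi> (m - n) x) \<partial>m01)
        - refK \<psi> (m - n) * (\<integral>x. (eop ^^ n) f x * right_ind x \<partial>m01)\<bar>
      \<le> c * (\<integral>x. (eop ^^ n) f x * right_ind x \<partial>m01)"
  shows "\<bar>\<integral>x. f x * (birk \<psi> m x - ent \<psi> m x) \<partial>m01\<bar> \<le> c * (\<integral>x. f x \<partial>m01)"
proof -
  let ?R = "\<lambda>n x. (kleft ^^ n) (\<lambda>x. right_ind x * birk \<psi> (m - n) x) x"
  let ?q = "\<lambda>n. \<integral>x. f x * (kleft ^^ n) right_ind x \<partial>m01"
  have b1: "bdd_meas (\<lambda>x. right_ind x * birk \<psi> k x)" for k
    using \<psi> by (intro bdd_meas_mult bdd_meas_indicator bdd_meas_birk) auto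
  have b2: "bdd_meas right_ind" by (rule bdd_meas_indicator) simp
  have i1: "integrable m01 (\<lambda>x. f x * ?R n x)" for n
    by (intro bdd_meas_integrable_m01 bdd_meas_mult[OF f(1) bdd_meas_kleft_pow[OF b1]])
  have i2: "integrable m01 (\<lambda>x. f x * (kleft ^^ n) right_ind x)" for n
    by (intro bdd_meas_integrable_m01 bdd_meas_mult[OF f(1) bdd_meas_kleft_pow[OF b2]])
  have "birk \<psi> m x - ent \<psi> m x = (\<Sum>n<m. ?R n x - refK \<psi> (m - n) * (kleft ^^ n) right_ind x)" for x
    unfolding birk_entrance[of \<psi> m x] ent_def by (simp add: sum_subtractf)
  then have "(\<integral>x. f x * (birk \<psi> m x - ent \<psi> m x) \<partial>m01)
      = (\<integral>x. (\<Sum>n<m. f x * ?R n x - refK \<psi> (m - n) * (f x * (kleft ^^ n) right_ind x)) \<partial>m01)"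
    by (simp add: sum_distrib_left right_diff_distrib mult_ac)
  also have "\<dots> = (\<Sum>n<m. (\<integral>x. f x * ?R n x \<partial>m01) - refK \<psi> (m - n) * ?q n)"
    using i1 i2 by (subst Bochner_Integration.integral_sum) simp_all
  finally have "\<bar>\<integral>x. f x * (birk \<psi> m x - ent \<psi> m x) \<partial>m01\<bar>
      = \<bar>\<Sum>n<m. (\<integral>x. f x * ?R n x \<partial>m01) - refK \<psi> (m - n) * ?q n\<bar>"
    by (rule arg_cong)
  also have "\<dots> \<le> (\<Sum>n<m. c * ?q n)"
  proof (rule order_trans[OF sum_abs sum_mono])
    fix n assume "n \<in> {..<m}"
    then have "n < m" by simp
    from pieces[OF this] show "\<bar>(\<integral>x. f x * ?R n x \<partial>m01) - refK \<psi> (m - n) * ?q n\<bar> \<le> c * ?q n"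
      unfolding eop_pow_dual[OF f(1) b1, of n] eop_pow_dual[OF f(1) b2, of n] .
  qed
  also have "\<dots> = c * (\<integral>x. f x * (\<Sum>n<m. (kleft ^^ n) right_ind x) \<partial>m01)"
  proof -
    have "(\<lambda>x. f x * (\<Sum>n<m. (kleft ^^ n) right_ind x)) = (\<lambda>x. \<Sum>n<m. f x * (kleft ^^ n) right_ind x)"
      by (simp only: sum_distrib_left)
    then show ?thesis
      using i2 by (simp only: Bochner_Integration.integral_sum sum_distrib_left)
  qed
  also have "\<dots> \<le> c * (\<integral>x. f x \<partial>m01)"
    using f sum_kleft_pow_right_ind_le
    by (intro mult_left_mono[OF _ \<open>0 \<le> c\<close>] integral_m01_mono bdd_meas_mult[OF f(1)] bdd_meas_sum
        bdd_meas_kleft_pow[OF b2] mult_left_le)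
  finally show ?thesis .
qed

text \<open>The solution \<open>B\<close> of \<open>B = 2 + 32 * lyap_mass + 7/8 * B\<close>, the recursion in the proof of
  \<open>coupling\<close>.\<close>

definition coupling_const :: real where "coupling_const = 8 * (2 + 32 * lyap_mass)"

lemma coupling_const_nonneg: "0 \<le> coupling_const"
  using lyap_mass_nonneg by (simp add: coupling_const_def)

lemma dcone_integral_tau_le:
  assumes f: "bdd_meas f" "\<And>x. 0 \<le> f x" "\<And>x. 0 < x \<Longrightarrow> x \<le> 1 \<Longrightarrow> f x \<le> c"
  shows "(\<integral>x. f x * tau m x \<partial>m01) \<le> c * lyap_mass"
proof -
  have "f 1 \<le> c" using f(3)[of 1] by simp
  then have "0 \<le> c" using f(2)[of 1] by linarith
  then have "(\<integral>x. f x * tau m x \<partial>m01) \<le> (\<integral>x. c * lyap x \<partial>m01)"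
    using f lyap_integrable tau_nonneg tau_le_lyap
    by (intro integrable_m01_mono bdd_meas_mult bdd_meas_tau mult_mono) auto
  then show ?thesis by (simp add: lyap_mass_def)
qed

text \<open>Strong induction on \<open>m\<close>. One step through the right branch spreads the mass
  over the unit interval with bounded density. At each later entrance an eighth of the entering mass
  is split off as a multiple of the uniform distribution, for which the comparison with
  \<open>refK\<close> is exact, and the rest is again in the cone. The recursion for the error
  contracts although the entrances occur at different times.\<close>

lemma coupling:
  assumes \<psi>: "bdd_meas \<psi>" "\<And>y. \<bar>\<psi> y\<bar> \<le> \<Psi>" and "dcone 4 {1/2<..1} f"
  shows "\<bar>(\<integral>x. f x * (right_ind x * birk \<psi> m x) \<partial>m01) - refK \<psi> m * (\<integral>x. f x * right_ind x \<partial>m01)\<bar>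
    \<le> coupling_const * \<Psi> * (\<integral>x. f x * right_ind x \<partial>m01)"
  using assms(3)
proof (induction m arbitrary: f rule: less_induct)
  case (less m)
  note fD = dconeD[OF less.prems]
  have \<Psi>: "0 \<le> \<Psi>" using \<psi>(2)[of 0] by linarith
  have br: "bdd_meas right_ind" by (rule bdd_meas_indicator) simp
  define q where "q = (\<integral>x. f x * right_ind x \<partial>m01)"
  have q0: "0 \<le> q" unfolding q_def using fD(2) by (intro integral_nonneg_AE) simp
  show ?case
  proof (cases m)
    case 0
    then show ?thesis using q0 \<Psi> coupling_const_nonneg by (simp add: q_def)
  next
    case (Suc M)
    define F where "F = rop f"
    have F: "dcone 2 {0<..1} F" unfolding F_def by (rule dcone_rop[OF less.prems])
    note FD = dconeD[OF F]
    have qF: "q = (\<integral>x. F x \<partial>m01)"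
      using rop_dual[OF fD(1), of "\<lambda>_. 1"] by (simp add: q_def F_def)
    \<comment> \<open>The 32 of \<open>dcone_upper\<close> is halved by the slope of the right
      branch.\<close>
    have Fle: "F x \<le> 16 * q" if "0 < x" "x \<le> 1" for x
      using dcone_upper[OF less.prems, of "(1 + x) / 2"] that by (simp add: F_def rop_def q_def)
    \<comment> \<open>The density bound makes the mean entrance time from \<open>F\<close> finite,
      however it behaves under the stationary measure.\<close>
    have Ft: "(\<integral>x. F x * tau M x \<partial>m01) \<le> 16 * q * lyap_mass"
      by (rule dcone_integral_tau_le[OF FD(1,2) Fle])
    let ?K = "refK \<psi>"
    have pieces: "\<bar>(\<integral>x. (eop ^^ n) F x * (right_ind x * birk \<psi> (M - n) x) \<partial>m01)
        - ?K (M - n) * (\<integral>x. (eop ^^ n) F x * right_ind x \<partial>m01)\<bar>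
      \<le> 7 / 8 * coupling_const * \<Psi> * (\<integral>x. (eop ^^ n) F x * right_ind x \<partial>m01)" if "n < M" for n
    proof -
      define G where "G = (eop ^^ n) F"
      have "dcone 2 {0<..1} G" unfolding G_def by (rule dcone_eop_pow[OF _ F]) simp
      then have G: "dcone 2 {1/2<..1} G" by (rule dcone_subset) auto
      note GD = dconeD[OF G]
      \<comment> \<open>Density \<open>c\<close> on length 1/2 carries an eighth of the entering
        mass \<open>4 * c\<close>, leaving \<open>7 / 2 * c\<close>. By \<open>dcone_lower\<close>
        it satisfies \<open>2 * c \<le> G\<close>, as \<open>dcone_minus_const\<close>
        demands.\<close>
      define c where "c = (\<integral>x. G x * right_ind x \<partial>m01) / 4"
      have c0: "0 \<le> c" unfolding c_def using GD(2) by (intro divide_nonneg_nonneg integral_nonneg_AE) simp_all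
      have cle: "2 * c \<le> G x" if "x \<in> {1/2<..1}" for x
        using dcone_lower[OF G that] by (simp add: c_def)
      define G' where "G' = (\<lambda>x. max 0 (G x - c))"
      have G': "dcone 4 {1/2<..1} G'"
        unfolding G'_def by (rule dcone_minus_const[OF G c0 cle])
      have split: "(\<integral>x. G x * (right_ind x * h x) \<partial>m01)
          = (\<integral>x. G' x * (right_ind x * h x) \<partial>m01) + c * (\<integral>x. right_ind x * h x \<partial>m01)"
        if "bdd_meas h" for h
      proof -
        have b: "bdd_meas (\<lambda>x. right_ind x * h x)" using that br by (rule bdd_meas_mult[rotated])
        have "AE x in m01. G x * (right_ind x * h x) = G' x * (right_ind x * h x) + c * (right_ind x * h x)"
          using AE_space
        proof eventually_elim
          case (elim x)
          then have "G' x + c = G x" if "1/2 < x"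
            using cle[of x] c0 that by (simp add: G'_def)
          then show ?case by (auto simp: indicator_def simp flip: distrib_right)
        qed
        then have "(\<integral>x. G x * (right_ind x * h x) \<partial>m01)
            = (\<integral>x. G' x * (right_ind x * h x) + c * (right_ind x * h x) \<partial>m01)"
          using b GD(1) dconeD(1)[OF G']
          by (intro integral_cong_AE) (auto intro!: measurable_m01 bdd_meas_measurable bdd_meas_intros)
        also have "\<dots> = (\<integral>x. G' x * (right_ind x * h x) \<partial>m01) + (\<integral>x. c * (right_ind x * h x) \<partial>m01)"
          by (intro Bochner_Integration.integral_add bdd_meas_integrable_m01
              bdd_meas_mult[OF dconeD(1)[OF G'] b] bdd_meas_cmult[OF b])
        finally show ?thesis by simp
      qed
      have s1: "(\<integral>x. G x * (right_ind x * birk \<psi> (M - n) x) \<partial>m01)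
          = (\<integral>x. G' x * (right_ind x * birk \<psi> (M - n) x) \<partial>m01) + c * (?K (M - n) / 2)"
        using split[OF bdd_meas_birk[OF \<psi>(1)]] by (simp add: refK_def)
      have s2: "4 * c = (\<integral>x. G' x * right_ind x \<partial>m01) + c / 2"
        using split[of "\<lambda>_. 1", OF bdd_meas_const] unfolding mult_1_right integral_right_ind
        by (simp add: c_def)
      have "\<bar>(\<integral>x. G' x * (right_ind x * birk \<psi> (M - n) x) \<partial>m01) - ?K (M - n) * (7 / 2 * c)\<bar>
          \<le> coupling_const * \<Psi> * (7 / 2 * c)"
      proof -
        have "M - n < m" using Suc by simp
        moreover from s2 have "(\<integral>x. G' x * right_ind x \<partial>m01) = 7 / 2 * c" by simp
        ultimately show ?thesis using less.IH[OF _ G', of "M - n"] by (simp only:)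
      qed
      moreover have "(\<integral>x. G' x * (right_ind x * birk \<psi> (M - n) x) \<partial>m01) - ?K (M - n) * (7 / 2 * c)
         = (\<integral>x. G x * (right_ind x * birk \<psi> (M - n) x) \<partial>m01) - ?K (M - n) * (4 * c)"
        unfolding s1 by (simp add: algebra_simps)
      moreover have "coupling_const * \<Psi> * (7 / 2 * c) = 7 / 8 * coupling_const * \<Psi> * (4 * c)" by simp
      ultimately show ?thesis by (simp add: G_def c_def)
    qed
    have bF: "bdd_meas (\<lambda>x. F x * g x)" if "bdd_meas g" for g using FD(1) that by (rule bdd_meas_mult)
    have e1: "\<bar>\<integral>x. F x * (birk \<psi> M x - ent \<psi> M x) \<partial>m01\<bar> \<le> 7 / 8 * coupling_const * \<Psi> * q"
      unfolding qF using FD(1,2) \<psi>(1) coupling_const_nonneg \<Psi>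
      by (intro entrance_estimate pieces) auto
    have e2: "\<bar>\<integral>x. F x * (ent \<psi> M x - ?K M) \<partial>m01\<bar> \<le> 2 * \<Psi> * (16 * q * lyap_mass)"
    proof -
      have "\<bar>\<integral>x. F x * (ent \<psi> M x - ?K M) \<partial>m01\<bar> \<le> (\<integral>x. 2 * \<Psi> * (F x * tau M x) \<partial>m01)"
      proof (intro order_trans[OF integral_abs_bound] integral_mono)
        fix x
        have "F x * \<bar>ent \<psi> M x - ?K M\<bar> \<le> F x * (2 * \<Psi> * tau M x)"
          using ent_refK_le(2)[OF \<psi>] FD(2) by (intro mult_left_mono)
        then show "\<bar>F x * (ent \<psi> M x - ?K M)\<bar> \<le> 2 * \<Psi> * (F x * tau M x)"
          using FD(2)[of x] by (simp add: abs_mult mult_ac)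
      qed (use \<psi> in \<open>auto intro!: bdd_meas_abs bdd_meas_integrable_m01 bdd_meas_mult bdd_meas_diff bdd_meas_ent bdd_meas_tau FD(1)\<close>)
      also have "\<dots> = 2 * \<Psi> * (\<integral>x. F x * tau M x \<partial>m01)" by simp
      also have "\<dots> \<le> 2 * \<Psi> * (16 * q * lyap_mass)" using Ft \<Psi> by (intro mult_left_mono) auto
      finally show ?thesis .
    qed
    have e3: "\<bar>\<integral>x. f x * (right_ind x * \<psi> x) \<partial>m01\<bar> \<le> \<Psi> * q"
    proof -
      have "\<bar>\<integral>x. f x * (right_ind x * \<psi> x) \<partial>m01\<bar> \<le> (\<integral>x. \<Psi> * (f x * right_ind x) \<partial>m01)"
      proof (intro order_trans[OF integral_abs_bound] integral_mono)
        fix x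
        have "f x * right_ind x * \<bar>\<psi> x\<bar> \<le> f x * right_ind x * \<Psi>"
          using \<psi>(2) fD(2) by (intro mult_left_mono) auto
        then show "\<bar>f x * (right_ind x * \<psi> x)\<bar> \<le> \<Psi> * (f x * right_ind x)"
          using fD(2)[of x] by (simp add: abs_mult mult_ac)
      qed (use \<psi> br in \<open>auto intro!: bdd_meas_abs bdd_meas_integrable_m01 bdd_meas_mult fD(1)\<close>)
      then show ?thesis by (simp add: q_def)
    qed
    have e4: "\<bar>?K M - ?K m\<bar> \<le> \<Psi>" using refK_diff_le[OF \<psi>, of M m] Suc by simp
    have s: "(\<integral>x. f x * (right_ind x * birk \<psi> m x) \<partial>m01)
        = (\<integral>x. f x * (right_ind x * \<psi> x) \<partial>m01) + (\<integral>x. F x * birk \<psi> M x \<partial>m01)"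
    proof -
      have bb: "bdd_meas (\<lambda>x. birk \<psi> M (2 * x - 1))"
        using \<psi> by - (rule bdd_meas_comp, auto)
      have "f x * (right_ind x * birk \<psi> m x)
         = f x * (right_ind x * \<psi> x) + f x * (right_ind x * birk \<psi> M (2 * x - 1))" for x
        unfolding Suc birk_Suc koop_split[of "birk \<psi> M"]
        by (auto simp: indicator_def kleft_def algebra_simps)
      then have "(\<integral>x. f x * (right_ind x * birk \<psi> m x) \<partial>m01)
         = (\<integral>x. f x * (right_ind x * \<psi> x) \<partial>m01) + (\<integral>x. f x * (right_ind x * birk \<psi> M (2 * x - 1)) \<partial>m01)"
        using fD(1) \<psi> br bb
        by (simp only:) (intro Bochner_Integration.integral_add bdd_meas_integrable_m01 bdd_meas_mult)
      also have "(\<integral>x. f x * (right_ind x * birk \<psi> M (2 * x - 1)) \<partial>m01) = (\<integral>x. F x * birk \<psi> M x \<partial>m01)"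
        unfolding F_def using fD(1) \<psi> by (intro rop_dual[symmetric] bdd_meas_birk)
      finally show ?thesis .
    qed
    have i: "integrable m01 (\<lambda>x. F x * (birk \<psi> M x - ent \<psi> M x))"
      "integrable m01 (\<lambda>x. F x * (ent \<psi> M x - ?K M))" "integrable m01 F"
      using \<psi>(1) FD(1)
      by (auto intro!: bdd_meas_integrable_m01 bF bdd_meas_diff bdd_meas_birk bdd_meas_ent)
    have s': "(\<integral>x. F x * birk \<psi> M x \<partial>m01) = (\<integral>x. F x * (birk \<psi> M x - ent \<psi> M x) \<partial>m01)
        + (\<integral>x. F x * (ent \<psi> M x - ?K M) \<partial>m01) + ?K M * q"
    proof -
      have "(\<integral>x. F x * birk \<psi> M x \<partial>m01) = (\<integral>x. F x * (birk \<psi> M x - ent \<psi> M x)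
        + F x * (ent \<psi> M x - ?K M) + ?K M * F x \<partial>m01)"
        by (intro Bochner_Integration.integral_cong) (auto simp: algebra_simps)
      also have "\<dots> = (\<integral>x. F x * (birk \<psi> M x - ent \<psi> M x) \<partial>m01)
        + (\<integral>x. F x * (ent \<psi> M x - ?K M) \<partial>m01) + (\<integral>x. ?K M * F x \<partial>m01)"
        using i by simp
      finally show ?thesis by (simp add: qF)
    qed
    have "\<bar>(?K M - ?K m) * q\<bar> \<le> \<Psi> * q"
      using e4 q0 unfolding abs_mult by (intro mult_mono) auto
    moreover have "(\<integral>x. f x * (right_ind x * birk \<psi> m x) \<partial>m01) - ?K m * q
      = (\<integral>x. f x * (right_ind x * \<psi> x) \<partial>m01) + (\<integral>x. F x * (birk \<psi> M x - ent \<psi> M x) \<partial>m01)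
        + (\<integral>x. F x * (ent \<psi> M x - ?K M) \<partial>m01) + (?K M - ?K m) * q"
      unfolding s s' by (simp add: algebra_simps)
    ultimately have "\<bar>(\<integral>x. f x * (right_ind x * birk \<psi> m x) \<partial>m01) - ?K m * q\<bar>
      \<le> \<Psi> * q + 7 / 8 * coupling_const * \<Psi> * q + 2 * \<Psi> * (16 * q * lyap_mass) + \<Psi> * q"
      using e1 e2 e3 by linarith
    also have "\<dots> = (2 + 32 * lyap_mass + 7 / 8 * coupling_const) * \<Psi> * q" by (simp add: algebra_simps)
    also have "\<dots> \<le> coupling_const * \<Psi> * q" 
      using \<Psi> q0 by (intro mult_right_mono) (auto simp: coupling_const_def)
    finally show ?thesis by (simp add: q_def)
  qed
qed

text \<open>The densities \<open>(eop ^^ n) f\<close> at the entrances stay in the cone of exponent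
  4, so \<open>coupling\<close> applies to each of them.\<close>

lemma entrance:
  assumes \<psi>: "bdd_meas \<psi>" "\<And>y. \<bar>\<psi> y\<bar> \<le> \<Psi>" and f: "dcone 4 {0<..1} f"
  shows "\<bar>\<integral>x. f x * (birk \<psi> m x - ent \<psi> m x) \<partial>m01\<bar> \<le> coupling_const * \<Psi> * (\<integral>x. f x \<partial>m01)"
proof (intro entrance_estimate coupling[OF \<psi>])
  have "0 \<le> \<Psi>" using \<psi>(2)[of 0] by linarith
  then show "0 \<le> coupling_const * \<Psi>" using coupling_const_nonneg by simp
  fix n
  have "dcone 4 {0<..1} ((eop ^^ n) f)" using f by (intro dcone_eop_pow) auto
  then show "dcone 4 {1/2<..1} ((eop ^^ n) f)" by (rule dcone_subset) auto
qed (use \<psi> dconeD[OF f] in auto)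

end

section \<open>Uniqueness of the asymptotic mean\<close>

lemma measurable_imap_m01: "0 < \<beta> \<Longrightarrow> imap \<beta> \<in> measurable m01 m01"
  unfolding m01_def using imap_unit by (intro measurable_restrict_space3) auto

lemma sets_m01_borel: "A \<in> sets m01 \<Longrightarrow> A \<in> sets borel"
  unfolding m01_def by (auto simp: sets_restrict_space)

lemma integrable_mult_bdd_meas:
  assumes f: "integrable m01 f" and g: "bdd_meas g"
  shows "integrable m01 (\<lambda>x. f x * g x :: real)"
proof -
  obtain M where M: "0 \<le> M" "\<And>x. \<bar>g x\<bar> \<le> M" using g by (metis bdd_measE)
  have "norm (f x * g x) \<le> norm (M * f x)" for x
    using M mult_right_mono[OF M(2)[of x], of "\<bar>f x\<bar>"] by (simp add: abs_mult mult.commute)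
  moreover have "integrable m01 (\<lambda>x. M * f x)" using f by simp
  moreover have "(\<lambda>x. f x * g x) \<in> borel_measurable m01"
    by (rule borel_measurable_times[OF borel_measurable_integrable[OF f]
          measurable_m01[OF bdd_meas_measurable[OF g]]])
  ultimately show ?thesis
    by (intro Bochner_Integration.integrable_bound[of _ "\<lambda>x. M * f x" "\<lambda>x. f x * g x"] AE_I2)
qed

context intermittent_system
begin

text \<open>Combines \<open>entrance\<close> with \<open>ent_refK_le\<close>. The truncated time is
  kept as an integral because it is later applied to families of densities without a common
  bound.\<close>

lemma coupling_bound:
  assumes \<psi>: "bdd_meas \<psi>" "\<And>y. \<bar>\<psi> y\<bar> \<le> \<Psi>" and f: "dcone 4 {0<..1} f"
  shows "\<bar>(\<integral>x. f x * birk \<psi> m x \<partial>m01) - refK \<psi> m * (\<integral>x. f x \<partial>m01)\<bar>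
    \<le> coupling_const * \<Psi> * (\<integral>x. f x \<partial>m01) + 2 * \<Psi> * (\<integral>x. f x * tau m x \<partial>m01)"
proof -
  note fD = dconeD[OF f]
  have \<Psi>: "0 \<le> \<Psi>" using \<psi>(2)[of 0] by linarith
  have i: "integrable m01 (\<lambda>x. f x * (birk \<psi> m x - ent \<psi> m x))"
    "integrable m01 (\<lambda>x. f x * (ent \<psi> m x - refK \<psi> m))" "integrable m01 f"
    "integrable m01 (\<lambda>x. f x * tau m x)"
    using \<psi>(1) fD(1)
    by (auto intro!: bdd_meas_integrable_m01 bdd_meas_mult bdd_meas_diff bdd_meas_birk bdd_meas_ent bdd_meas_tau)
  have "(\<integral>x. f x * birk \<psi> m x \<partial>m01) = (\<integral>x. f x * (birk \<psi> m x - ent \<psi> m x)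
        + f x * (ent \<psi> m x - refK \<psi> m) + refK \<psi> m * f x \<partial>m01)"
    by (intro Bochner_Integration.integral_cong) (auto simp: algebra_simps)
  then have s: "(\<integral>x. f x * birk \<psi> m x \<partial>m01) - refK \<psi> m * (\<integral>x. f x \<partial>m01)
      = (\<integral>x. f x * (birk \<psi> m x - ent \<psi> m x) \<partial>m01) + (\<integral>x. f x * (ent \<psi> m x - refK \<psi> m) \<partial>m01)"
    using i by simp
  have "\<bar>\<integral>x. f x * (ent \<psi> m x - refK \<psi> m) \<partial>m01\<bar> \<le> (\<integral>x. 2 * \<Psi> * (f x * tau m x) \<partial>m01)"
  proof (intro order_trans[OF integral_abs_bound] integral_mono)
    fix x
    have "f x * \<bar>ent \<psi> m x - refK \<psi> m\<bar> \<le> f x * (2 * \<Psi> * tau m x)"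
      using ent_refK_le(2)[OF \<psi>] fD(2) by (intro mult_left_mono)
    then show "\<bar>f x * (ent \<psi> m x - refK \<psi> m)\<bar> \<le> 2 * \<Psi> * (f x * tau m x)"
      using fD(2)[of x] by (simp add: abs_mult mult_ac)
  qed (use i in auto)
  also have "\<dots> = 2 * \<Psi> * (\<integral>x. f x * tau m x \<partial>m01)" by simp
  finally show ?thesis unfolding s using entrance[OF \<psi> f, of m] by linarith
qed

text \<open>The Birkhoff mean from the possibly signed density \<open>f\<close> grows like that of
  the reference distribution. Being linear and closed in L1, the property extends from the cone to
  all integrable \<open>f\<close>, in particular to the density of a stationary measure.\<close>

definition asymp_ref :: "(real \<Rightarrow> real) \<Rightarrow> (real \<Rightarrow> real) \<Rightarrow> bool" where
  "asymp_ref \<psi> f \<longleftrightarrow>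
    (\<lambda>m. ((\<integral>x. f x * birk \<psi> m x \<partial>m01) - refK \<psi> m * (\<integral>x. f x \<partial>m01)) / real m) \<longlonglongrightarrow> 0"

lemma asymp_ref_dcone:
  assumes \<psi>: "bdd_meas \<psi>" and f: "dcone 4 {0<..1} f"
  shows "asymp_ref \<psi> f"
proof -
  obtain \<Psi> where \<Psi>: "0 \<le> \<Psi>" "\<And>x. \<bar>\<psi> x\<bar> \<le> \<Psi>" using \<psi> by (metis bdd_measE)
  obtain c where c: "\<And>x. \<bar>f x\<bar> \<le> c" using dconeD(1)[OF f] by (metis bdd_measE)
  define B where "B = coupling_const * \<Psi> * (\<integral>x. f x \<partial>m01) + 2 * \<Psi> * (c * lyap_mass)"
  have le: "\<bar>(\<integral>x. f x * birk \<psi> m x \<partial>m01) - refK \<psi> m * (\<integral>x. f x \<partial>m01)\<bar> \<le> B" for m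
  proof -
    have "(\<integral>x. f x * tau m x \<partial>m01) \<le> c * lyap_mass"
      using dconeD[OF f] c by (intro dcone_integral_tau_le) (auto simp: abs_le_iff)
    then have "2 * \<Psi> * (\<integral>x. f x * tau m x \<partial>m01) \<le> 2 * \<Psi> * (c * lyap_mass)"
      using \<Psi> by (intro mult_left_mono) auto
    then show ?thesis using coupling_bound[OF \<psi> \<Psi>(2) f, of m] unfolding B_def by linarith
  qed
  have "(\<lambda>m. B / real m) \<longlonglongrightarrow> 0" by (rule lim_const_over_n)
  then show ?thesis unfolding asymp_ref_def
  proof (rule Lim_null_comparison[rotated])
    show "\<forall>\<^sub>F m in sequentially. norm (((\<integral>x. f x * birk \<psi> m x \<partial>m01)
        - refK \<psi> m * (\<integral>x. f x \<partial>m01)) / real m) \<le> B / real m"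
      using le by (intro always_eventually allI) (simp add: divide_right_mono)
  qed
qed

lemma asymp_ref_add:
  assumes "bdd_meas \<psi>" "integrable m01 f" "integrable m01 g" "asymp_ref \<psi> f" "asymp_ref \<psi> g"
  shows "asymp_ref \<psi> (\<lambda>x. f x + g x)"
proof -
  have "(\<integral>x. (f x + g x) * birk \<psi> m x \<partial>m01) = (\<integral>x. f x * birk \<psi> m x \<partial>m01) + (\<integral>x. g x * birk \<psi> m x \<partial>m01)" for m
    unfolding distrib_right using assms
    by (intro Bochner_Integration.integral_add integrable_mult_bdd_meas bdd_meas_birk)
  then have "((\<integral>x. (f x + g x) * birk \<psi> m x \<partial>m01) - refK \<psi> m * (\<integral>x. f x + g x \<partial>m01)) / real m
      = ((\<integral>x. f x * birk \<psi> m x \<partial>m01) - refK \<psi> m * (\<integral>x. f x \<partial>m01)) / real m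
      + ((\<integral>x. g x * birk \<psi> m x \<partial>m01) - refK \<psi> m * (\<integral>x. g x \<partial>m01)) / real m" for m
    using assms(2,3) by (simp add: distrib_left diff_divide_distrib add_divide_distrib)
  then show ?thesis
    using tendsto_add[OF assms(4,5)[unfolded asymp_ref_def]] by (simp add: asymp_ref_def)
qed

lemma asymp_ref_cmult:
  assumes "asymp_ref \<psi> f"
  shows "asymp_ref \<psi> (\<lambda>x. c * f x)"
  using tendsto_mult_left[OF assms[unfolded asymp_ref_def], of c]
  by (simp add: asymp_ref_def algebra_simps)

text \<open>Both \<open>birk\<close> and \<open>refK\<close> are at most \<open>m * \<Psi>\<close>,
  so an L1 error \<open>d\<close> changes the quotient by at most \<open>2 * \<Psi> * d\<close>,
  uniformly in \<open>m\<close>.\<close>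

lemma asymp_ref_closed:
  assumes \<psi>: "bdd_meas \<psi>" and f: "integrable m01 f"
    and approx: "\<And>e. 0 < e \<Longrightarrow> \<exists>g. integrable m01 g \<and> asymp_ref \<psi> g \<and> (\<integral>x. \<bar>f x - g x\<bar> \<partial>m01) \<le> e"
  shows "asymp_ref \<psi> f"
  unfolding asymp_ref_def LIMSEQ_iff
proof (intro allI impI)
  fix e :: real assume "0 < e"
  obtain \<Psi> where \<Psi>: "0 \<le> \<Psi>" "\<And>x. \<bar>\<psi> x\<bar> \<le> \<Psi>" using \<psi> by (metis bdd_measE)
  define d where "d = e / (4 * (\<Psi> + 1))"
  have d: "0 < d" using \<open>0 < e\<close> \<Psi> by (simp add: d_def)
  from approx[OF this] obtain g where g: "integrable m01 g" "asymp_ref \<psi> g"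
    "(\<integral>x. \<bar>f x - g x\<bar> \<partial>m01) \<le> d" by blast
  let ?e = "\<lambda>f m. (\<integral>x. f x * birk \<psi> m x \<partial>m01) - refK \<psi> m * (\<integral>x. f x \<partial>m01)"
  from g(2)[unfolded asymp_ref_def LIMSEQ_iff, rule_format, of "e / 2"] \<open>0 < e\<close>
  obtain N where N: "\<And>m. N \<le> m \<Longrightarrow> \<bar>?e g m / real m\<bar> < e / 2" by auto
  have "\<bar>?e f m / real m\<bar> < e" if m: "max N 1 \<le> m" for m
  proof -
    have i: "integrable m01 (\<lambda>x. f x * birk \<psi> m x)" "integrable m01 (\<lambda>x. g x * birk \<psi> m x)"
      using f g \<psi> by (auto intro!: integrable_mult_bdd_meas)
    have "?e f m - ?e g m = (\<integral>x. f x * birk \<psi> m x - g x * birk \<psi> m x \<partial>m01) - refK \<psi> m * (\<integral>x. f x - g x \<partial>m01)"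
      using i f g(1) by (simp add: algebra_simps)
    also have "\<dots> = (\<integral>x. (f x - g x) * birk \<psi> m x \<partial>m01) - refK \<psi> m * (\<integral>x. f x - g x \<partial>m01)"
      by (simp add: left_diff_distrib)
    finally have eq: "?e f m - ?e g m = \<dots>" .
    have "\<bar>\<integral>x. (f x - g x) * birk \<psi> m x \<partial>m01\<bar> \<le> (\<integral>x. real m * \<Psi> * \<bar>f x - g x\<bar> \<partial>m01)"
    proof (intro order_trans[OF integral_abs_bound] integral_mono)
      fix x
      show "\<bar>(f x - g x) * birk \<psi> m x\<bar> \<le> real m * \<Psi> * \<bar>f x - g x\<bar>"
        using mult_right_mono[OF birk_abs_le[OF \<Psi>(2), where m = m and x = x], of "\<bar>f x - g x\<bar>"]
        by (simp add: abs_mult mult_ac)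
    qed (use f g \<psi> in \<open>auto intro!: integrable_abs integrable_mult_bdd_meas Bochner_Integration.integrable_diff\<close>)
    also have "\<dots> \<le> real m * \<Psi> * d" using g(3) \<Psi> by (simp add: mult_left_mono)
    finally have 1: "\<bar>\<integral>x. (f x - g x) * birk \<psi> m x \<partial>m01\<bar> \<le> real m * \<Psi> * d" .
    have "\<bar>refK \<psi> m * (\<integral>x. f x - g x \<partial>m01)\<bar> \<le> (real m * \<Psi>) * d"
      unfolding abs_mult using refK_abs_le[OF \<psi> \<Psi>(2)] \<Psi>(1)
        order_trans[OF integral_abs_bound[of m01 "\<lambda>x. f x - g x"] g(3)]
      by (intro mult_mono) auto
    with 1 have "\<bar>?e f m\<bar> \<le> \<bar>?e g m\<bar> + real m * (2 * \<Psi> * d)" using eq by (simp add: algebra_simps)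
    then have "\<bar>?e f m / real m\<bar> \<le> \<bar>?e g m / real m\<bar> + 2 * \<Psi> * d"
      using m by (simp add: abs_divide field_simps)
    also have "2 * \<Psi> * d \<le> e / 2"
      using \<Psi> \<open>0 < e\<close> by (simp add: d_def field_simps)
    finally have "\<bar>?e f m / real m\<bar> \<le> \<bar>?e g m / real m\<bar> + e / 2" by simp
    moreover have "\<bar>?e g m / real m\<bar> < e / 2" using N[of m] m by simp
    ultimately show ?thesis by linarith
  qed
  then show "\<exists>N. \<forall>m\<ge>N. norm (?e f m / real m - 0) < e"
    by (intro exI[of _ "max N 1"]) simp
qed

lemma asymp_ref_const:
  assumes "bdd_meas \<psi>"
  shows "asymp_ref \<psi> (\<lambda>_. c)"
proof -
  have "dcone 4 {0<..1} (\<lambda>_. 1)" by (rule dcone_const) auto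
  from asymp_ref_cmult[OF asymp_ref_dcone[OF assms this], of c] show ?thesis by simp
qed

lemma asymp_ref_diff:
  assumes "bdd_meas \<psi>" "integrable m01 f" "integrable m01 g" "asymp_ref \<psi> f" "asymp_ref \<psi> g"
  shows "asymp_ref \<psi> (\<lambda>x. f x - g x)"
  using asymp_ref_add[OF assms(1,2) _ assms(4) asymp_ref_cmult[OF assms(5), of "-1"]] assms by simp

text \<open>The half-line is approximated from above by a decreasing ramp of slope
  \<open>1 / e\<close>. Adding this slope puts the ramp into the cone by
  \<open>lipschitz_dcone\<close>, and the constant is subtracted again by linearity.\<close>

lemma asymp_ref_atMost:
  assumes \<psi>: "bdd_meas \<psi>"
  shows "asymp_ref \<psi> (indicator {..a})"
proof (rule asymp_ref_closed[OF \<psi>])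
  show "integrable m01 (indicator {..a} :: real \<Rightarrow> real)"
    by (intro bdd_meas_integrable_m01 bdd_meas_indicator) simp
  fix e :: real assume "0 < e"
  define k where "k = 1 / e"
  have k: "0 < k" using \<open>0 < e\<close> by (simp add: k_def)
  define r where "r = (\<lambda>x. max 0 (min 1 (1 - (x - a) * k)))"
  have r01: "0 \<le> r x" "r x \<le> 1" for x by (auto simp: r_def)
  have br: "bdd_meas r" unfolding r_def by (rule bdd_measI[of _ 1]) auto
  have "dcone 1 {0<..1} (\<lambda>x. r x + k)"
  proof (rule lipschitz_dcone[where \<Lambda> = k])
    show "bdd_meas (\<lambda>x. r x + k)" using br by auto
    fix x y :: real assume xy: "0 < x" "x \<le> y"
    have "(x - a) * k \<le> (y - a) * k" using xy k by (intro mult_right_mono) auto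
    moreover have "(y - a) * k - (x - a) * k = k * (y - x)" by (simp add: algebra_simps)
    ultimately show "r y + k \<le> r x + k" "r x + k - (r y + k) \<le> k * (y - x)"
      by (auto simp: r_def max_def min_def)
  qed (use k r01 in \<open>auto intro: add_nonneg_nonneg\<close>)
  then have "dcone 4 {0<..1} (\<lambda>x. r x + k)" by (rule dcone_weaken) auto
  then have "asymp_ref \<psi> (\<lambda>x. (r x + k) - k)"
    using \<psi> br
    by (intro asymp_ref_diff asymp_ref_const asymp_ref_dcone bdd_meas_integrable_m01 bdd_meas_add) auto
  moreover have "(\<integral>x. \<bar>indicator {..a} x - r x\<bar> \<partial>m01) \<le> e"
  proof -
    have "\<bar>indicator {..a} x - r x\<bar> \<le> indicator {a..a + e} x" for x
    proof (cases "x \<le> a")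
      case True
      then have "(x - a) * k \<le> 0" using k by (simp add: mult_nonpos_nonneg)
      then show ?thesis using True by (simp add: r_def)
    next
      case False
      then show ?thesis
      proof (cases "x \<le> a + e")
        case nle: False
        then have "1 \<le> (x - a) * k" using \<open>0 < e\<close> by (simp add: k_def field_simps)
        then show ?thesis using False nle by (simp add: r_def)
      qed (use r01 in auto)
    qed
    then have "(\<integral>x. \<bar>indicator {..a} x - r x\<bar> \<partial>m01) \<le> (\<integral>x. indicator {a..a + e} x \<partial>m01)"
      using br by (intro integral_mono bdd_meas_integrable_m01 bdd_meas_abs bdd_meas_diff bdd_meas_indicator) auto
    also have "\<dots> = (\<integral>x. indicator {0..1} x * indicator {a..a + e} x \<partial>lborel)"
      by (rule integral_m01) auto
    also have "\<dots> \<le> (\<integral>x. indicator {a..a + e} x \<partial>lborel)"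
    proof (rule integral_mono)
      have "integrable lborel (indicator ({0..1} \<inter> {a..a + e}) :: real \<Rightarrow> real)"
        by (intro integrable_real_indicator)
          (auto intro: le_less_trans[OF emeasure_mono[of _ "{0..1}"]])
      moreover have "(indicator ({0..1} \<inter> {a..a + e}) :: real \<Rightarrow> real)
          = (\<lambda>x. indicator {0..1} x * indicator {a..a + e} x)"
        by (rule ext) (rule indicator_inter_arith)
      ultimately show "integrable lborel (\<lambda>x. indicator {0..1} x * indicator {a..a + e} x :: real)"
        by (simp only:)
      show "integrable lborel (indicat_real {a..a + e})"
        by (intro integrable_real_indicator) (auto simp: emeasure_lborel_Icc_eq)
    qed (auto split: split_indicator)
    also have "\<dots> = e" using \<open>0 < e\<close> by simp
    finally show ?thesis .
  qed
  ultimately show "\<exists>g. integrable m01 g \<and> asymp_ref \<psi> g \<and> (\<integral>x. \<bar>indicator {..a} x - g x\<bar> \<partial>m01) \<le> e"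
    using br by (intro exI[of _ r]) auto
qed

text \<open>Dynkin's argument from the half-lines; countable disjoint unions are L1 limits of finite
  ones.\<close>

lemma asymp_ref_indicator:
  assumes \<psi>: "bdd_meas \<psi>" and A: "A \<in> sets borel"
  shows "asymp_ref \<psi> (indicator A)"
proof -
  have int: "integrable m01 (indicator B :: real \<Rightarrow> real)" if "B \<in> sets borel" for B
    using that by (intro bdd_meas_integrable_m01 bdd_meas_indicator)
  have S: "sets borel = sigma_sets UNIV (range (\<lambda>a::real. {..a}))"
    unfolding borel_eq_atMost by simp
  have "Int_stable (range (\<lambda>a::real. {..a}))"
    by (auto simp: Int_stable_def)
  moreover have "range (\<lambda>a::real. {..a}) \<subseteq> Pow UNIV" by simp
  moreover have "A \<in> sigma_sets UNIV (range (\<lambda>a::real. {..a}))" using A S by simp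
  ultimately show ?thesis
  proof (rule sigma_sets_induct_disjoint[where P = "\<lambda>A. asymp_ref \<psi> (indicator A)"])
    show "asymp_ref \<psi> (indicator B)" if "B \<in> range (\<lambda>a::real. {..a})" for B
      using that asymp_ref_atMost[OF \<psi>] by auto
    show "asymp_ref \<psi> (indicator {})"
      using asymp_ref_const[OF \<psi>, of 0] by (simp add: indicator_def[abs_def])
    show "asymp_ref \<psi> (indicator (UNIV - B))"
      if "B \<in> sigma_sets UNIV (range (\<lambda>a::real. {..a}))" "asymp_ref \<psi> (indicator B)" for B
    proof -
      have "asymp_ref \<psi> (\<lambda>x. 1 - indicator B x)"
        using that \<psi> S int by (intro asymp_ref_diff asymp_ref_const) auto
      also have "(\<lambda>x. 1 - indicator B x) = (indicator (UNIV - B) :: real \<Rightarrow> real)"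
        by (auto simp: indicator_def fun_eq_iff)
      finally show ?thesis .
    qed
    fix D :: "nat \<Rightarrow> real set"
    assume D: "disjoint_family D" "range D \<subseteq> sigma_sets UNIV (range (\<lambda>a::real. {..a}))"
      "\<And>i. asymp_ref \<psi> (indicator (D i))"
    then have Dm: "D i \<in> sets borel" for i using S by auto
    show "asymp_ref \<psi> (indicator (\<Union>i. D i))"
    proof (rule asymp_ref_closed[OF \<psi>])
      show iU: "integrable m01 (indicator (\<Union>i. D i) :: real \<Rightarrow> real)" using Dm by (intro int) auto
      fix e :: real assume "0 < e"
      have fin: "asymp_ref \<psi> (\<lambda>x. \<Sum>i<n. indicator (D i) x)" for n
        by (induction n) (use \<psi> D Dm int in \<open>auto intro!: asymp_ref_add asymp_ref_const[where c = 0, simplified]\<close>)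
      have "(\<lambda>n. \<integral>x. \<bar>indicat_real (\<Union>i. D i) x - (\<Sum>i<n. indicator (D i) x)\<bar> \<partial>m01)
          \<longlonglongrightarrow> (\<integral>x. 0 \<partial>m01)"
      proof (rule integral_dominated_convergence[where w = "\<lambda>_. 1"])
        have sum_eq: "(\<Sum>i<n. indicator (D i) x) = (indicator (\<Union>i<n. D i) x :: real)" for n x
          using D(1) by (subst indicator_UN_disjoint) (auto simp: disjoint_family_on_def)
        show "AE x in m01. norm (\<bar>indicat_real (\<Union>i. D i) x - (\<Sum>i<n. indicator (D i) x)\<bar>) \<le> (1::real)" for n
          unfolding sum_eq by (auto simp: indicator_def)
        show "AE x in m01. (\<lambda>n. \<bar>indicat_real (\<Union>i. D i) x - (\<Sum>i<n. indicator (D i) x)\<bar>) \<longlonglongrightarrow> (0::real)"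
        proof (rule AE_I2)
          fix x
          have "\<forall>\<^sub>F n in sequentially. \<bar>indicat_real (\<Union>i. D i) x - (\<Sum>i<n. indicator (D i) x)\<bar> = (0::real)"
          proof (cases "\<exists>i. x \<in> D i")
            case True
            then obtain i where "x \<in> D i" by blast
            then show ?thesis unfolding sum_eq
              by (intro eventually_sequentiallyI[of "Suc i"]) (auto simp: indicator_def)
          qed (simp add: indicator_def)
          then show "(\<lambda>n. \<bar>indicat_real (\<Union>i. D i) x - (\<Sum>i<n. indicator (D i) x)\<bar>) \<longlonglongrightarrow> (0::real)"
            by (rule tendsto_eventually)
        qed
      qed (use Dm in \<open>auto intro!: measurable_m01\<close>)
      then have "(\<lambda>n. \<integral>x. \<bar>indicat_real (\<Union>i. D i) x - (\<Sum>i<n. indicator (D i) x)\<bar> \<partial>m01) \<longlonglongrightarrow> 0"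
        by simp
      from this[unfolded LIMSEQ_iff, rule_format, OF \<open>0 < e\<close>] obtain n where
        "\<bar>\<integral>x. \<bar>indicat_real (\<Union>i. D i) x - (\<Sum>i<n. indicator (D i) x)\<bar> \<partial>m01\<bar> < e" by auto
      then show "\<exists>g. integrable m01 g \<and> asymp_ref \<psi> g \<and> (\<integral>x. \<bar>indicator (\<Union>i. D i) x - g x\<bar> \<partial>m01) \<le> e"
        using fin Dm int by (intro exI[of _ "\<lambda>x. \<Sum>i<n. indicator (D i) x"]) auto
    qed
  qed
qed

lemma asymp_ref_integrable:
  assumes \<psi>: "bdd_meas \<psi>" and f: "integrable m01 f"
  shows "asymp_ref \<psi> f"
  using f
proof (induct rule: integrable_induct)
  case (base A c)
  then have "asymp_ref \<psi> (\<lambda>x. c * indicator A x)"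
    by (intro asymp_ref_cmult asymp_ref_indicator[OF \<psi>] sets_m01_borel)
  then show ?case by (simp add: mult.commute)
next
  case (add f g)
  then show ?case using \<psi> by (intro asymp_ref_add)
next
  case (lim f s)
  show ?case
  proof (rule asymp_ref_closed[OF \<psi> lim(5)])
    fix e :: real assume "0 < e"
    have "(\<lambda>i. \<integral>x. \<bar>f x - s i x\<bar> \<partial>m01) \<longlonglongrightarrow> (\<integral>x. 0 \<partial>m01)"
    proof (rule integral_dominated_convergence[where w = "\<lambda>x. 3 * \<bar>f x\<bar>"])
      show "AE x in m01. (\<lambda>i. \<bar>f x - s i x\<bar>) \<longlonglongrightarrow> 0"
      proof (rule AE_I2)
        fix x assume "x \<in> space m01"
        then have "(\<lambda>i. \<bar>f x - s i x\<bar>) \<longlonglongrightarrow> \<bar>f x - f x\<bar>"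
          using lim(3) by (intro tendsto_intros)
        then show "(\<lambda>i. \<bar>f x - s i x\<bar>) \<longlonglongrightarrow> 0" by simp
      qed
      show "AE x in m01. norm \<bar>f x - s i x\<bar> \<le> 3 * \<bar>f x\<bar>" for i
      proof (rule AE_I2)
        fix x assume "x \<in> space m01"
        then show "norm \<bar>f x - s i x\<bar> \<le> 3 * \<bar>f x\<bar>" using lim(4)[of x i] by auto
      qed
    qed (use lim(1,5) in auto)
    then have "(\<lambda>i. \<integral>x. \<bar>f x - s i x\<bar> \<partial>m01) \<longlonglongrightarrow> 0" by simp
    from this[unfolded LIMSEQ_iff, rule_format, OF \<open>0 < e\<close>] obtain i where
      "\<bar>\<integral>x. \<bar>f x - s i x\<bar> \<partial>m01\<bar> < e" by auto
    then show "\<exists>g. integrable m01 g \<and> asymp_ref \<psi> g \<and> (\<integral>x. \<bar>f x - g x\<bar> \<partial>m01) \<le> e"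
      using lim(1,2) by (intro exI[of _ "s i"]) auto
  qed
qed

text \<open>Passage from sets to bounded functions. With the weights of the locale it covers the
  stationary measure, and in a one-point system the invariant measure of a single map.\<close>

lemma integral_koop_stationary:
  assumes fin: "finite_measure \<mu>" and sets: "sets \<mu> = sets m01"
    and inv: "\<And>A. A \<in> sets m01 \<Longrightarrow> measure \<mu> A = (\<Sum>\<beta>\<in>\<Omega>. p \<beta> * measure \<mu> (imap \<beta> -` A \<inter> {0..1}))"
    and \<psi>: "bdd_meas \<psi>"
  shows "(\<integral>x. koop \<psi> x \<partial>\<mu>) = (\<integral>x. \<psi> x \<partial>\<mu>)"
proof -
  interpret finite_measure \<mu> by fact
  have sp: "space \<mu> = {0..1}" using sets_eq_imp_space_eq[OF sets] by simp
  have T: "imap \<beta> \<in> measurable \<mu> \<mu>" if "\<beta> \<in> \<Omega>" for \<beta>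
    using measurable_imap_m01[of \<beta>] Omega_bounds[OF that] measurable_cong_sets[OF sets sets] by blast
  have Tsp: "imap \<beta> x \<in> space \<mu>" if "\<beta> \<in> \<Omega>" "x \<in> space \<mu>" for \<beta> x
    using measurable_space[OF T] that by blast
  have nn: "integrable \<mu> u" if "u \<in> borel_measurable \<mu>" "\<And>x. x \<in> space \<mu> \<Longrightarrow> 0 \<le> u x \<and> u x \<le> B" for u :: "real \<Rightarrow> real" and B
    using that by (intro integrable_const_bound[of _ B]) auto
  \<comment> \<open>The bound is quantified inside \<open>P\<close> because in the induction over
    nonnegative measurable functions the parts of a sum or limit inherit it from the whole.\<close>
  define P where "P u \<longleftrightarrow> (\<forall>B. (\<forall>x\<in>space \<mu>. u x \<le> B) \<longrightarrow>
    (\<integral>x. u x \<partial>\<mu>) = (\<Sum>\<beta>\<in>\<Omega>. p \<beta> * (\<integral>x. u (imap \<beta> x) \<partial>\<mu>)))" for u :: "real \<Rightarrow> real"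
  have P: "P u" if "u \<in> borel_measurable \<mu>" "\<And>x. 0 \<le> u x" for u
    using that
  proof (induction rule: borel_measurable_induct_real)
    case (set A)
    have "(\<integral>x. indicat_real A (imap \<beta> x) \<partial>\<mu>) = measure \<mu> (imap \<beta> -` A \<inter> {0..1})" if "\<beta> \<in> \<Omega>" for \<beta>
    proof -
      have "(\<integral>x. indicat_real A (imap \<beta> x) \<partial>\<mu>) = (\<integral>x. indicat_real (imap \<beta> -` A) x \<partial>\<mu>)"
        by (intro Bochner_Integration.integral_cong) (auto simp: indicator_def)
      then show ?thesis by (simp add: sp)
    qed
    moreover have "A \<inter> {0..1} = A" using sets.sets_into_space[OF set] sp by auto
    ultimately show ?case using inv[of A] set sets by (simp add: P_def sp)
  next
    case (mult u c)
    show ?case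
    proof (cases "c = 0")
      case False
      then have c: "0 < c" using mult by simp
      show ?thesis unfolding P_def
      proof (intro allI impI)
        fix B assume "\<forall>x\<in>space \<mu>. c * u x \<le> B"
        then have "\<forall>x\<in>space \<mu>. u x \<le> B / c" using c by (simp add: field_simps)
        with mult have "(\<integral>x. u x \<partial>\<mu>) = (\<Sum>\<beta>\<in>\<Omega>. p \<beta> * (\<integral>x. u (imap \<beta> x) \<partial>\<mu>))"
          unfolding P_def by blast
        then show "(\<integral>x. c * u x \<partial>\<mu>) = (\<Sum>\<beta>\<in>\<Omega>. p \<beta> * (\<integral>x. c * u (imap \<beta> x) \<partial>\<mu>))"
          by (simp add: sum_distrib_left mult_ac)
      qed
    qed (simp add: P_def)
  next
    case (add u v)
    show ?case unfolding P_def
    proof (intro allI impI)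
      fix B assume B: "\<forall>x\<in>space \<mu>. v x + u x \<le> B"
      have le: "u x \<le> B" "v x \<le> B" if "x \<in> space \<mu>" for x
        using B[rule_format, OF that] add.hyps(2)[of x] add.hyps(4)[of x] by linarith+
      have m: "(\<lambda>x. u (imap \<beta> x)) \<in> borel_measurable \<mu>" "(\<lambda>x. v (imap \<beta> x)) \<in> borel_measurable \<mu>" if "\<beta> \<in> \<Omega>" for \<beta>
        using measurable_compose[OF T[OF that]] add by auto
      have i: "integrable \<mu> u" "integrable \<mu> v" using add le by (auto intro!: nn[of _ B])
      have iT: "integrable \<mu> (\<lambda>x. u (imap \<beta> x))" "integrable \<mu> (\<lambda>x. v (imap \<beta> x))" if "\<beta> \<in> \<Omega>" for \<beta>
        using add le m[OF that] Tsp[OF that] by (auto intro!: nn[of _ B])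
      have "(\<integral>x. u x \<partial>\<mu>) = (\<Sum>\<beta>\<in>\<Omega>. p \<beta> * (\<integral>x. u (imap \<beta> x) \<partial>\<mu>))"
        "(\<integral>x. v x \<partial>\<mu>) = (\<Sum>\<beta>\<in>\<Omega>. p \<beta> * (\<integral>x. v (imap \<beta> x) \<partial>\<mu>))"
        using add le unfolding P_def by blast+
      then show "(\<integral>x. v x + u x \<partial>\<mu>) = (\<Sum>\<beta>\<in>\<Omega>. p \<beta> * (\<integral>x. v (imap \<beta> x) + u (imap \<beta> x) \<partial>\<mu>))"
        using i iT by (simp add: distrib_left sum.distrib)
    qed
  next
    case (seq U)
    show ?case unfolding P_def
    proof (intro allI impI)
      fix B assume B: "\<forall>x\<in>space \<mu>. u x \<le> B"
      have UB: "U i x \<le> B" if "x \<in> space \<mu>" for i x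
        using incseq_le[of "\<lambda>i. U i x" "u x" i] seq.hyps(3,4) B that
        by (force simp: incseq_def le_fun_def)
      have 1: "(\<lambda>i. \<integral>x. U i x \<partial>\<mu>) \<longlonglongrightarrow> (\<integral>x. u x \<partial>\<mu>)"
        using seq UB that(1)
        by (intro integral_dominated_convergence[where w = "\<lambda>_. B"]) auto
      have 2: "(\<lambda>i. \<integral>x. U i (imap \<beta> x) \<partial>\<mu>) \<longlonglongrightarrow> (\<integral>x. u (imap \<beta> x) \<partial>\<mu>)" if "\<beta> \<in> \<Omega>" for \<beta>
        using seq UB Tsp[OF that] measurable_compose[OF T[OF that] \<open>u \<in> borel_measurable \<mu>\<close>]
          measurable_compose[OF T[OF that] seq.hyps(1)]
        by (intro integral_dominated_convergence[where w = "\<lambda>_. B"]) auto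
      have "(\<lambda>i. \<Sum>\<beta>\<in>\<Omega>. p \<beta> * (\<integral>x. U i (imap \<beta> x) \<partial>\<mu>)) \<longlonglongrightarrow> (\<Sum>\<beta>\<in>\<Omega>. p \<beta> * (\<integral>x. u (imap \<beta> x) \<partial>\<mu>))"
        by (intro tendsto_sum tendsto_mult_left 2)
      moreover have "(\<Sum>\<beta>\<in>\<Omega>. p \<beta> * (\<integral>x. U i (imap \<beta> x) \<partial>\<mu>)) = (\<integral>x. U i x \<partial>\<mu>)" for i
        using seq.IH[of i, unfolded P_def, rule_format, of B] UB by simp
      ultimately show "(\<integral>x. u x \<partial>\<mu>) = (\<Sum>\<beta>\<in>\<Omega>. p \<beta> * (\<integral>x. u (imap \<beta> x) \<partial>\<mu>))"
        using 1 LIMSEQ_unique by auto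
    qed
  qed
  obtain M where M: "0 \<le> M" "\<And>x. \<bar>\<psi> x\<bar> \<le> M" using \<psi> by (metis bdd_measE)
  have \<psi>m: "\<psi> \<in> borel_measurable \<mu>"
    using measurable_m01[OF bdd_meas_measurable[OF \<psi>]] sets by (metis measurable_cong_sets)
  have i: "integrable \<mu> \<psi>" by (rule bdd_meas_integrable[OF \<psi> fin sets])
  have iT: "integrable \<mu> (\<lambda>x. \<psi> (imap \<beta> x))" if "\<beta> \<in> \<Omega>" for \<beta>
    using M measurable_compose[OF T[OF that] \<psi>m] by (intro integrable_const_bound[of _ M]) auto
  have 0: "0 \<le> \<psi> x + M" and le: "\<psi> x + M \<le> 2 * M" for x using M(2)[of x] by linarith+
  have "P (\<lambda>x. \<psi> x + M)" using 0 \<psi>m by (intro P) auto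
  then have "(\<integral>x. \<psi> x + M \<partial>\<mu>) = (\<Sum>\<beta>\<in>\<Omega>. p \<beta> * (\<integral>x. \<psi> (imap \<beta> x) + M \<partial>\<mu>))"
    using le unfolding P_def by blast
  also have "\<dots> = (\<Sum>\<beta>\<in>\<Omega>. p \<beta> * (\<integral>x. \<psi> (imap \<beta> x) \<partial>\<mu>)) + (\<Sum>\<beta>\<in>\<Omega>. p \<beta>) * (\<integral>x. M \<partial>\<mu>)"
    unfolding sum_distrib_right using iT by (simp add: distrib_left sum.distrib)
  finally have "(\<integral>x. \<psi> x \<partial>\<mu>) = (\<Sum>\<beta>\<in>\<Omega>. p \<beta> * (\<integral>x. \<psi> (imap \<beta> x) \<partial>\<mu>))"
    using i by (simp add: p_sum)
  also have "\<dots> = (\<integral>x. koop \<psi> x \<partial>\<mu>)" unfolding koop_def using iT by simp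
  finally show ?thesis by simp
qed

lemma ac_prob_density:
  assumes "ac_prob \<mu>"
  obtains f where "integrable m01 f" "\<And>\<psi>. bdd_meas \<psi> \<Longrightarrow> (\<integral>x. \<psi> x \<partial>\<mu>) = (\<integral>x. f x * \<psi> x \<partial>m01)"
proof -
  have "prob_space \<mu>" and sets: "sets \<mu> = sets m01" and ac: "absolutely_continuous m01 \<mu>"
    using assms by (auto simp: ac_prob_def)
  interpret \<mu>: prob_space \<mu> by fact
  obtain D where D: "D \<in> borel_measurable m01" "AE x in m01. RN_deriv m01 \<mu> x = ennreal (D x)" "\<And>x. 0 \<le> D x"
    using m01.real_RN_deriv[OF \<mu>.finite_measure_axioms ac sets] by metis
  have "\<mu> = density m01 (RN_deriv m01 \<mu>)" using m01.density_RN_deriv[OF ac sets] by simp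
  also have "\<dots> = density m01 (\<lambda>x. ennreal (D x))"
    using D by (intro density_cong) auto
  finally have \<mu>: "\<mu> = density m01 (\<lambda>x. ennreal (D x))" .
  have eq: "(\<integral>x. \<psi> x \<partial>\<mu>) = (\<integral>x. D x * \<psi> x \<partial>m01)" if "bdd_meas \<psi>" for \<psi>
    unfolding \<mu> using that D by (subst integral_density) (auto intro: measurable_m01 bdd_meas_measurable)
  have "integrable \<mu> (\<lambda>_. 1 :: real)" by simp
  then have "integrable m01 (\<lambda>x. D x *\<^sub>R (1::real))"
    unfolding \<mu> using D by (subst (asm) integrable_density) auto
  then have "integrable m01 D" by simp
  then show thesis using that eq by blast
qed

end

section \<open>The stationary measure\<close>

context intermittent_system
begin

lemma kleft_pow_one_le: "(kleft ^^ n) (\<lambda>_. 1) x \<le> 1"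
proof -
  have "0 \<le> (\<Sum>k<n. (kleft ^^ k) right_ind x)" by (intro sum_nonneg kleft_pow_nonneg) simp
  then show ?thesis unfolding sum_kleft_pow_right_ind by simp
qed

text \<open>Dominated convergence: \<open>tau m x / m\<close> is at most 1 everywhere and at most
  \<open>lyap x / m\<close> at each positive \<open>x\<close>. The mean entrance time under
  \<open>M\<close> itself may be infinite.\<close>

lemma tau_sublinear:
  assumes M: "prob_space M" "sets M = sets m01" "AE x in M. 0 < x \<and> x \<le> 1"
  shows "(\<lambda>m. (\<integral>x. tau m x \<partial>M) / real m) \<longlonglongrightarrow> 0"
proof -
  interpret M: prob_space M by fact
  have tau_le: "tau m x \<le> real m" for m x
  proof -
    have "tau m x \<le> (\<Sum>n<m. 1)"
      unfolding tau_def using kleft_pow_one_le by (intro sum_mono) (simp flip: kleft_pow_Suc_one del: funpow.simps)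
    then show ?thesis by simp
  qed
  have "(\<lambda>m. \<integral>x. tau m x / real m \<partial>M) \<longlonglongrightarrow> (\<integral>x. 0 \<partial>M)"
  proof (rule integral_dominated_convergence[where w = "\<lambda>_. 1"])
    show "AE x in M. norm (tau m x / real m) \<le> 1" for m
      using tau_le tau_nonneg by (intro AE_I2) (auto simp: divide_le_eq_1 abs_of_nonneg)
    show "AE x in M. (\<lambda>m. tau m x / real m) \<longlonglongrightarrow> 0"
      using M(3)
    proof eventually_elim
      case (elim x)
      show ?case
      proof (rule Lim_null_comparison[OF _ lim_const_over_n[of "lyap x"]])
        show "\<forall>\<^sub>F m in sequentially. norm (tau m x / real m) \<le> lyap x / real m"
          using elim tau_le_lyap[of x] tau_nonneg
          by (intro always_eventually allI) (simp add: divide_right_mono)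
      qed
    qed
    show "(\<lambda>x. tau m x / real m) \<in> borel_measurable M" for m
      using bdd_meas_integrable[OF bdd_meas_tau[of m] M.finite_measure_axioms M(2)] by simp
  qed simp_all
  then show ?thesis by simp
qed

end

locale stationary_system = intermittent_system +
  fixes \<mu> :: "real measure"
  assumes ac_prob_mu: "ac_prob \<mu>"
    and stationary: "\<And>\<psi>. bdd_meas \<psi> \<Longrightarrow> (\<integral>x. koop \<psi> x \<partial>\<mu>) = (\<integral>x. \<psi> x \<partial>\<mu>)"
begin

sublocale mu: prob_space \<mu>
  using ac_prob_mu by (simp add: ac_prob_def)

lemma sets_mu: "sets \<mu> = sets m01"
  using ac_prob_mu by (simp add: ac_prob_def)

lemma space_mu: "space \<mu> = {0..1}"
  using sets_eq_imp_space_eq[OF sets_mu] by simp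

lemma integrable_mu [intro]: "bdd_meas \<psi> \<Longrightarrow> integrable \<mu> \<psi>"
  by (rule bdd_meas_integrable[OF _ mu.finite_measure_axioms sets_mu])

lemma AE_mu_pos: "AE x in \<mu>. 0 < x \<and> x \<le> 1"
proof -
  have "AE x in \<mu>. 0 < x"
    using ac_prob_mu by (intro absolutely_continuous_AE[OF sets_mu _ AE_m01_pos]) (simp add: ac_prob_def)
  with AE_space show ?thesis by eventually_elim (simp add: space_mu)
qed

lemma integral_mu_mono:
  assumes "bdd_meas f" "bdd_meas g" "\<And>x. 0 < x \<Longrightarrow> x \<le> 1 \<Longrightarrow> f x \<le> g x"
  shows "(\<integral>x. f x \<partial>\<mu>) \<le> (\<integral>x. g x \<partial>\<mu>)"
proof (rule integral_mono_AE)
  show "AE x in \<mu>. f x \<le> g x" using AE_mu_pos by eventually_elim (simp add: assms(3))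
qed (use assms in auto)

lemma stationary_pow: "bdd_meas \<psi> \<Longrightarrow> (\<integral>x. (koop ^^ n) \<psi> x \<partial>\<mu>) = (\<integral>x. \<psi> x \<partial>\<mu>)"
  by (induction n) (simp_all add: stationary bdd_meas_koop_pow)

lemma integral_birk_mu: "bdd_meas \<psi> \<Longrightarrow> (\<integral>x. birk \<psi> m x \<partial>\<mu>) = real m * (\<integral>x. \<psi> x \<partial>\<mu>)"
  unfolding birk_def
  by (subst Bochner_Integration.integral_sum) (auto intro!: integrable_mu bdd_meas_koop_pow simp: stationary_pow)

text \<open>For the density of \<mu> the Birkhoff mean is exactly \<open>m\<close> times the
  integral, by stationarity; \<open>asymp_ref\<close> then identifies the growth of the reference
  means.\<close>

lemma refK_limit:
  assumes "bdd_meas \<psi>"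
  shows "(\<lambda>m. refK \<psi> m / real m) \<longlonglongrightarrow> (\<integral>x. \<psi> x \<partial>\<mu>)"
proof -
  obtain f where f: "integrable m01 f" "\<And>\<psi>. bdd_meas \<psi> \<Longrightarrow> (\<integral>x. \<psi> x \<partial>\<mu>) = (\<integral>x. f x * \<psi> x \<partial>m01)"
    using ac_prob_density[OF ac_prob_mu] by blast
  have f1: "(\<integral>x. f x \<partial>m01) = 1" using f(2)[of "\<lambda>_. 1"] mu.prob_space by simp
  have "(\<lambda>m. (real m * (\<integral>x. \<psi> x \<partial>\<mu>) - refK \<psi> m * 1) / real m) \<longlonglongrightarrow> 0"
    using asymp_ref_integrable[OF assms f(1)] unfolding asymp_ref_def f1
    by (simp flip: f(2) add: bdd_meas_birk assms integral_birk_mu)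
  then have "(\<lambda>m. (\<integral>x. \<psi> x \<partial>\<mu>) - (real m * (\<integral>x. \<psi> x \<partial>\<mu>) - refK \<psi> m * 1) / real m) \<longlonglongrightarrow> (\<integral>x. \<psi> x \<partial>\<mu>) - 0"
    by (intro tendsto_diff tendsto_const)
  moreover have "\<forall>\<^sub>F m in sequentially.
      (\<integral>x. \<psi> x \<partial>\<mu>) - (real m * (\<integral>x. \<psi> x \<partial>\<mu>) - refK \<psi> m * 1) / real m = refK \<psi> m / real m"
    using eventually_gt_at_top[of 0] by eventually_elim (simp add: field_simps)
  ultimately show ?thesis by (simp only: diff_zero) (rule Lim_transform_eventually)
qed

lemma lebesgue_birk_limit:
  assumes "bdd_meas \<psi>"
  shows "(\<lambda>m. (\<integral>x. birk \<psi> m x \<partial>m01) / real m) \<longlonglongrightarrow> (\<integral>x. \<psi> x \<partial>\<mu>)"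
proof -
  have "(\<lambda>m. ((\<integral>x. birk \<psi> m x \<partial>m01) - refK \<psi> m) / real m) \<longlonglongrightarrow> 0"
    using asymp_ref_const[OF assms, of 1] by (simp add: asymp_ref_def m01.prob_space[unfolded space_m01])
  from tendsto_add[OF this refK_limit[OF assms]] show ?thesis
    by (simp add: diff_divide_distrib)
qed

text \<open>Averages over \<open>s\<close> of Lebesgue measure pushed forward by \<open>s\<close>
  steps converge to \<mu> on bounded Borel functions. In this way cone estimates reach \<mu>
  although its density has not been placed in the cone.\<close>

lemma integral_mu_le:
  assumes h: "bdd_meas h" and le: "\<And>s. (\<integral>x. (koop ^^ s) h x \<partial>m01) \<le> B"
  shows "(\<integral>x. h x \<partial>\<mu>) \<le> B"
proof (rule LIMSEQ_le_const2[OF lebesgue_birk_limit[OF h]])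
  have "(\<integral>x. birk h m x \<partial>m01) \<le> real m * B" for m
  proof -
    have "(\<integral>x. birk h m x \<partial>m01) = (\<Sum>s<m. \<integral>x. (koop ^^ s) h x \<partial>m01)"
      unfolding birk_def using h
      by (intro Bochner_Integration.integral_sum bdd_meas_integrable_m01 bdd_meas_koop_pow)
    also have "\<dots> \<le> (\<Sum>s<m. B)" by (intro sum_mono le)
    finally show ?thesis by simp
  qed
  then show "\<exists>N. \<forall>n\<ge>N. (\<integral>x. birk h n x \<partial>m01) / real n \<le> B"
    by (intro exI[of _ 1]) (simp add: divide_simps mult.commute)
qed

lemma pf_pow_one:
  "bdd_meas ((pf ^^ s) (\<lambda>_. 1))" "dcone 2 {0<..1} ((pf ^^ s) (\<lambda>_. 1))"
  "bdd_meas \<psi> \<Longrightarrow> (\<integral>x. (pf ^^ s) (\<lambda>_. 1) x * \<psi> x \<partial>m01) = (\<integral>x. (koop ^^ s) \<psi> x \<partial>m01)"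
  "(\<integral>x. (pf ^^ s) (\<lambda>_. 1) x \<partial>m01) = 1"
proof -
  show d: "dcone 2 {0<..1} ((pf ^^ s) (\<lambda>_. 1))" by (intro dcone_pf_pow dcone_const) auto
  show "bdd_meas ((pf ^^ s) (\<lambda>_. 1))" by (rule dconeD(1)[OF d])
  show "(\<integral>x. (pf ^^ s) (\<lambda>_. 1) x * \<psi> x \<partial>m01) = (\<integral>x. (koop ^^ s) \<psi> x \<partial>m01)" if "bdd_meas \<psi>" for \<psi>
    using pf_pow_dual[OF bdd_meas_const that, of s 1] by simp
  from this[of "\<lambda>_. 1"] show "(\<integral>x. (pf ^^ s) (\<lambda>_. 1) x \<partial>m01) = 1"
    by (simp add: koop_pow_linear m01.prob_space[unfolded space_m01])
qed

text \<open>A weight of exponent 2 times a pushed-forward density of exponent 2 lies in the cone of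
  exponent 4, where \<open>entrance\<close> applies; \<open>integral_mu_le\<close> is then used for
  both signs.\<close>

lemma entrance_mu:
  assumes \<psi>: "bdd_meas \<psi>" "\<And>y. \<bar>\<psi> y\<bar> \<le> \<Psi>"
    and g: "dcone 2 {0<..1} g" "\<And>x. 0 < x \<Longrightarrow> x \<le> 1 \<Longrightarrow> g x \<le> c"
  shows "\<bar>\<integral>x. g x * (birk \<psi> m x - ent \<psi> m x) \<partial>\<mu>\<bar> \<le> coupling_const * \<Psi> * c"
proof -
  let ?h = "\<lambda>x. g x * (birk \<psi> m x - ent \<psi> m x)"
  have h: "bdd_meas ?h"
    using \<psi>(1) dconeD(1)[OF g(1)] by (intro bdd_meas_mult bdd_meas_diff bdd_meas_birk bdd_meas_ent)
  have \<Psi>: "0 \<le> \<Psi>" using \<psi>(2)[of 0] by linarith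
  have le: "\<bar>\<integral>x. (koop ^^ s) ?h x \<partial>m01\<bar> \<le> coupling_const * \<Psi> * c" for s
  proof -
    let ?\<rho> = "(pf ^^ s) (\<lambda>_. 1)"
    have "dcone (2 + 2) {0<..1} (\<lambda>x. ?\<rho> x * g x)" using pf_pow_one(2) g(1) by (rule dcone_mult) auto
    then have d: "dcone 4 {0<..1} (\<lambda>x. ?\<rho> x * g x)" by simp
    have "(\<integral>x. (koop ^^ s) ?h x \<partial>m01) = (\<integral>x. ?\<rho> x * g x * (birk \<psi> m x - ent \<psi> m x) \<partial>m01)"
      using pf_pow_one(3)[OF h, of s] by (simp add: mult.assoc)
    then have "\<bar>\<integral>x. (koop ^^ s) ?h x \<partial>m01\<bar> \<le> coupling_const * \<Psi> * (\<integral>x. ?\<rho> x * g x \<partial>m01)"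
      using entrance[OF \<psi> d, of m] by simp
    also have "(\<integral>x. ?\<rho> x * g x \<partial>m01) \<le> (\<integral>x. ?\<rho> x * c \<partial>m01)"
      using dconeD(1,2)[OF pf_pow_one(2)] dconeD(1)[OF g(1)] g(2)
      by (intro integral_m01_mono bdd_meas_mult mult_left_mono) auto
    also have "\<dots> = c" using pf_pow_one(4)[of s] by simp
    finally show ?thesis using coupling_const_nonneg \<Psi> by (simp add: mult_left_mono)
  qed
  have "(\<integral>x. ?h x \<partial>\<mu>) \<le> coupling_const * \<Psi> * c"
    using le by (intro integral_mu_le[OF h]) (simp add: abs_le_iff)
  moreover have "(\<integral>x. - 1 * ?h x \<partial>\<mu>) \<le> coupling_const * \<Psi> * c"
  proof (rule integral_mu_le[OF bdd_meas_cmult[OF h]])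
    show "(\<integral>x. (koop ^^ s) (\<lambda>x. - 1 * ?h x) x \<partial>m01) \<le> coupling_const * \<Psi> * c" for s
      unfolding koop_pow_linear(3) using le[of s] by (simp add: abs_le_iff)
  qed
  ultimately show ?thesis by (simp add: abs_le_iff)
qed

section \<open>Entrance times under the stationary measure\<close>

definition mean_tau :: "nat \<Rightarrow> real" where "mean_tau m = (\<integral>x. tau m x \<partial>\<mu>)"

text \<open>Probability under \<mu> that the entrance time is at least \<open>n\<close>. Thus
  \<open>surv 0 = 1\<close>, and \<open>mean_tau m\<close> sums \<open>surv\<close> from index 1
  on.\<close>

definition surv :: "nat \<Rightarrow> real" where "surv n = (\<integral>x. (kleft ^^ n) (\<lambda>_. 1) x \<partial>\<mu>)"

lemma bdd_meas_right_ind: "bdd_meas right_ind"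
  by (rule bdd_meas_indicator) simp

lemma surv_diff: "surv n - surv (Suc n) = (\<integral>x. (kleft ^^ n) right_ind x \<partial>\<mu>)"
  unfolding surv_def kleft_pow_right_ind
  by (intro Bochner_Integration.integral_diff[symmetric] integrable_mu bdd_meas_kleft_pow bdd_meas_const)

lemma surv_diff_nonneg: "0 \<le> surv n - surv (Suc n)"
  unfolding surv_diff by (intro integral_nonneg_AE AE_I2 kleft_pow_nonneg) simp

lemma surv_decseq: "decseq surv"
  using surv_diff_nonneg by (intro decseq_SucI) (simp add: algebra_simps)

lemma surv_nonneg: "0 \<le> surv n"
  unfolding surv_def by (intro integral_nonneg_AE AE_I2 kleft_pow_nonneg) simp

lemma surv_0: "surv 0 = 1"
  using mu.prob_space by (simp add: surv_def)

lemma mean_tau_eq: "mean_tau m = (\<Sum>n<m. surv (Suc n))"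
  unfolding mean_tau_def tau_def surv_def kleft_pow_Suc_one
  by (intro Bochner_Integration.integral_sum integrable_mu bdd_meas_kleft_pow bdd_meas_indicator) simp

lemma mean_tau_mono: "m \<le> k \<Longrightarrow> mean_tau m \<le> mean_tau k"
  unfolding mean_tau_eq by (intro sum_mono2 surv_nonneg) auto

lemma mean_tau_nonneg: "0 \<le> mean_tau m"
  unfolding mean_tau_eq by (intro sum_nonneg surv_nonneg)

lemma mean_tau_sublinear: "(\<lambda>m. mean_tau m / real m) \<longlonglongrightarrow> 0"
  unfolding mean_tau_def by (rule tau_sublinear[OF mu.prob_space_axioms sets_mu AE_mu_pos])

text \<open>As \<open>surv\<close> decreases, \<open>m * surv m\<close> is at most
  \<open>mean_tau m\<close>, which is sublinear.\<close>

lemma surv_tendsto_0: "surv \<longlonglongrightarrow> 0"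
proof (rule Lim_null_comparison[OF _ mean_tau_sublinear])
  show "\<forall>\<^sub>F m in sequentially. norm (surv m) \<le> mean_tau m / real m"
    using eventually_gt_at_top[of 0]
  proof eventually_elim
    case (elim m)
    have "real m * surv m = (\<Sum>n<m. surv m)" by simp
    also have "\<dots> \<le> mean_tau m"
      unfolding mean_tau_eq by (intro sum_mono decseqD[OF surv_decseq]) auto
    finally show ?case using elim surv_nonneg[of m] by (simp add: field_simps)
  qed
qed

lemma kleft_pow_le_koop_pow: "(\<And>y. 0 \<le> f y) \<Longrightarrow> 0 < x \<Longrightarrow> x \<le> 1 \<Longrightarrow> (kleft ^^ n) f x \<le> (koop ^^ n) f x"
proof (induction n arbitrary: x)
  case (Suc n)
  have "kleft ((kleft ^^ n) f) x \<le> koop ((kleft ^^ n) f) x"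
    using koop_nonneg[of "(kleft ^^ n) f" x] kleft_pow_nonneg[OF Suc.prems(1)] by (simp add: kleft_def indicator_def)
  also have "\<dots> \<le> koop ((koop ^^ n) f) x" using Suc by (intro koop_mono) auto
  finally show ?case by simp
qed simp

definition right_mass :: real where "right_mass = (\<integral>x. right_ind x \<partial>\<mu>)"

text \<open>Were the right half a null set, stationarity would rule out an entrance at any time, and
  \<open>surv\<close> would be constantly 1.\<close>

lemma right_mass_pos: "0 < right_mass"
proof (rule ccontr)
  assume "\<not> 0 < right_mass"
  have "surv n - surv (Suc n) \<le> 0" for n
  proof -
    have "surv n - surv (Suc n) \<le> (\<integral>x. (koop ^^ n) right_ind x \<partial>\<mu>)"
      unfolding surv_diff using bdd_meas_right_ind
      by (intro integral_mu_mono kleft_pow_le_koop_pow bdd_meas_kleft_pow bdd_meas_koop_pow) auto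
    also have "\<dots> \<le> 0"
      using \<open>\<not> 0 < right_mass\<close> stationary_pow[OF bdd_meas_right_ind] by (simp add: right_mass_def)
    finally show ?thesis .
  qed
  then have "surv (Suc n) = surv n" for n using surv_diff_nonneg[of n] by (simp add: antisym)
  then have "surv n = 1" for n by (induction n) (auto simp: surv_0)
  then have "surv = (\<lambda>_. 1)" by auto
  then show False using surv_tendsto_0 by (simp add: LIMSEQ_const_iff)
qed

text \<open>A cone density is at least its value at 1, which by \<open>dcone_lower\<close> is at
  least half its mass on the right. The test function \<open>c * right_ind - h\<close> expresses
  this by a single integral, the form that \<open>integral_mu_le\<close> accepts. In effect the
  density of \<mu> is bounded below by \<open>right_mass / 2\<close>.\<close>

lemma lebesgue_le_mu:
  assumes h: "bdd_meas h" "\<And>x. 0 \<le> h x"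
  shows "(\<integral>x. h x \<partial>m01) \<le> 2 / right_mass * (\<integral>x. h x \<partial>\<mu>)"
proof -
  define c where "c = (\<integral>x. h x \<partial>m01) / 2"
  have c: "0 \<le> c" unfolding c_def using h(2) by simp
  let ?k = "\<lambda>x. c * right_ind x - h x"
  have k: "bdd_meas ?k" using h(1) bdd_meas_right_ind by (intro bdd_meas_diff bdd_meas_cmult)
  have "(\<integral>x. ?k x \<partial>\<mu>) \<le> 0"
  proof (rule integral_mu_le[OF k])
    fix s
    let ?\<rho> = "(pf ^^ s) (\<lambda>_. 1)"
    note \<rho> = dconeD[OF pf_pow_one(2)[of s]]
    have i: "integrable m01 (\<lambda>x. ?\<rho> x * right_ind x)" "integrable m01 (\<lambda>x. ?\<rho> x * h x)"
      using \<rho>(1) h(1) bdd_meas_right_ind by (auto intro!: bdd_meas_integrable_m01 bdd_meas_mult)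
    have "dcone 2 {1/2<..1} ?\<rho>" by (rule dcone_subset[OF pf_pow_one(2)]) auto
    then have "(\<integral>x. ?\<rho> x * right_ind x \<partial>m01) \<le> 2 * ?\<rho> 1" by (rule dcone_lower) simp
    then have "c * (\<integral>x. ?\<rho> x * right_ind x \<partial>m01) \<le> c * (2 * ?\<rho> 1)" by (intro mult_left_mono c)
    also have "\<dots> = (\<integral>x. ?\<rho> 1 * h x \<partial>m01)" by (simp add: c_def)
    also have "\<dots> \<le> (\<integral>x. ?\<rho> x * h x \<partial>m01)"
      using \<rho>(1) \<rho>(3)[of _ 1] h by (intro integral_m01_mono bdd_meas_mult mult_right_mono) auto
    finally have "c * (\<integral>x. ?\<rho> x * right_ind x \<partial>m01) - (\<integral>x. ?\<rho> x * h x \<partial>m01) \<le> 0" by simp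
    also have "c * (\<integral>x. ?\<rho> x * right_ind x \<partial>m01) - (\<integral>x. ?\<rho> x * h x \<partial>m01)
        = (\<integral>x. c * (?\<rho> x * right_ind x) - ?\<rho> x * h x \<partial>m01)"
      using i by simp
    also have "\<dots> = (\<integral>x. ?\<rho> x * ?k x \<partial>m01)"
      by (intro Bochner_Integration.integral_cong) (auto simp: algebra_simps)
    finally show "(\<integral>x. (koop ^^ s) ?k x \<partial>m01) \<le> 0" unfolding pf_pow_one(3)[OF k] .
  qed
  moreover have "(\<integral>x. ?k x \<partial>\<mu>) = c * right_mass - (\<integral>x. h x \<partial>\<mu>)"
    using h(1) bdd_meas_right_ind integrable_mu unfolding right_mass_def
    by (subst Bochner_Integration.integral_diff) auto
  ultimately show ?thesis using right_mass_pos by (simp add: c_def field_simps)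
qed

text \<open>Domination of Lebesgue measure by a multiple of \<mu> survives the pushing forward
  because \<mu> is stationary, hence the uniformity in \<open>s\<close>.\<close>

lemma pf_pow_one_le_mu:
  assumes "bdd_meas h" "\<And>x. 0 \<le> h x"
  shows "(\<integral>x. (pf ^^ s) (\<lambda>_. 1) x * h x \<partial>m01) \<le> 2 / right_mass * (\<integral>x. h x \<partial>\<mu>)"
  using lebesgue_le_mu[of "(koop ^^ s) h"] assms
  by (simp add: pf_pow_one(3) bdd_meas_koop_pow koop_pow_nonneg stationary_pow)

end

section \<open>Entrance times and boundedness of the reference means\<close>

lemma sum_convolution:
  fixes q y :: "nat \<Rightarrow> real"
  shows "(\<Sum>r<n. \<Sum>k\<le>r. q k * y (r - k)) = (\<Sum>k<n. q k * (\<Sum>j<n - k. y j))"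
proof (induction n)
  case (Suc n)
  have "(\<Sum>k<Suc n. q k * (\<Sum>j<Suc n - k. y j)) = (\<Sum>k<Suc n. q k * (\<Sum>j<n - k. y j) + q k * y (n - k))"
    by (intro sum.cong) (auto simp: Suc_diff_le distrib_left)
  also have "\<dots> = (\<Sum>k<n. q k * (\<Sum>j<n - k. y j)) + (\<Sum>k\<le>n. q k * y (n - k))"
    by (simp add: sum.distrib flip: lessThan_Suc_atMost)
  finally show ?case using Suc by simp
qed simp

text \<open>Boundedness and the Lipschitz condition are required on the whole line; the final proof
  supplies such an extension of the observable.\<close>

locale observable_system = stationary_system +
  fixes \<phi> :: "real \<Rightarrow> real" and \<Phi> \<Lambda> :: real
  assumes bdd_phi: "bdd_meas \<phi>"
    and phi_le: "\<bar>\<phi> x\<bar> \<le> \<Phi>"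
    and phi_lipschitz: "\<bar>\<phi> x - \<phi> y\<bar> \<le> \<Lambda> * \<bar>x - y\<bar>"
    and phi_mean: "(\<integral>x. \<phi> x \<partial>\<mu>) = 0"
begin

lemma Phi_nonneg: "0 \<le> \<Phi>"
  using phi_le[of 0] by linarith

lemma Lambda_nonneg: "0 \<le> \<Lambda>"
  using phi_lipschitz[of 1 0] by simp

definition drift_const :: real where "drift_const = \<Lambda> * (2 / (1 - \<alpha>))"

text \<open>During a stay on the left \<phi> is replaced by \<open>\<phi> 0\<close>;
  \<open>drift_bound\<close> sums the Lipschitz errors.\<close>

lemma left_part:
  assumes "0 < x" "x \<le> 1"
  shows "\<bar>(\<Sum>n<m. (kleft ^^ n) (\<lambda>x. left_ind x * \<phi> x) x) - \<phi> 0 * tau m x\<bar> \<le> drift_const"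
proof -
  have "(kleft ^^ n) (\<lambda>x. left_ind x * (\<phi> x - \<phi> 0)) x
      = (kleft ^^ n) (\<lambda>x. left_ind x * \<phi> x) x - \<phi> 0 * (kleft ^^ n) left_ind x" for n
  proof -
    have "(\<lambda>x. left_ind x * (\<phi> x - \<phi> 0)) = (\<lambda>x. left_ind x * \<phi> x - \<phi> 0 * left_ind x)"
      by (simp add: algebra_simps)
    then show ?thesis by (simp only: kleft_pow_linear)
  qed
  then have "(\<Sum>n<m. (kleft ^^ n) (\<lambda>x. left_ind x * \<phi> x) x) - \<phi> 0 * tau m x
      = (\<Sum>n<m. (kleft ^^ n) (\<lambda>x. left_ind x * (\<phi> x - \<phi> 0)) x)"
    by (simp add: tau_def sum_subtractf sum_distrib_left)
  then have "\<bar>(\<Sum>n<m. (kleft ^^ n) (\<lambda>x. left_ind x * \<phi> x) x) - \<phi> 0 * tau m x\<bar>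
      = \<bar>\<Sum>n<m. (kleft ^^ n) (\<lambda>x. left_ind x * (\<phi> x - \<phi> 0)) x\<bar>" by simp
  also have "\<dots> \<le> \<Lambda> * (\<Sum>n<m. (kleft ^^ n) (\<lambda>x. left_ind x * \<bar>x\<bar>) x)"
    using phi_lipschitz[of _ 0] by (intro sum_kleft_left_abs_le) simp
  also have "\<dots> \<le> \<Lambda> * (\<Sum>n<m. (kleft ^^ n) (\<lambda>x. left_ind x * x) x)"
    using Lambda_nonneg assms by (intro mult_left_mono sum_mono kleft_pow_mono) auto
  also have "\<dots> \<le> drift_const"
    unfolding drift_const_def using drift_bound[OF assms] Lambda_nonneg by (intro mult_left_mono)
  finally show ?thesis .
qed

definition mean_ref :: "nat \<Rightarrow> real" where
  "mean_ref m = (\<Sum>n<m. refK \<phi> (m - n) * (surv n - surv (Suc n)))"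

definition renewal_const :: real where "renewal_const = coupling_const * \<Phi> + drift_const"

text \<open>The stationary mean of the Birkhoff sum is 0. Splitting it at the first entrance yields
  a renewal equation for \<open>refK\<close> with bounded error.\<close>

lemma renewal_identity: "\<bar>\<phi> 0 * mean_tau m + mean_ref m\<bar> \<le> renewal_const"
proof -
  let ?L = "\<lambda>x. \<Sum>n<m. (kleft ^^ n) (\<lambda>x. left_ind x * \<phi> x) x"
  have bL: "bdd_meas ?L"
    using bdd_phi by (intro bdd_meas_sum bdd_meas_kleft_pow bdd_meas_mult bdd_meas_indicator) simp_all
  have i: "integrable \<mu> (birk \<phi> m)" "integrable \<mu> (ent \<phi> m)" "integrable \<mu> ?L" "integrable \<mu> (tau m)"
    "integrable \<mu> (\<lambda>x. refK \<phi> (m - n) * (kleft ^^ n) right_ind x)" for n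
    using bdd_phi bL
    by (auto intro!: integrable_mu bdd_meas_birk bdd_meas_ent bdd_meas_tau bdd_meas_cmult bdd_meas_kleft_pow
        bdd_meas_right_ind)
  have "(\<integral>x. ent \<phi> m x \<partial>\<mu>) = (\<integral>x. ?L x \<partial>\<mu>) + mean_ref m"
  proof -
    have "(\<integral>x. ent \<phi> m x \<partial>\<mu>) = (\<integral>x. ?L x \<partial>\<mu>)
        + (\<integral>x. (\<Sum>n<m. refK \<phi> (m - n) * (kleft ^^ n) right_ind x) \<partial>\<mu>)"
      unfolding ent_def by (intro Bochner_Integration.integral_add i Bochner_Integration.integrable_sum)
    also have "(\<integral>x. (\<Sum>n<m. refK \<phi> (m - n) * (kleft ^^ n) right_ind x) \<partial>\<mu>) = mean_ref m"
      unfolding mean_ref_def surv_diff using i(5) by (subst Bochner_Integration.integral_sum) simp_all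
    finally show ?thesis .
  qed
  moreover have "(\<integral>x. birk \<phi> m x - ent \<phi> m x \<partial>\<mu>) = - (\<integral>x. ent \<phi> m x \<partial>\<mu>)"
    using i integral_birk_mu[OF bdd_phi, of m] phi_mean by simp
  moreover have "\<bar>\<integral>x. birk \<phi> m x - ent \<phi> m x \<partial>\<mu>\<bar> \<le> coupling_const * \<Phi>"
  proof -
    have "dcone 2 {0<..1} (\<lambda>_. 1)" by (rule dcone_const) auto
    from entrance_mu[OF bdd_phi phi_le this, of 1 m] show ?thesis by simp
  qed
  moreover have "\<bar>(\<integral>x. ?L x \<partial>\<mu>) - \<phi> 0 * mean_tau m\<bar> \<le> drift_const"
  proof -
    have "(\<integral>x. ?L x \<partial>\<mu>) - \<phi> 0 * mean_tau m = (\<integral>x. ?L x - \<phi> 0 * tau m x \<partial>\<mu>)"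
      using i by (simp add: mean_tau_def)
    moreover have "(\<integral>x. ?L x - \<phi> 0 * tau m x \<partial>\<mu>) \<le> (\<integral>x. drift_const \<partial>\<mu>)"
      using bL left_part[of _ m]
      by (intro integral_mu_mono bdd_meas_diff bdd_meas_cmult bdd_meas_tau bdd_meas_const) (auto simp: abs_le_iff)
    moreover have "(\<integral>x. - drift_const \<partial>\<mu>) \<le> (\<integral>x. ?L x - \<phi> 0 * tau m x \<partial>\<mu>)"
      using bL left_part[of _ m]
      by (intro integral_mu_mono bdd_meas_diff bdd_meas_cmult bdd_meas_tau bdd_meas_const)
        (auto simp: abs_le_iff, smt (verit))
    ultimately show ?thesis using mu.prob_space by (simp add: abs_le_iff)
  qed
  ultimately show ?thesis unfolding renewal_const_def by linarith
qed

definition weight_const :: real where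
  "weight_const = 2 * (coupling_const * \<Phi> * (2 * \<Phi> + 3 * \<Lambda>)) + 8 * \<Phi> * \<Lambda> / \<alpha>"

lemma x_tau_le:
  assumes "0 < x" "x \<le> 1"
  shows "x * tau m x \<le> 4 / \<alpha>"
proof -
  have "x * tau m x \<le> x * lyap x" using assms by (intro mult_left_mono tau_le_lyap) auto
  also have "\<dots> = 4 / \<alpha> * x powr (1 - \<alpha>)"
    using assms by (simp add: lyap_def powr_diff powr_minus field_simps)
  also have "\<dots> \<le> 4 / \<alpha> * 1"
    using assms alpha_pos alpha_less_1 by (intro mult_left_mono powr_le1) auto
  finally show ?thesis by simp
qed

text \<open>The factor \<open>\<phi> x - \<phi> 0\<close> vanishes at the fixed point and tames the
  entrance time through \<open>x_tau_le\<close>. What it leaves is \<open>\<phi> 0\<close> times the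
  stationary mean of the sum, which is 0, and \<open>refK \<phi> m\<close> times the integral of
  \<open>\<phi> x - \<phi> 0\<close>, which is \<open>- \<phi> 0\<close>.\<close>

lemma weighted_estimate:
  "\<bar>(\<integral>x. \<phi> x * birk \<phi> m x \<partial>\<mu>) + \<phi> 0 * refK \<phi> m\<bar> \<le> weight_const"
proof -
  define M where "M = \<Phi> + 3 * \<Lambda>"
  define cl where "cl = (\<lambda>x::real. max 0 (min 1 x))"
  \<comment> \<open>Two cone elements with difference \<open>\<phi> x - \<phi> 0\<close>:
    subtracting \<open>\<Lambda> * cl x\<close> makes both decreasing with Lipschitz constant at
    most \<open>2 * \<Lambda>\<close>, and \<open>M\<close> lifts both above that constant.\<close>
  define g1 where "g1 = (\<lambda>x. \<phi> x + M - \<Lambda> * cl x)"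
  define g2 where "g2 = (\<lambda>x. \<phi> 0 + M - \<Lambda> * cl x)"
  have cl: "0 \<le> cl x" "cl x \<le> 1" for x by (auto simp: cl_def)
  have \<Lambda>cl: "0 \<le> \<Lambda> * cl x" "\<Lambda> * cl x \<le> \<Lambda>" for x
    using cl[of x] Lambda_nonneg by (auto simp: mult_left_le)
  have bcl: "bdd_meas cl" unfolding cl_def by (rule bdd_measI[of _ 1]) auto
  have b1: "bdd_meas g1" and b2: "bdd_meas g2"
    unfolding g1_def g2_def using bdd_phi bcl
    by (auto intro!: bdd_meas_diff bdd_meas_add bdd_meas_cmult)
  have phi: "- \<Phi> \<le> \<phi> x" "\<phi> x \<le> \<Phi>" for x using phi_le[of x] by linarith+
  have lower: "2 * \<Lambda> \<le> g1 x" "2 * \<Lambda> \<le> g2 x" for x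
    using \<Lambda>cl[of x] phi[of x] phi[of 0] unfolding g1_def g2_def M_def by linarith+
  have nonneg: "0 \<le> g1 x" "0 \<le> g2 x" for x
    using lower[of x] Lambda_nonneg by linarith+
  have upper: "g1 x \<le> 2 * \<Phi> + 3 * \<Lambda>" "g2 x \<le> 2 * \<Phi> + 3 * \<Lambda>" for x
    using \<Lambda>cl[of x] phi[of x] phi[of 0] unfolding g1_def g2_def M_def by linarith+
  have d1: "dcone 1 {0<..1} g1"
  proof (rule lipschitz_dcone[where \<Lambda> = "2 * \<Lambda>"])
    fix x y :: real assume "0 < x" "x \<le> y" "y \<le> 1"
    then have "\<Lambda> * cl y - \<Lambda> * cl x = \<Lambda> * (y - x)" "\<bar>\<phi> x - \<phi> y\<bar> \<le> \<Lambda> * (y - x)"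
      using phi_lipschitz[of x y] by (auto simp: cl_def right_diff_distrib)
    then show "g1 y \<le> g1 x" "g1 x - g1 y \<le> 2 * \<Lambda> * (y - x)"
      unfolding g1_def by linarith+
  qed (simp_all add: b1 lower nonneg Lambda_nonneg)
  have d2: "dcone 1 {0<..1} g2"
  proof (rule lipschitz_dcone[where \<Lambda> = "2 * \<Lambda>"])
    fix x y :: real assume xy: "0 < x" "x \<le> y" "y \<le> 1"
    then have "\<Lambda> * cl y - \<Lambda> * cl x = \<Lambda> * (y - x)"
      by (auto simp: cl_def right_diff_distrib)
    moreover have "0 \<le> \<Lambda> * (y - x)" using xy Lambda_nonneg by simp
    ultimately show "g2 y \<le> g2 x" "g2 x - g2 y \<le> 2 * \<Lambda> * (y - x)"
      unfolding g2_def by linarith+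
  qed (simp_all add: b2 lower nonneg Lambda_nonneg)
  have d: "dcone 2 {0<..1} g1" "dcone 2 {0<..1} g2"
    by (rule dcone_weaken[OF d1]; force) (rule dcone_weaken[OF d2]; force)
  let ?D = "\<lambda>x. birk \<phi> m x - ent \<phi> m x"
  have bD: "bdd_meas ?D" using bdd_phi by (intro bdd_meas_diff bdd_meas_birk bdd_meas_ent)
  have bE: "bdd_meas (\<lambda>x. ent \<phi> m x - refK \<phi> m)" using bdd_phi by (intro bdd_meas_diff bdd_meas_const bdd_meas_ent)
  have bp: "bdd_meas (\<lambda>x. \<phi> x - \<phi> 0)" using bdd_phi by (intro bdd_meas_diff bdd_meas_const)
  have i: "integrable \<mu> (\<lambda>x. g1 x * ?D x)" "integrable \<mu> (\<lambda>x. g2 x * ?D x)"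
    "integrable \<mu> (\<lambda>x. (\<phi> x - \<phi> 0) * (ent \<phi> m x - refK \<phi> m))" "integrable \<mu> (birk \<phi> m)" "integrable \<mu> \<phi>"
    using b1 b2 bD bE bp bdd_phi by (auto intro!: integrable_mu bdd_meas_mult bdd_meas_birk)
  have "\<phi> x * birk \<phi> m x = g1 x * ?D x - g2 x * ?D x + (\<phi> x - \<phi> 0) * (ent \<phi> m x - refK \<phi> m)
      + \<phi> 0 * birk \<phi> m x + refK \<phi> m * (\<phi> x - \<phi> 0)" for x
    unfolding g1_def g2_def by (simp add: algebra_simps)
  then have "(\<integral>x. \<phi> x * birk \<phi> m x \<partial>\<mu>) = (\<integral>x. g1 x * ?D x - g2 x * ?D x
      + (\<phi> x - \<phi> 0) * (ent \<phi> m x - refK \<phi> m) + \<phi> 0 * birk \<phi> m x + refK \<phi> m * (\<phi> x - \<phi> 0) \<partial>\<mu>)"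
    by (simp only:)
  also have "\<dots> = (\<integral>x. g1 x * ?D x \<partial>\<mu>) - (\<integral>x. g2 x * ?D x \<partial>\<mu>)
      + (\<integral>x. (\<phi> x - \<phi> 0) * (ent \<phi> m x - refK \<phi> m) \<partial>\<mu>)
      + \<phi> 0 * (\<integral>x. birk \<phi> m x \<partial>\<mu>) + refK \<phi> m * ((\<integral>x. \<phi> x \<partial>\<mu>) - \<phi> 0)"
    using i mu.prob_space by simp
  also have "(\<integral>x. birk \<phi> m x \<partial>\<mu>) = 0" using integral_birk_mu[OF bdd_phi] phi_mean by simp
  finally have eq: "(\<integral>x. \<phi> x * birk \<phi> m x \<partial>\<mu>) + \<phi> 0 * refK \<phi> m
      = (\<integral>x. g1 x * ?D x \<partial>\<mu>) - (\<integral>x. g2 x * ?D x \<partial>\<mu>)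
      + (\<integral>x. (\<phi> x - \<phi> 0) * (ent \<phi> m x - refK \<phi> m) \<partial>\<mu>)"
    using phi_mean by (simp add: mult.commute)
  have e1: "\<bar>\<integral>x. g1 x * ?D x \<partial>\<mu>\<bar> \<le> coupling_const * \<Phi> * (2 * \<Phi> + 3 * \<Lambda>)"
    by (rule entrance_mu[OF bdd_phi phi_le d(1) upper(1)])
  have e2: "\<bar>\<integral>x. g2 x * ?D x \<partial>\<mu>\<bar> \<le> coupling_const * \<Phi> * (2 * \<Phi> + 3 * \<Lambda>)"
    by (rule entrance_mu[OF bdd_phi phi_le d(2) upper(2)])
  have e3: "\<bar>\<integral>x. (\<phi> x - \<phi> 0) * (ent \<phi> m x - refK \<phi> m) \<partial>\<mu>\<bar> \<le> 8 * \<Phi> * \<Lambda> / \<alpha>"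
  proof -
    have "(\<integral>x. \<bar>(\<phi> x - \<phi> 0) * (ent \<phi> m x - refK \<phi> m)\<bar> \<partial>\<mu>) \<le> (\<integral>x. 8 * \<Phi> * \<Lambda> / \<alpha> \<partial>\<mu>)"
    proof (rule integral_mu_mono)
      fix x :: real assume x: "0 < x" "x \<le> 1"
      have "\<bar>(\<phi> x - \<phi> 0) * (ent \<phi> m x - refK \<phi> m)\<bar> \<le> (\<Lambda> * x) * (2 * \<Phi> * tau m x)"
        unfolding abs_mult using phi_lipschitz[of x 0] ent_refK_le(2)[OF bdd_phi phi_le, of m x] x Lambda_nonneg
        by (intro mult_mono) auto
      also have "\<dots> = (2 * \<Phi> * \<Lambda>) * (x * tau m x)" by simp
      also have "\<dots> \<le> (2 * \<Phi> * \<Lambda>) * (4 / \<alpha>)"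
        using x_tau_le[OF x] Phi_nonneg Lambda_nonneg by (intro mult_left_mono) auto
      finally show "\<bar>(\<phi> x - \<phi> 0) * (ent \<phi> m x - refK \<phi> m)\<bar> \<le> 8 * \<Phi> * \<Lambda> / \<alpha>" by simp
    qed (use bp bE in \<open>auto intro!: bdd_meas_abs bdd_meas_mult\<close>)
    then show ?thesis using mu.prob_space by (intro order_trans[OF integral_abs_bound]) simp
  qed
  show ?thesis unfolding eq weight_const_def using e1 e2 e3 by linarith
qed

text \<open>If \<open>\<phi> 0 \<noteq> 0\<close>, then without an integrable entrance time the sojourns near the neutral fixed
  point would make the variance grow superlinearly.\<close>

lemma mean_tau_bounded:
  assumes V: "0 \<le> V" "\<And>n. (\<Sum>r<n. \<integral>x. \<phi> x * birk \<phi> (Suc r) x \<partial>\<mu>) \<le> V * real n"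
  obtains N where "0 \<le> N" "\<And>m. \<bar>\<phi> 0\<bar> * mean_tau m \<le> N"
proof (cases "\<phi> 0 = 0")
  case True
  then show ?thesis using that[of 0] by simp
next
  case False
  define b where "b = \<phi> 0"
  define V' where "V' = V + weight_const"
  have wc: "0 \<le> weight_const"
    using weighted_estimate[of 0] by linarith
  have V': "0 \<le> V'" using V(1) wc by (simp add: V'_def)
  \<comment> \<open>Up to a bounded error \<open>y r\<close> is at most the correlation of \<phi>
    with the Birkhoff sum, so the variance controls its partial sums from above. One-sided control
    suffices, since they are only averaged with the nonnegative weights \<open>?q\<close>.\<close>
  define y where "y r = - b * refK \<phi> (Suc r)" for r
  have sum_y: "(\<Sum>r<n. y r) \<le> V' * real n" for n
  proof -
    have "(\<Sum>r<n. y r) \<le> (\<Sum>r<n. (\<integral>x. \<phi> x * birk \<phi> (Suc r) x \<partial>\<mu>) + weight_const)"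
    proof (rule sum_mono)
      fix r
      show "y r \<le> (\<integral>x. \<phi> x * birk \<phi> (Suc r) x \<partial>\<mu>) + weight_const"
        using weighted_estimate[of "Suc r"] unfolding y_def b_def by linarith
    qed
    also have "\<dots> = (\<Sum>r<n. \<integral>x. \<phi> x * birk \<phi> (Suc r) x \<partial>\<mu>) + weight_const * real n"
      by (simp add: sum.distrib)
    also have "\<dots> \<le> V' * real n" using V(2)[of n] by (simp add: V'_def distrib_right)
    finally show ?thesis .
  qed
  let ?q = "\<lambda>k. surv k - surv (Suc k)"
  have "- b * mean_ref (Suc r) = (\<Sum>k\<le>r. ?q k * y (r - k))" for r
    unfolding mean_ref_def y_def lessThan_Suc_atMost sum_distrib_left
    by (intro sum.cong refl) (simp add: Suc_diff_le mult_ac)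
  then have "(\<Sum>r<n. - b * mean_ref (Suc r)) = (\<Sum>k<n. ?q k * (\<Sum>j<n - k. y j))" for n
    by (simp only: sum_convolution[of ?q y])
  also have "\<dots> n \<le> (\<Sum>k<n. ?q k * (V' * real n))" for n
  proof (rule sum_mono, rule mult_left_mono)
    fix k
    have "(\<Sum>j<n - k. y j) \<le> V' * real (n - k)" by (rule sum_y)
    also have "\<dots> \<le> V' * real n" using V' by (intro mult_left_mono) auto
    finally show "(\<Sum>j<n - k. y j) \<le> V' * real n" .
  qed (rule surv_diff_nonneg)
  also have "\<dots> n = (surv 0 - surv n) * (V' * real n)" for n
    by (simp add: sum_lessThan_telescope' flip: sum_distrib_right)
  also have "\<dots> n \<le> 1 * (V' * real n)" for n
    using V' surv_nonneg[of n] by (intro mult_right_mono) (auto simp: surv_0)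
  finally have ref: "(\<Sum>r<n. - b * mean_ref (Suc r)) \<le> V' * real n" for n by simp
  define C where "C = V' + \<bar>b\<bar> * renewal_const"
  have rc: "0 \<le> renewal_const" using renewal_identity[of 0] by linarith
  have C: "0 \<le> C" using V' rc by (simp add: C_def)
  have sq: "(\<Sum>r<n. b * b * mean_tau (Suc r)) \<le> C * real n" for n
  proof -
    have "(\<Sum>r<n. b * b * mean_tau (Suc r)) \<le> (\<Sum>r<n. - b * mean_ref (Suc r) + \<bar>b\<bar> * renewal_const)"
    proof (rule sum_mono)
      fix r
      have "\<bar>b * (b * mean_tau (Suc r) + mean_ref (Suc r))\<bar> \<le> \<bar>b\<bar> * renewal_const"
        unfolding abs_mult using renewal_identity[of "Suc r"] by (intro mult_left_mono) (auto simp: b_def)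
      then show "b * b * mean_tau (Suc r) \<le> - b * mean_ref (Suc r) + \<bar>b\<bar> * renewal_const"
        by (simp add: algebra_simps abs_le_iff)
    qed
    also have "\<dots> = (\<Sum>r<n. - b * mean_ref (Suc r)) + \<bar>b\<bar> * renewal_const * real n"
      unfolding sum.distrib by simp
    also have "\<dots> \<le> C * real n" using ref[of n] by (simp add: C_def distrib_right)
    finally show ?thesis .
  qed
  have "\<bar>b\<bar> * mean_tau m \<le> 2 * C / \<bar>b\<bar>" for m
  proof (cases "m = 0")
    case True
    then show ?thesis using C by (simp add: mean_tau_def)
  next
    case m: False
    \<comment> \<open>As \<open>mean_tau\<close> increases, its value at \<open>m\<close> is at most
      its average over \<open>{m..<2 * m}\<close>, which the linear bound \<open>sq\<close>
      controls.\<close>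
    have "real m * (b * b * mean_tau m) = (\<Sum>r\<in>{m..<2 * m}. b * b * mean_tau m)" by simp
    also have "\<dots> \<le> (\<Sum>r\<in>{m..<2 * m}. b * b * mean_tau (Suc r))"
      by (intro sum_mono mult_left_mono mean_tau_mono) auto
    also have "\<dots> \<le> (\<Sum>r<2 * m. b * b * mean_tau (Suc r))"
      by (intro sum_mono2) (auto intro!: mult_nonneg_nonneg[of "b * b"] mean_tau_nonneg)
    also have "\<dots> \<le> C * real (2 * m)" by (rule sq)
    finally have "b * b * mean_tau m \<le> 2 * C" using m by (simp add: mult_ac)
    moreover have "b * b * mean_tau m = \<bar>b\<bar> * (\<bar>b\<bar> * mean_tau m)" by (simp flip: abs_mult)
    ultimately show ?thesis using False by (simp add: b_def field_simps)
  qed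
  then show ?thesis using that[of "2 * C / \<bar>b\<bar>"] C by (simp add: b_def)
qed

text \<open>By the renewal identity a weighted sum of earlier values of \<open>refK\<close> is
  bounded. Most of the weight sits on lags below a fixed \<open>J\<close>, across which
  \<open>refK\<close> changes by at most \<open>J * \<Phi>\<close>.\<close>

lemma refK_bounded:
  assumes N: "\<And>m. \<bar>\<phi> 0\<bar> * mean_tau m \<le> N"
  obtains B where "\<And>m. \<bar>refK \<phi> m\<bar> \<le> B"
proof -
  define C where "C = renewal_const + N"
  have C: "\<bar>mean_ref m\<bar> \<le> C" for m
  proof -
    have "\<bar>\<phi> 0 * mean_tau m\<bar> \<le> N" using N[of m] mean_tau_nonneg[of m] by (simp add: abs_mult)
    then show ?thesis using renewal_identity[of m] unfolding C_def by linarith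
  qed
  obtain J where J: "surv J \<le> 1 / 4"
    using order_tendstoD(2)[OF surv_tendsto_0, of "1/4"]
    by (metis eventually_happens trivial_limit_sequentially less_imp_le zero_less_divide_1_iff zero_less_numeral)
  let ?K = "refK \<phi>"
  have "\<bar>?K m\<bar> \<le> 2 * (C + real J * \<Phi>)" for m
  proof -
    \<comment> \<open>Working at an index \<open>k\<close> where the maximum is attained, the lags
      from \<open>J\<close> on together with the mass not yet entered contribute at most half of
      \<open>M\<close>, which is absorbed on the left.\<close>
    define M where "M = Max ((\<lambda>k. \<bar>?K k\<bar>) ` {..m})"
    have M: "\<bar>?K k\<bar> \<le> M" if "k \<le> m" for k unfolding M_def using that by (intro Max_ge) auto
    have "M \<in> (\<lambda>k. \<bar>?K k\<bar>) ` {..m}" unfolding M_def by (rule Max_in) auto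
    then obtain k where k: "k \<le> m" "\<bar>?K k\<bar> = M" by auto
    have M0: "0 \<le> M" using k by auto
    have C0: "0 \<le> C" using C[of 0] by linarith
    have J\<Phi>: "0 \<le> real J * \<Phi>" using Phi_nonneg by simp
    have "M \<le> 2 * (C + real J * \<Phi>)"
    proof (cases "k \<le> J")
      case True
      have "M \<le> real k * \<Phi>" using refK_abs_le[OF bdd_phi phi_le, of k] k by simp
      also have "\<dots> \<le> real J * \<Phi>" using True Phi_nonneg by (intro mult_right_mono) auto
      finally show ?thesis using C0 J\<Phi> by simp
    next
      case False
      let ?q = "\<lambda>n. surv n - surv (Suc n)"
      have tel: "(\<Sum>n<k. ?q n) = 1 - surv k"
        by (subst sum_lessThan_telescope') (simp add: surv_0)
      have "?K k - mean_ref k = (\<Sum>n<k. (?K k - ?K (k - n)) * ?q n) + surv k * ?K k"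
        using tel unfolding mean_ref_def
        by (simp add: left_diff_distrib sum_subtractf flip: sum_distrib_left) (simp add: algebra_simps)
      moreover have "\<bar>\<Sum>n<k. (?K k - ?K (k - n)) * ?q n\<bar> \<le> (\<Sum>n<k. real J * \<Phi> * ?q n + (if n < J then 0 else 2 * M * ?q n))"
      proof (rule order_trans[OF sum_abs sum_mono])
        fix n assume n: "n \<in> {..<k}"
        have "\<bar>?K k - ?K (k - n)\<bar> \<le> real J * \<Phi> + (if n < J then 0 else 2 * M)"
        proof (cases "n < J")
          case True
          have "\<bar>?K k - ?K (k - n)\<bar> \<le> real n * \<Phi>"
            using refK_diff_le[OF bdd_phi phi_le, of "k - n" k] n by simp
          also have "\<dots> \<le> real J * \<Phi>" using True Phi_nonneg by (intro mult_right_mono) auto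
          finally show ?thesis using True by simp
        next
          case False
          have "\<bar>?K k\<bar> \<le> M" "\<bar>?K (k - n)\<bar> \<le> M" using M[of k] M[of "k - n"] k by auto
          then show ?thesis using False J\<Phi> by simp
        qed
        then have "\<bar>?K k - ?K (k - n)\<bar> * ?q n \<le> (real J * \<Phi> + (if n < J then 0 else 2 * M)) * ?q n"
          using surv_diff_nonneg by (intro mult_right_mono) auto
        then show "\<bar>(?K k - ?K (k - n)) * ?q n\<bar> \<le> real J * \<Phi> * ?q n + (if n < J then 0 else 2 * M * ?q n)"
          using surv_diff_nonneg[of n] by (auto simp: abs_mult distrib_right)
      qed
      moreover have "(\<Sum>n<k. real J * \<Phi> * ?q n + (if n < J then 0 else 2 * M * ?q n))
          = real J * \<Phi> * (1 - surv k) + 2 * M * (surv J - surv k)"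
      proof -
        have "(\<Sum>n<k. if n < J then 0 else 2 * M * ?q n) = (\<Sum>n\<in>{J..<k}. 2 * M * ?q n)"
          using False by (intro sum.mono_neutral_cong_right) auto
        also have "\<dots> = 2 * M * (\<Sum>n\<in>{J..<k}. ?q n)" by (simp only: sum_distrib_left)
        also have "(\<Sum>n\<in>{J..<k}. ?q n) = surv J - surv k"
          using False sum_Suc_diff'[of J k "\<lambda>n. - surv n"] by simp
        finally show ?thesis unfolding sum.distrib tel[symmetric] by (simp only: sum_distrib_left)
      qed
      moreover have "\<bar>surv k * ?K k\<bar> = surv k * M"
        using k surv_nonneg[of k] by (simp add: abs_mult)
      ultimately have "M \<le> \<bar>mean_ref k\<bar> + (real J * \<Phi> * (1 - surv k) + 2 * M * (surv J - surv k)) + surv k * M"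
        using k(2) by linarith
      also have "\<dots> = \<bar>mean_ref k\<bar> + real J * \<Phi> - real J * \<Phi> * surv k + 2 * M * surv J - M * surv k"
        by (simp add: algebra_simps)
      also have "\<dots> \<le> C + real J * \<Phi> + 2 * M * (1 / 4)"
      proof -
        have "2 * M * surv J \<le> 2 * M * (1 / 4)" using J M0 by (intro mult_left_mono) auto
        moreover have "0 \<le> real J * \<Phi> * surv k" "0 \<le> M * surv k"
          using J\<Phi> M0 surv_nonneg[of k] by auto
        ultimately show ?thesis using C[of k] by linarith
      qed
      finally show ?thesis by simp
    qed
    then show ?thesis using M[of m] by linarith
  qed
  then show ?thesis using that by blast
qed

text \<open>Once the reference means are bounded, only the stay near the fixed point can make a
  Birkhoff mean large, and only if \<open>\<phi> 0\<close> is nonzero.\<close>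

lemma birk_bound:
  assumes B: "\<And>m. \<bar>refK \<phi> m\<bar> \<le> B" and f: "dcone 4 {0<..1} f"
  shows "\<bar>\<integral>x. f x * birk \<phi> m x \<partial>m01\<bar>
    \<le> (renewal_const + B) * (\<integral>x. f x \<partial>m01) + \<bar>\<phi> 0\<bar> * (\<integral>x. f x * tau m x \<partial>m01)"
proof -
  note fD = dconeD[OF f]
  have B0: "0 \<le> B" using B[of 0] by simp
  have i: "integrable m01 (\<lambda>x. f x * (birk \<phi> m x - ent \<phi> m x))" "integrable m01 (\<lambda>x. f x * ent \<phi> m x)"
    "integrable m01 f" "integrable m01 (\<lambda>x. f x * tau m x)"
    using bdd_phi fD(1)
    by (auto intro!: bdd_meas_integrable_m01 bdd_meas_mult bdd_meas_diff bdd_meas_birk bdd_meas_ent bdd_meas_tau)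
  have "(\<integral>x. f x * birk \<phi> m x \<partial>m01) = (\<integral>x. f x * (birk \<phi> m x - ent \<phi> m x) + f x * ent \<phi> m x \<partial>m01)"
    by (intro Bochner_Integration.integral_cong) (auto simp: algebra_simps)
  also have "\<dots> = (\<integral>x. f x * (birk \<phi> m x - ent \<phi> m x) \<partial>m01) + (\<integral>x. f x * ent \<phi> m x \<partial>m01)"
    using i by simp
  finally have eq: "(\<integral>x. f x * birk \<phi> m x \<partial>m01) = \<dots>" .
  have pt: "\<bar>ent \<phi> m x\<bar> \<le> drift_const + B + \<bar>\<phi> 0\<bar> * tau m x" if x: "0 < x" "x \<le> 1" for x
  proof -
    have "\<bar>\<Sum>n<m. refK \<phi> (m - n) * (kleft ^^ n) right_ind x\<bar> \<le> (\<Sum>n<m. B * (kleft ^^ n) right_ind x)"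
    proof (rule order_trans[OF sum_abs sum_mono])
      fix n
      have "0 \<le> (kleft ^^ n) right_ind x" by (rule kleft_pow_nonneg) simp
      then show "\<bar>refK \<phi> (m - n) * (kleft ^^ n) right_ind x\<bar> \<le> B * (kleft ^^ n) right_ind x"
        using B[of "m - n"] by (simp add: abs_mult mult_right_mono)
    qed
    also have "\<dots> = B * (\<Sum>n<m. (kleft ^^ n) right_ind x)" by (simp only: sum_distrib_left)
    also have "\<dots> \<le> B" using B0 sum_kleft_pow_right_ind_le[where m = m and x = x] by (simp add: mult_left_le)
    finally have "\<bar>\<Sum>n<m. refK \<phi> (m - n) * (kleft ^^ n) right_ind x\<bar> \<le> B" .
    moreover have "\<bar>\<phi> 0 * tau m x\<bar> = \<bar>\<phi> 0\<bar> * tau m x" using tau_nonneg by (simp add: abs_mult)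
    ultimately show ?thesis unfolding ent_def using left_part[OF x, of m] by linarith
  qed
  have "\<bar>\<integral>x. f x * ent \<phi> m x \<partial>m01\<bar> \<le> (\<integral>x. (drift_const + B) * f x + \<bar>\<phi> 0\<bar> * (f x * tau m x) \<partial>m01)"
  proof (rule order_trans[OF integral_abs_bound])
    show "(\<integral>x. \<bar>f x * ent \<phi> m x\<bar> \<partial>m01) \<le> (\<integral>x. (drift_const + B) * f x + \<bar>\<phi> 0\<bar> * (f x * tau m x) \<partial>m01)"
    proof (rule integral_m01_mono)
      fix x :: real assume x: "0 < x" "x \<le> 1"
      have "f x * \<bar>ent \<phi> m x\<bar> \<le> f x * (drift_const + B + \<bar>\<phi> 0\<bar> * tau m x)"
        using pt[OF x] fD(2) by (intro mult_left_mono)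
      then show "\<bar>f x * ent \<phi> m x\<bar> \<le> (drift_const + B) * f x + \<bar>\<phi> 0\<bar> * (f x * tau m x)"
        using fD(2)[of x] by (simp add: abs_mult algebra_simps)
    qed (use bdd_phi fD(1) in \<open>auto intro!: bdd_meas_abs bdd_meas_mult bdd_meas_add bdd_meas_ent bdd_meas_tau\<close>)
  qed
  also have "\<dots> = (drift_const + B) * (\<integral>x. f x \<partial>m01) + \<bar>\<phi> 0\<bar> * (\<integral>x. f x * tau m x \<partial>m01)"
    using i by simp
  finally have "\<bar>\<integral>x. f x * ent \<phi> m x \<partial>m01\<bar>
      \<le> (drift_const + B) * (\<integral>x. f x \<partial>m01) + \<bar>\<phi> 0\<bar> * (\<integral>x. f x * tau m x \<partial>m01)" .
  then show ?thesis
    unfolding eq renewal_const_def using entrance[OF bdd_phi phi_le f, of m] by (simp add: distrib_right)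
qed

end

section \<open>Random parameter sequences\<close>

text \<open>A letter put in front acts on the starting point; together with
  \<open>integral_nu_step\<close> this reduces integrals over sequences to inductions on the
  length.\<close>

lemma rcomp_case_nat: "rcomp (case_nat \<beta> \<omega>) (Suc j) x = rcomp \<omega> j (imap \<beta> x)"
  by (induction j) simp_all

definition bsum :: "(real \<Rightarrow> real) \<Rightarrow> (nat \<Rightarrow> real) \<Rightarrow> nat \<Rightarrow> real \<Rightarrow> real" where
  "bsum \<phi> \<omega> n x = (\<Sum>k<n. \<phi> (rcomp \<omega> k x))"

lemma bsum_case_nat: "bsum \<phi> (case_nat \<beta> \<omega>) (Suc n) x = \<phi> x + bsum \<phi> \<omega> n (imap \<beta> x)"
  unfolding bsum_def by (simp only: sum.lessThan_Suc_shift rcomp_case_nat) simp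

lemma bsum_0 [simp]: "bsum \<phi> \<omega> 0 x = 0"
  by (simp add: bsum_def)

definition run :: "real \<Rightarrow> nat \<Rightarrow> (nat \<Rightarrow> real) \<Rightarrow> real" where
  "run \<beta> L \<omega> = of_bool (\<forall>i<L. \<omega> i = \<beta>)"

lemma run_0 [simp]: "run \<beta> 0 \<omega> = 1"
  by (simp add: run_def)

lemma run_case_nat: "run \<beta> (Suc L) (case_nat \<gamma> \<omega>) = of_bool (\<gamma> = \<beta>) * run \<beta> L \<omega>"
  by (simp add: run_def All_less_Suc2)

lemma run_01: "0 \<le> run \<beta> L \<omega>" "run \<beta> L \<omega> \<le> 1"
  by (auto simp: run_def)

context intermittent_system
begin

abbreviation nu :: "(nat \<Rightarrow> real) measure" where "nu \<equiv> seq_measure \<Omega> p"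
abbreviation letter :: "real measure" where "letter \<equiv> point_measure \<Omega> (\<lambda>\<beta>. ennreal (p \<beta>))"

lemma prob_space_letter: "prob_space letter"
proof (rule prob_spaceI)
  have "(\<Sum>\<beta>\<in>\<Omega>. ennreal (p \<beta>)) = ennreal (\<Sum>\<beta>\<in>\<Omega>. p \<beta>)" using p_nonneg by (rule sum_ennreal)
  then show "emeasure letter (space letter) = 1"
    by (simp add: emeasure_point_measure_finite[OF finite_Omega] space_point_measure p_sum)
qed

sublocale sq: sequence_space letter
proof -
  interpret prob_space letter by (rule prob_space_letter)
  show "sequence_space letter" by unfold_locales
qed

lemma nu_eq: "nu = sq.S"
  by (simp add: seq_measure_def)

sublocale nu: prob_space nu
  unfolding nu_eq by (rule sq.P.prob_space_axioms)

lemma space_nu: "\<omega> \<in> space nu \<Longrightarrow> \<omega> i \<in> \<Omega>"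
  by (auto simp: nu_eq space_PiM space_point_measure)

lemma measurable_coord: "(\<lambda>\<omega>. \<omega> i) \<in> measurable nu (count_space \<Omega>)"
proof -
  have "(\<lambda>\<omega>. \<omega> i) \<in> measurable sq.S letter" by (rule measurable_component_singleton) simp
  then show ?thesis
    unfolding nu_eq by (simp add: measurable_cong_sets[OF refl sets_point_measure_count_space])
qed

lemma measurable_coord_fun [measurable]: "(\<lambda>\<omega>. (f (\<omega> i) :: real)) \<in> borel_measurable nu"
  by (rule measurable_compose[OF measurable_coord]) simp

definition bdd_nu :: "((nat \<Rightarrow> real) \<Rightarrow> real) \<Rightarrow> bool" where
  "bdd_nu F \<longleftrightarrow> F \<in> borel_measurable nu \<and> (\<exists>B. \<forall>\<omega>. \<bar>F \<omega>\<bar> \<le> B)"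

lemma bdd_nuI: "F \<in> borel_measurable nu \<Longrightarrow> (\<And>\<omega>. \<bar>F \<omega>\<bar> \<le> B) \<Longrightarrow> bdd_nu F"
  unfolding bdd_nu_def by blast

lemma bdd_nuD: "bdd_nu F \<Longrightarrow> F \<in> borel_measurable nu"
  unfolding bdd_nu_def by blast

lemma bdd_nuE:
  assumes "bdd_nu F" obtains B where "0 \<le> B" "\<And>\<omega>. \<bar>F \<omega>\<bar> \<le> B"
  using assms unfolding bdd_nu_def by (meson abs_ge_zero order_trans)

lemma bdd_nu_integrable:
  assumes "bdd_nu F" shows "integrable nu F"
proof -
  obtain B where "\<And>\<omega>. \<bar>F \<omega>\<bar> \<le> B" using assms by (metis bdd_nuE)
  then show ?thesis using bdd_nuD[OF assms] by (intro nu.integrable_const_bound[of _ B]) auto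
qed

lemma bdd_nu_const: "bdd_nu (\<lambda>_. c)"
  by (rule bdd_nuI[of _ "\<bar>c\<bar>"]) auto

lemma bdd_nu_add:
  assumes "bdd_nu F" "bdd_nu G" shows "bdd_nu (\<lambda>\<omega>. F \<omega> + G \<omega>)"
proof -
  obtain B C where "\<And>\<omega>. \<bar>F \<omega>\<bar> \<le> B" "\<And>\<omega>. \<bar>G \<omega>\<bar> \<le> C" using assms by (metis bdd_nuE)
  then have "\<bar>F \<omega> + G \<omega>\<bar> \<le> B + C" for \<omega>
    by (meson abs_triangle_ineq add_mono order_trans)
  then show ?thesis using assms[THEN bdd_nuD] by (intro bdd_nuI) auto
qed

lemma bdd_nu_mult:
  assumes "bdd_nu F" "bdd_nu G" shows "bdd_nu (\<lambda>\<omega>. F \<omega> * G \<omega>)"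
proof -
  obtain B C where "0 \<le> B" "\<And>\<omega>. \<bar>F \<omega>\<bar> \<le> B" "\<And>\<omega>. \<bar>G \<omega>\<bar> \<le> C" using assms by (metis bdd_nuE)
  then have "\<bar>F \<omega> * G \<omega>\<bar> \<le> B * C" for \<omega>
    by (auto simp: abs_mult intro!: mult_mono)
  then show ?thesis using assms[THEN bdd_nuD] by (intro bdd_nuI) auto
qed

lemma bdd_nu_power: "bdd_nu F \<Longrightarrow> bdd_nu (\<lambda>\<omega>. F \<omega> ^ k)"
  by (induction k) (simp_all add: bdd_nu_const bdd_nu_mult)

lemma bdd_nu_sum: "(\<And>i. i \<in> I \<Longrightarrow> bdd_nu (F i)) \<Longrightarrow> bdd_nu (\<lambda>\<omega>. \<Sum>i\<in>I. F i \<omega>)"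
  by (induction I rule: infinite_finite_induct) (simp_all add: bdd_nu_const bdd_nu_add)

lemma measurable_shift: "(\<lambda>\<omega> i. \<omega> (i + L)) \<in> measurable nu nu"
proof -
  have "(\<lambda>\<omega> i. \<omega> (i + L)) \<in> measurable sq.S sq.S"
    by (rule measurable_PiM_single') (auto simp: space_PiM PiE_iff)
  then show ?thesis by (simp add: nu_eq)
qed

lemma bdd_nu_comp: "bdd_nu F \<Longrightarrow> g \<in> measurable nu nu \<Longrightarrow> bdd_nu (\<lambda>\<omega>. F (g \<omega>))"
  unfolding bdd_nu_def by (auto intro: measurable_compose[of g])

text \<open>Conditioning on the first letter: the product measure is the image of letter times
  sequence under \<open>case_nat\<close>.\<close>

lemma integral_nu_step:
  assumes F: "bdd_nu F"
  shows "(\<integral>\<omega>. F \<omega> \<partial>nu) = (\<Sum>\<beta>\<in>\<Omega>. p \<beta> * (\<integral>\<omega>. F (case_nat \<beta> \<omega>) \<partial>nu))"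
proof -
  interpret L: prob_space letter by (rule prob_space_letter)
  interpret pr: pair_prob_space letter sq.S ..
  have FS: "F \<in> borel_measurable sq.S" using bdd_nuD[OF F] by (simp add: nu_eq)
  have cn: "(\<lambda>(s, \<omega>). case_nat s \<omega>) \<in> measurable (letter \<Otimes>\<^sub>M sq.S) sq.S"
    unfolding split_beta' by (rule measurable_case_nat') simp_all
  obtain B where B: "\<And>\<omega>. \<bar>F \<omega>\<bar> \<le> B" using F by (metis bdd_nuE)
  have int: "integrable (letter \<Otimes>\<^sub>M sq.S) (\<lambda>z. F ((\<lambda>(s, \<omega>). case_nat s \<omega>) z))"
    using B measurable_compose[OF cn FS] by (intro pr.P.integrable_const_bound[of _ B]) auto
  have "(\<integral>\<omega>. F \<omega> \<partial>nu) = (\<integral>\<omega>. F \<omega> \<partial>distr (letter \<Otimes>\<^sub>M sq.S) sq.S (\<lambda>(s, \<omega>). case_nat s \<omega>))"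
    by (simp add: sq.PiM_iter nu_eq)
  also have "\<dots> = (\<integral>z. F ((\<lambda>(s, \<omega>). case_nat s \<omega>) z) \<partial>(letter \<Otimes>\<^sub>M sq.S))"
    by (rule integral_distr[OF cn FS])
  also have "\<dots> = (\<integral>\<beta>. (\<integral>\<omega>. F (case_nat \<beta> \<omega>) \<partial>sq.S) \<partial>letter)"
    using pr.integral_fst'[OF int] by simp
  also have "\<dots> = (\<Sum>\<beta>\<in>\<Omega>. p \<beta> * (\<integral>\<omega>. F (case_nat \<beta> \<omega>) \<partial>nu))"
    using p_nonneg by (subst lebesgue_integral_point_measure_finite[OF finite_Omega]) (simp_all add: nu_eq)
  finally show ?thesis .
qed

lemma measurable_rcomp:
  assumes "sets M = sets m01"
  shows "(\<lambda>z. rcomp (fst z) j (snd z)) \<in> borel_measurable (nu \<Otimes>\<^sub>M M)"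
proof (induction j)
  case 0
  have "(\<lambda>x. x) \<in> borel_measurable m01" by (rule measurable_m01) simp
  then have "(\<lambda>x. x) \<in> borel_measurable M" by (simp only: measurable_cong_sets[OF assms refl])
  from measurable_compose[OF measurable_snd this] show ?case by simp
next
  case (Suc j)
  have m: "(\<lambda>z. of_bool (fst z j = \<beta>) :: real) \<in> borel_measurable (nu \<Otimes>\<^sub>M M)" for \<beta>
    using measurable_compose[OF measurable_fst measurable_coord_fun[of "\<lambda>b. of_bool (b = \<beta>)" j]] .
  \<comment> \<open>The parameter of the next map is itself random; the sum over the finite set
    \<Omega> fixes it in each term.\<close>
  have "(\<lambda>z. \<Sum>\<beta>\<in>\<Omega>. of_bool (fst z j = \<beta>) * imap \<beta> (rcomp (fst z) j (snd z))) \<in> borel_measurable (nu \<Otimes>\<^sub>M M)"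
    by (intro borel_measurable_sum borel_measurable_times m measurable_compose[OF Suc measurable_imap])
  also have "?this \<longleftrightarrow> (\<lambda>z. rcomp (fst z) (Suc j) (snd z)) \<in> borel_measurable (nu \<Otimes>\<^sub>M M)"
  proof (rule measurable_cong)
    fix z assume "z \<in> space (nu \<Otimes>\<^sub>M M)"
    then have "fst z j \<in> \<Omega>" by (auto simp: space_pair_measure space_nu)
    then show "(\<Sum>\<beta>\<in>\<Omega>. of_bool (fst z j = \<beta>) * imap \<beta> (rcomp (fst z) j (snd z))) = rcomp (fst z) (Suc j) (snd z)"
      using finite_Omega by (simp add: of_bool_def if_distrib[of "\<lambda>c. c * _"] sum.delta cong: if_cong)
  qed
  finally show ?case .
qed

lemma measurable_bsum:
  assumes "bdd_meas \<phi>" "sets M = sets m01"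
  shows "(\<lambda>z. bsum \<phi> (fst z) n (snd z)) \<in> borel_measurable (nu \<Otimes>\<^sub>M M)"
  unfolding bsum_def
  by (intro borel_measurable_sum measurable_compose[OF measurable_rcomp[OF assms(2)] bdd_meas_measurable[OF assms(1)]])

lemma bsum_abs_le: "(\<And>x. \<bar>\<phi> x\<bar> \<le> \<Phi>) \<Longrightarrow> \<bar>bsum \<phi> \<omega> n x\<bar> \<le> real n * \<Phi>"
  unfolding bsum_def by (rule order_trans[OF sum_abs]) (rule sum_bounded_above[of "{..<n}", simplified], simp)

lemma bdd_nu_rcomp:
  assumes "bdd_meas \<phi>"
  shows "bdd_nu (\<lambda>\<omega>. \<phi> (rcomp \<omega> j x))"
proof -
  have m: "(\<lambda>\<omega>. rcomp \<omega> j x) \<in> borel_measurable nu"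
  proof (induction j)
    case (Suc j)
    have m: "(\<lambda>\<omega>. of_bool (\<omega> j = \<beta>) :: real) \<in> borel_measurable nu" for \<beta>
      by (rule measurable_coord_fun)
    have "(\<lambda>\<omega>. \<Sum>\<beta>\<in>\<Omega>. of_bool (\<omega> j = \<beta>) * imap \<beta> (rcomp \<omega> j x)) \<in> borel_measurable nu"
      by (intro borel_measurable_sum borel_measurable_times m measurable_compose[OF Suc measurable_imap])
    also have "?this \<longleftrightarrow> (\<lambda>\<omega>. rcomp \<omega> (Suc j) x) \<in> borel_measurable nu"
      using finite_Omega space_nu
      by (intro measurable_cong) (simp add: of_bool_def if_distrib[of "\<lambda>c. c * _"] sum.delta cong: if_cong)
    finally show ?case .
  qed simp
  obtain B where "\<And>x. \<bar>\<phi> x\<bar> \<le> B" using assms by (metis bdd_measE)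
  then show ?thesis using measurable_compose[OF m bdd_meas_measurable[OF assms]] by (intro bdd_nuI[of _ B]) auto
qed

lemma bdd_nu_bsum: "bdd_meas \<phi> \<Longrightarrow> bdd_nu (\<lambda>\<omega>. bsum \<phi> \<omega> n x)"
  unfolding bsum_def by (intro bdd_nu_sum bdd_nu_rcomp)

lemma bdd_nu_run: "bdd_nu (run \<beta> L)"
proof (rule bdd_nuI[of _ 1])
  have "run \<beta> L = (\<lambda>\<omega>. \<Prod>i<L. of_bool (\<omega> i = \<beta>))"
    by (induction L) (auto simp: run_def fun_eq_iff less_Suc_eq)
  moreover have "(\<lambda>\<omega>. of_bool (\<omega> i = \<beta>) :: real) \<in> borel_measurable nu" for i
    by (rule measurable_coord_fun)
  ultimately show "run \<beta> L \<in> borel_measurable nu" by simp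
  show "\<bar>run \<beta> L \<omega>\<bar> \<le> 1" for \<omega> using run_01[of \<beta> L \<omega>] by simp
qed

lemma integral_bsum:
  assumes "bdd_meas \<phi>"
  shows "(\<integral>\<omega>. bsum \<phi> \<omega> n x \<partial>nu) = birk \<phi> n x"
proof (induction n arbitrary: x)
  case (Suc n)
  have "(\<integral>\<omega>. bsum \<phi> \<omega> (Suc n) x \<partial>nu) = (\<Sum>\<beta>\<in>\<Omega>. p \<beta> * (\<integral>\<omega>. \<phi> x + bsum \<phi> \<omega> n (imap \<beta> x) \<partial>nu))"
    by (subst integral_nu_step[OF bdd_nu_bsum[OF assms]]) (simp only: bsum_case_nat)
  also have "\<dots> = koop (\<lambda>y. \<phi> x + birk \<phi> n y) x"
    unfolding koop_def using bdd_nu_integrable[OF bdd_nu_bsum[OF assms]] Suc nu.prob_space by simp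
  also have "\<dots> = birk \<phi> (Suc n) x" by (simp add: koop_linear birk_Suc)
  finally show ?case .
qed simp

section \<open>Second moments and covariances with runs of one letter\<close>

definition second_moment :: "(real \<Rightarrow> real) \<Rightarrow> nat \<Rightarrow> real \<Rightarrow> real" where
  "second_moment \<phi> n x = (\<integral>\<omega>. (bsum \<phi> \<omega> n x)\<^sup>2 \<partial>nu)"

lemma second_moment_Suc:
  assumes "bdd_meas \<phi>"
  shows "second_moment \<phi> (Suc n) x = (\<phi> x)\<^sup>2 + 2 * \<phi> x * koop (birk \<phi> n) x + koop (second_moment \<phi> n) x"
proof -
  have i: "integrable nu (\<lambda>\<omega>. bsum \<phi> \<omega> n y)" "integrable nu (\<lambda>\<omega>. (bsum \<phi> \<omega> n y)\<^sup>2)" for y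
    using assms by (auto intro!: bdd_nu_integrable bdd_nu_bsum bdd_nu_power)
  have e1: "second_moment \<phi> (Suc n) x = (\<Sum>\<beta>\<in>\<Omega>. p \<beta> * (\<integral>\<omega>. (\<phi> x + bsum \<phi> \<omega> n (imap \<beta> x))\<^sup>2 \<partial>nu))"
    unfolding second_moment_def
    by (subst integral_nu_step[OF bdd_nu_power[OF bdd_nu_bsum[OF assms]]]) (simp only: bsum_case_nat)
  have "(\<integral>\<omega>. (\<phi> x + bsum \<phi> \<omega> n y)\<^sup>2 \<partial>nu) = (\<phi> x)\<^sup>2 + 2 * \<phi> x * birk \<phi> n y + second_moment \<phi> n y" for y
  proof -
    have "(\<integral>\<omega>. (\<phi> x + bsum \<phi> \<omega> n y)\<^sup>2 \<partial>nu)
        = (\<integral>\<omega>. (\<phi> x)\<^sup>2 + 2 * \<phi> x * bsum \<phi> \<omega> n y + (bsum \<phi> \<omega> n y)\<^sup>2 \<partial>nu)"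
      by (intro Bochner_Integration.integral_cong) (auto simp: power2_sum algebra_simps)
    also have "\<dots> = (\<phi> x)\<^sup>2 + 2 * \<phi> x * (\<integral>\<omega>. bsum \<phi> \<omega> n y \<partial>nu) + second_moment \<phi> n y"
      unfolding second_moment_def using i nu.prob_space by simp
    finally show ?thesis by (simp only: integral_bsum[OF assms])
  qed
  then have e2: "(\<Sum>\<beta>\<in>\<Omega>. p \<beta> * (\<integral>\<omega>. (\<phi> x + bsum \<phi> \<omega> n (imap \<beta> x))\<^sup>2 \<partial>nu))
      = koop (\<lambda>y. ((\<phi> x)\<^sup>2 + (2 * \<phi> x) * birk \<phi> n y) + second_moment \<phi> n y) x"
    by (simp add: koop_def)
  show ?thesis unfolding e1 e2 koop_linear by (rule refl)
qed

lemma bdd_meas_second_moment: "bdd_meas \<phi> \<Longrightarrow> bdd_meas (second_moment \<phi> n)"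
proof (induction n)
  case 0
  then show ?case by (simp add: second_moment_def[abs_def])
next
  case (Suc n)
  have "second_moment \<phi> (Suc n) = (\<lambda>x. \<phi> x * \<phi> x + 2 * \<phi> x * koop (birk \<phi> n) x + koop (second_moment \<phi> n) x)"
    using second_moment_Suc[OF Suc.prems] by (simp add: fun_eq_iff power2_eq_square)
  then show ?case using Suc by (auto intro!: bdd_meas_add bdd_meas_mult bdd_meas_koop bdd_meas_birk)
qed

lemma integral_run: "\<beta> \<in> \<Omega> \<Longrightarrow> (\<integral>\<omega>. run \<beta> L \<omega> \<partial>nu) = p \<beta> ^ L"
proof (induction L)
  case 0
  then show ?case using nu.prob_space by simp
next
  case (Suc L)
  have "(\<integral>\<omega>. run \<beta> (Suc L) \<omega> \<partial>nu) = (\<Sum>\<gamma>\<in>\<Omega>. p \<gamma> * (of_bool (\<gamma> = \<beta>) * (\<integral>\<omega>. run \<beta> L \<omega> \<partial>nu)))"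
    by (subst integral_nu_step[OF bdd_nu_run]) (simp add: run_case_nat)
  also have "\<dots> = (\<Sum>\<gamma>\<in>\<Omega>. if \<gamma> = \<beta> then p \<beta> * p \<beta> ^ L else 0)"
    using Suc by (intro sum.cong) auto
  finally show ?case using Suc.prems finite_Omega by simp
qed

text \<open>On the run the orbit is deterministic; after \<open>L\<close> steps the annealed chain
  takes over at \<open>(imap \<beta> ^^ L) x\<close>.\<close>

lemma integral_bsum_run:
  assumes \<phi>: "bdd_meas \<phi>" and \<beta>: "\<beta> \<in> \<Omega>" and "L \<le> r"
  shows "(\<integral>\<omega>. bsum \<phi> \<omega> r x * run \<beta> L \<omega> \<partial>nu)
    = p \<beta> ^ L * ((\<Sum>j<L. \<phi> ((imap \<beta> ^^ j) x)) + birk \<phi> (r - L) ((imap \<beta> ^^ L) x))"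
  using \<open>L \<le> r\<close>
proof (induction L arbitrary: r x)
  case 0
  then show ?case by (simp add: integral_bsum[OF \<phi>])
next
  case (Suc L)
  then obtain r' where r: "r = Suc r'" "L \<le> r'" by (cases r) auto
  let ?I = "\<lambda>y. \<integral>\<omega>. (\<phi> x + bsum \<phi> \<omega> r' y) * run \<beta> L \<omega> \<partial>nu"
  have "(\<integral>\<omega>. bsum \<phi> \<omega> r x * run \<beta> (Suc L) \<omega> \<partial>nu)
     = (\<Sum>\<gamma>\<in>\<Omega>. p \<gamma> * (\<integral>\<omega>. (\<phi> x + bsum \<phi> \<omega> r' (imap \<gamma> x)) * (of_bool (\<gamma> = \<beta>) * run \<beta> L \<omega>) \<partial>nu))"
    unfolding r by (subst integral_nu_step[OF bdd_nu_mult[OF bdd_nu_bsum[OF \<phi>] bdd_nu_run]])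
      (simp only: run_case_nat bsum_case_nat)
  also have "\<dots> = (\<Sum>\<gamma>\<in>\<Omega>. if \<gamma> = \<beta> then p \<beta> * ?I (imap \<beta> x) else 0)"
    by (intro sum.cong) auto
  also have "\<dots> = p \<beta> * ?I (imap \<beta> x)" using finite_Omega \<beta> by simp
  also have "?I y = \<phi> x * p \<beta> ^ L + (\<integral>\<omega>. bsum \<phi> \<omega> r' y * run \<beta> L \<omega> \<partial>nu)" for y
  proof -
    have "?I y = (\<integral>\<omega>. \<phi> x * run \<beta> L \<omega> + bsum \<phi> \<omega> r' y * run \<beta> L \<omega> \<partial>nu)"
      by (intro Bochner_Integration.integral_cong) (auto simp: distrib_right)
    then show ?thesis
      using bdd_nu_integrable[OF bdd_nu_run] bdd_nu_integrable[OF bdd_nu_mult[OF bdd_nu_bsum[OF \<phi>] bdd_nu_run]]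
      by (simp add: integral_run[OF \<beta>])
  qed
  also have "p \<beta> * (\<phi> x * p \<beta> ^ L + (\<integral>\<omega>. bsum \<phi> \<omega> r' (imap \<beta> x) * run \<beta> L \<omega> \<partial>nu))
     = p \<beta> ^ Suc L * ((\<Sum>j<Suc L. \<phi> ((imap \<beta> ^^ j) x)) + birk \<phi> (r - Suc L) ((imap \<beta> ^^ Suc L) x))"
    unfolding Suc.IH[OF r(2)] sum.lessThan_Suc_shift
    by (simp add: r(1) funpow_swap1 algebra_simps)
  finally show ?case .
qed

text \<open>For \<beta> in \<Omega> the centring makes a block orthogonal to everything that depends
  only on letters outside it.\<close>

definition block :: "real \<Rightarrow> nat \<Rightarrow> nat \<Rightarrow> (nat \<Rightarrow> real) \<Rightarrow> real" where
  "block \<beta> L s \<omega> = run \<beta> L (\<lambda>i. \<omega> (i + s)) - p \<beta> ^ L"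

lemma block_case_nat: "block \<beta> L (Suc s) (case_nat \<gamma> \<omega>) = block \<beta> L s \<omega>"
  by (simp add: block_def)

lemma bdd_nu_block: "bdd_nu (block \<beta> L s)"
proof -
  have "bdd_nu (\<lambda>\<omega>. run \<beta> L (\<lambda>i. \<omega> (i + s)) + - (p \<beta> ^ L))"
    by (intro bdd_nu_add bdd_nu_const bdd_nu_comp[OF bdd_nu_run measurable_shift])
  then show ?thesis by (simp add: block_def[abs_def])
qed

lemma integral_block:
  assumes "\<beta> \<in> \<Omega>"
  shows "(\<integral>\<omega>. block \<beta> L s \<omega> \<partial>nu) = 0"
proof (induction s)
  case 0
  show ?case unfolding block_def
    using bdd_nu_integrable[OF bdd_nu_run] integral_run[OF assms] nu.prob_space by simp
next
  case (Suc s)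
  show ?case by (subst integral_nu_step[OF bdd_nu_block]) (simp add: block_case_nat Suc)
qed

text \<open>Terms of the sum that are fixed before the block drop out because the block is centred;
  the first \<open>s\<close> letters then only move the starting point, which yields
  \<open>koop ^^ s\<close>.\<close>

lemma integral_bsum_block:
  assumes \<phi>: "bdd_meas \<phi>" and \<beta>: "\<beta> \<in> \<Omega>" and "s + L \<le> n"
  shows "(\<integral>\<omega>. bsum \<phi> \<omega> n x * block \<beta> L s \<omega> \<partial>nu)
    = (koop ^^ s) (\<lambda>x. p \<beta> ^ L * ((\<Sum>j<L. \<phi> ((imap \<beta> ^^ j) x)) + birk \<phi> (n - s - L) ((imap \<beta> ^^ L) x)
        - birk \<phi> (n - s) x)) x"
  using \<open>s + L \<le> n\<close>
proof (induction s arbitrary: n x)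
  case 0
  have "(\<integral>\<omega>. bsum \<phi> \<omega> n x * block \<beta> L 0 \<omega> \<partial>nu)
      = (\<integral>\<omega>. bsum \<phi> \<omega> n x * run \<beta> L \<omega> - p \<beta> ^ L * bsum \<phi> \<omega> n x \<partial>nu)"
    by (intro Bochner_Integration.integral_cong) (auto simp: block_def algebra_simps)
  also have "\<dots> = (\<integral>\<omega>. bsum \<phi> \<omega> n x * run \<beta> L \<omega> \<partial>nu) - p \<beta> ^ L * birk \<phi> n x"
    using bdd_nu_integrable[OF bdd_nu_mult[OF bdd_nu_bsum[OF \<phi>] bdd_nu_run]]
      bdd_nu_integrable[OF bdd_nu_bsum[OF \<phi>]] by (simp add: integral_bsum[OF \<phi>])
  finally show ?case using 0 by (simp add: integral_bsum_run[OF \<phi> \<beta>] right_diff_distrib)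
next
  case (Suc s)
  then obtain n' where n: "n = Suc n'" "s + L \<le> n'" by (cases n) auto
  have e1: "(\<integral>\<omega>. bsum \<phi> \<omega> n x * block \<beta> L (Suc s) \<omega> \<partial>nu)
     = (\<Sum>\<gamma>\<in>\<Omega>. p \<gamma> * (\<integral>\<omega>. (\<phi> x + bsum \<phi> \<omega> n' (imap \<gamma> x)) * block \<beta> L s \<omega> \<partial>nu))"
    unfolding n by (subst integral_nu_step[OF bdd_nu_mult[OF bdd_nu_bsum[OF \<phi>] bdd_nu_block]])
      (simp only: block_case_nat bsum_case_nat)
  have e2: "(\<integral>\<omega>. (\<phi> x + bsum \<phi> \<omega> n' y) * block \<beta> L s \<omega> \<partial>nu) = (\<integral>\<omega>. bsum \<phi> \<omega> n' y * block \<beta> L s \<omega> \<partial>nu)" for y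
  proof -
    have "(\<integral>\<omega>. (\<phi> x + bsum \<phi> \<omega> n' y) * block \<beta> L s \<omega> \<partial>nu)
        = (\<integral>\<omega>. \<phi> x * block \<beta> L s \<omega> + bsum \<phi> \<omega> n' y * block \<beta> L s \<omega> \<partial>nu)"
      by (intro Bochner_Integration.integral_cong) (auto simp: distrib_right)
    then show ?thesis
      using bdd_nu_integrable[OF bdd_nu_block] bdd_nu_integrable[OF bdd_nu_mult[OF bdd_nu_bsum[OF \<phi>] bdd_nu_block]]
      by (simp add: integral_block[OF \<beta>])
  qed
  show ?case unfolding e1 e2 Suc.IH[OF n(2)] unfolding n(1) diff_Suc_Suc funpow.simps o_apply
    by (rule koop_def[symmetric])
qed

text \<open>Independence of the first \<open>L\<close> letters from the rest. The function
  \<open>h\<close> varies in the induction because a first letter other than \<beta> makes the run 0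
  and replaces \<open>h\<close> by the constant \<open>h 0\<close>.\<close>

lemma integral_run_shift:
  assumes \<beta>: "\<beta> \<in> \<Omega>" and G: "bdd_nu G"
  shows "(\<integral>\<omega>. h (run \<beta> L \<omega>) * G (\<lambda>i. \<omega> (i + L)) \<partial>nu)
    = (p \<beta> ^ L * h 1 + (1 - p \<beta> ^ L) * h 0) * (\<integral>\<omega>. G \<omega> \<partial>nu)"
proof (induction L arbitrary: h)
  case (Suc L)
  have run01: "run \<beta> L \<omega> = 0 \<or> run \<beta> L \<omega> = 1" for L \<omega>
    unfolding run_def of_bool_def by presburger
  have bh: "bdd_nu (\<lambda>\<omega>. h (run \<beta> L \<omega>))" for L h
  proof -
    have "h (run \<beta> L \<omega>) = h 0 + (h 1 - h 0) * run \<beta> L \<omega>" for \<omega>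
      using run01[of L \<omega>] by auto
    then show ?thesis by (simp add: bdd_nu_add bdd_nu_mult bdd_nu_const bdd_nu_run)
  qed
  have b: "bdd_nu (\<lambda>\<omega>. h (run \<beta> (Suc L) \<omega>) * G (\<lambda>i. \<omega> (i + Suc L)))"
    by (intro bdd_nu_mult bh bdd_nu_comp[OF G measurable_shift])
  have "(\<integral>\<omega>. h (run \<beta> (Suc L) \<omega>) * G (\<lambda>i. \<omega> (i + Suc L)) \<partial>nu)
    = (\<Sum>\<gamma>\<in>\<Omega>. p \<gamma> * (\<integral>\<omega>. h (of_bool (\<gamma> = \<beta>) * run \<beta> L \<omega>) * G (\<lambda>i. \<omega> (i + L)) \<partial>nu))"
    by (subst integral_nu_step[OF b]) (simp add: run_case_nat)
  also have "\<dots> = (\<Sum>\<gamma>\<in>\<Omega>. p \<gamma> * (h 0 * (\<integral>\<omega>. G \<omega> \<partial>nu))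
      + (if \<gamma> = \<beta> then p \<beta> * ((p \<beta> ^ L * h 1 + (1 - p \<beta> ^ L) * h 0 - h 0) * (\<integral>\<omega>. G \<omega> \<partial>nu)) else 0))"
  proof (intro sum.cong refl)
    fix \<gamma> assume "\<gamma> \<in> \<Omega>"
    have "(\<integral>\<omega>. h (of_bool (\<gamma> = \<beta>) * run \<beta> L \<omega>) * G (\<lambda>i. \<omega> (i + L)) \<partial>nu)
      = (if \<gamma> = \<beta> then (p \<beta> ^ L * h 1 + (1 - p \<beta> ^ L) * h 0) * (\<integral>\<omega>. G \<omega> \<partial>nu) else h 0 * (\<integral>\<omega>. G \<omega> \<partial>nu))"
      using Suc.IH[of h] Suc.IH[of "\<lambda>_. h 0"] by (auto simp: algebra_simps)
    then show "p \<gamma> * (\<integral>\<omega>. h (of_bool (\<gamma> = \<beta>) * run \<beta> L \<omega>) * G (\<lambda>i. \<omega> (i + L)) \<partial>nu)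
      = p \<gamma> * (h 0 * (\<integral>\<omega>. G \<omega> \<partial>nu))
      + (if \<gamma> = \<beta> then p \<beta> * ((p \<beta> ^ L * h 1 + (1 - p \<beta> ^ L) * h 0 - h 0) * (\<integral>\<omega>. G \<omega> \<partial>nu)) else 0)"
      by (auto simp: algebra_simps)
  qed
  also have "\<dots> = h 0 * (\<integral>\<omega>. G \<omega> \<partial>nu)
      + p \<beta> * ((p \<beta> ^ L * h 1 + (1 - p \<beta> ^ L) * h 0 - h 0) * (\<integral>\<omega>. G \<omega> \<partial>nu))"
    using finite_Omega \<beta> by (simp add: sum.distrib p_sum flip: sum_distrib_right)
  also have "\<dots> = (p \<beta> ^ Suc L * h 1 + (1 - p \<beta> ^ Suc L) * h 0) * (\<integral>\<omega>. G \<omega> \<partial>nu)"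
    by (simp add: algebra_simps)
  finally show ?case .
qed simp

definition blocks :: "real \<Rightarrow> nat \<Rightarrow> nat \<Rightarrow> (nat \<Rightarrow> real) \<Rightarrow> real" where
  "blocks \<beta> L N \<omega> = (\<Sum>k<N. block \<beta> L (k * L) \<omega>)"

lemma bdd_nu_blocks: "bdd_nu (blocks \<beta> L N)"
  unfolding blocks_def[abs_def] by (intro bdd_nu_sum bdd_nu_block)

lemma blocks_Suc: "blocks \<beta> L (Suc N) \<omega> = (run \<beta> L \<omega> - p \<beta> ^ L) + blocks \<beta> L N (\<lambda>i. \<omega> (i + L))"
  unfolding blocks_def sum.lessThan_Suc_shift by (simp add: block_def add_ac)

lemma p_power_01:
  assumes "\<beta> \<in> \<Omega>" shows "0 \<le> p \<beta> ^ L" "p \<beta> ^ L \<le> 1"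
proof -
  have "p \<beta> \<le> (\<Sum>\<beta>\<in>\<Omega>. p \<beta>)" using finite_Omega assms p_nonneg by (intro member_le_sum) auto
  then show "0 \<le> p \<beta> ^ L" "p \<beta> ^ L \<le> 1" using p_nonneg[OF assms] p_sum by (auto intro: power_le_one)
qed

text \<open>Moment recursion for a sum of independent centred terms. The first moment is carried
  along to remove the odd terms: in the fourth moment \<open>e 3\<close> meets
  \<open>?c 1 = 0\<close> and \<open>?c 3\<close> meets \<open>e 1 = 0\<close>, so third moments
  need no bound.\<close>

lemma blocks_moments:
  assumes \<beta>: "\<beta> \<in> \<Omega>"
  shows "(\<integral>\<omega>. blocks \<beta> L N \<omega> \<partial>nu) = 0 \<and> (\<integral>\<omega>. blocks \<beta> L N \<omega> ^ 2 \<partial>nu) \<le> real N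
    \<and> (\<integral>\<omega>. blocks \<beta> L N \<omega> ^ 4 \<partial>nu) \<le> 3 * (real N)\<^sup>2"
proof (induction N)
  case 0
  then show ?case by (simp add: blocks_def)
next
  case (Suc N)
  define t where "t = p \<beta> ^ L"
  have t: "0 \<le> t" "t \<le> 1" using p_power_01[OF \<beta>] by (auto simp: t_def)
  let ?Z = "blocks \<beta> L N"
  \<comment> \<open>The \<open>a\<close>-th central moment of \<open>run\<close>, a Bernoulli
    variable with parameter \<open>t\<close>.\<close>
  let ?c = "\<lambda>a. t * (1 - t) ^ a + (1 - t) * (- t) ^ a"
  define e where "e k = (\<integral>\<omega>. ?Z \<omega> ^ k \<partial>nu)" for k :: nat
  have e0: "e 0 = 1" using nu.prob_space by (simp add: e_def)
  have step: "(\<integral>\<omega>. (run \<beta> L \<omega> - t) ^ a * ?Z (\<lambda>i. \<omega> (i + L)) ^ k \<partial>nu) = ?c a * e k" for a k :: nat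
    using integral_run_shift[OF \<beta> bdd_nu_power[OF bdd_nu_blocks[of \<beta> L N], of k],
        of "\<lambda>y. (y - t) ^ a" L]
    by (simp add: e_def t_def)
  have int: "integrable nu (\<lambda>\<omega>. (run \<beta> L \<omega> - t) ^ a * ?Z (\<lambda>i. \<omega> (i + L)) ^ k)" for a k :: nat
  proof (intro bdd_nu_integrable bdd_nu_mult bdd_nu_power)
    show "bdd_nu (\<lambda>\<omega>. run \<beta> L \<omega> - t)"
      using bdd_nu_add[OF bdd_nu_run bdd_nu_const, of \<beta> L "- t"] by simp
    show "bdd_nu (\<lambda>\<omega>. ?Z (\<lambda>i. \<omega> (i + L)))" by (rule bdd_nu_comp[OF bdd_nu_blocks measurable_shift])
  qed
  have binom: "(\<integral>\<omega>. blocks \<beta> L (Suc N) \<omega> ^ m \<partial>nu) = (\<Sum>a\<le>m. real (m choose a) * (?c a * e (m - a)))" for m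
  proof -
    have "(\<integral>\<omega>. blocks \<beta> L (Suc N) \<omega> ^ m \<partial>nu)
       = (\<integral>\<omega>. (\<Sum>a\<le>m. real (m choose a) * ((run \<beta> L \<omega> - t) ^ a * ?Z (\<lambda>i. \<omega> (i + L)) ^ (m - a))) \<partial>nu)"
      unfolding blocks_Suc t_def[symmetric] binomial_ring by (simp add: mult.assoc)
    then show ?thesis using int step by simp
  qed
  have c0: "?c 0 = 1" and c1: "?c 1 = 0" by (simp_all add: algebra_simps)
  have c: "\<bar>?c a\<bar> \<le> 1" for a
  proof -
    have "\<bar>(1 - t) ^ a\<bar> \<le> 1" "\<bar>(- t) ^ a\<bar> \<le> 1"
      using t by (auto simp: power_abs intro!: power_le_one)
    then have "\<bar>t * (1 - t) ^ a\<bar> \<le> t * 1" "\<bar>(1 - t) * (- t) ^ a\<bar> \<le> (1 - t) * 1"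
      unfolding abs_mult using t by (auto simp: mult_left_le)
    then have "\<bar>?c a\<bar> \<le> t * 1 + (1 - t) * 1" by (rule order_trans[OF abs_triangle_ineq add_mono])
    also have "\<dots> = 1" by simp
    finally show ?thesis .
  qed
  have IH: "e 1 = 0" "e 2 \<le> real N" "e 4 \<le> 3 * (real N)\<^sup>2" using Suc by (simp_all add: e_def)
  have e2: "0 \<le> e 2" unfolding e_def by (rule integral_nonneg_AE) simp
  have m1: "(\<integral>\<omega>. blocks \<beta> L (Suc N) \<omega> ^ 1 \<partial>nu) = 0"
    unfolding binom using IH(1) c1 by (simp add: e0)
  have "(\<integral>\<omega>. blocks \<beta> L (Suc N) \<omega> ^ 2 \<partial>nu) = e 2 + ?c 2"
    unfolding binom using IH(1) c0 c1 e0 by (simp add: numeral_2_eq_2)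
  then have m2: "(\<integral>\<omega>. blocks \<beta> L (Suc N) \<omega> ^ 2 \<partial>nu) \<le> real (Suc N)"
    using IH(2) c[of 2] by simp
  have "(\<integral>\<omega>. blocks \<beta> L (Suc N) \<omega> ^ 4 \<partial>nu) = e 4 + 6 * (?c 2 * e 2) + ?c 4"
  proof -
    have "{..4::nat} = {0, 1, 2, 3, 4}" by auto
    moreover have "4 choose 2 = (6::nat)" "4 choose 3 = (4::nat)" by (simp_all add: eval_nat_numeral)
    ultimately show ?thesis unfolding binom using IH(1) c0 c1 e0 by simp
  qed
  moreover have "?c 2 * e 2 \<le> 1 * real N"
    using c[of 2] e2 IH(2) by (intro mult_mono) auto
  ultimately have "(\<integral>\<omega>. blocks \<beta> L (Suc N) \<omega> ^ 4 \<partial>nu) \<le> 3 * (real N)\<^sup>2 + 6 * real N + 1"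
    using IH(3) c[of 4] by simp
  also have "\<dots> \<le> 3 * (real (Suc N))\<^sup>2" by (simp add: power2_eq_square algebra_simps)
  finally show ?case using m1 m2 by simp
qed

lemma integral_nu_swap:
  assumes M: "prob_space M" "sets M = sets m01"
    and F: "(\<lambda>z. F (fst z) (snd z)) \<in> borel_measurable (nu \<Otimes>\<^sub>M M)" "\<And>\<omega> x. \<bar>F \<omega> x\<bar> \<le> B"
  shows "(\<integral>\<omega>. (\<integral>x. F \<omega> x \<partial>M) \<partial>nu) = (\<integral>x. (\<integral>\<omega>. F \<omega> x \<partial>nu) \<partial>M)"
    and "bdd_nu (\<lambda>\<omega>. \<integral>x. F \<omega> x \<partial>M)"
proof -
  interpret M: prob_space M by fact
  interpret pr: pair_prob_space nu M ..
  have "integrable (nu \<Otimes>\<^sub>M M) (\<lambda>(\<omega>, x). F \<omega> x)"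
    using F by (intro pr.P.integrable_const_bound[of _ B]) (auto simp: split_beta')
  from pr.Fubini_integral[OF this] show "(\<integral>\<omega>. (\<integral>x. F \<omega> x \<partial>M) \<partial>nu) = (\<integral>x. (\<integral>\<omega>. F \<omega> x \<partial>nu) \<partial>M)"
    by simp
  show "bdd_nu (\<lambda>\<omega>. \<integral>x. F \<omega> x \<partial>M)"
  proof (rule bdd_nuI)
    show "(\<lambda>\<omega>. \<integral>x. F \<omega> x \<partial>M) \<in> borel_measurable nu"
      using F(1) by (intro M.borel_measurable_lebesgue_integral) (simp add: split_beta')
    fix \<omega>
    have "0 \<le> B" using F(2)[of \<omega> 0] by linarith
    have "(\<integral>x. \<bar>F \<omega> x\<bar> \<partial>M) \<le> B"
    proof (cases "integrable M (\<lambda>x. \<bar>F \<omega> x\<bar>)")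
      case True
      then have "(\<integral>x. \<bar>F \<omega> x\<bar> \<partial>M) \<le> (\<integral>x. B \<partial>M)" using F(2) by (intro integral_mono) auto
      then show ?thesis using M.prob_space by simp
    qed (use \<open>0 \<le> B\<close> in \<open>simp add: not_integrable_integral_eq\<close>)
    then show "\<bar>\<integral>x. F \<omega> x \<partial>M\<bar> \<le> B" by (rule order_trans[OF integral_abs_bound])
  qed
qed

end

section \<open>The effect of a long run of one parameter\<close>

context intermittent_system
begin

text \<open>The left branches increase, so under the same letters a point further to the right
  leaves the left half no later.\<close>

lemma tau_antimono: "0 < x \<Longrightarrow> x \<le> y \<Longrightarrow> y \<le> 1 \<Longrightarrow> tau m y \<le> tau m x"
proof (induction m arbitrary: x y)
  case (Suc m)
  show ?case
  proof (cases "y \<le> 1/2")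
    case True
    have "koop (tau m) y \<le> koop (tau m) x"
      unfolding koop_def
    proof (intro sum_mono mult_left_mono p_nonneg)
      fix \<beta> assume "\<beta> \<in> \<Omega>"
      then show "tau m (imap \<beta> y) \<le> tau m (imap \<beta> x)"
        using Suc.prems True Omega_bounds[of \<beta>]
        by (intro Suc.IH imap_pos imap_left_mono imap_unit) auto
    qed
    then show ?thesis using True Suc.prems by (simp add: tau_Suc kleft_def)
  next
    case False
    then show ?thesis using tau_nonneg[of "Suc m" x] by (simp add: tau_Suc kleft_def)
  qed
qed simp

text \<open>Controls the part of the entrance time beyond \<open>M\<close>. It is multiplied by the
  length of the run in \<open>run_tau_bound\<close> and must therefore be small, not only
  finite.\<close>

definition excess :: "nat \<Rightarrow> real" where
  "excess M = (\<integral>x. max 0 (lyap x - real M) \<partial>m01)"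

lemma excess_integrable: "integrable m01 (\<lambda>x. max 0 (lyap x - real M))"
  using lyap_integrable by (intro integrable_max) auto

lemma excess_tendsto_0: "excess \<longlonglongrightarrow> 0"
proof -
  have "(\<lambda>M. \<integral>x. max 0 (lyap x - real M) \<partial>m01) \<longlonglongrightarrow> (\<integral>x. 0 \<partial>m01)"
  proof (rule integral_dominated_convergence[where w = lyap])
    show "AE x in m01. norm (max 0 (lyap x - real M)) \<le> lyap x" for M
      using lyap_nonneg by (intro AE_I2) simp
    show "AE x in m01. (\<lambda>M. max 0 (lyap x - real M)) \<longlonglongrightarrow> 0"
    proof (rule AE_I2)
      fix x
      obtain k :: nat where k: "lyap x \<le> real k" using real_arch_simple by blast
      have "\<forall>\<^sub>F M in sequentially. max 0 (lyap x - real M) = 0"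
        using eventually_ge_at_top[of k] by eventually_elim (use k in auto)
      then show "(\<lambda>M. max 0 (lyap x - real M)) \<longlonglongrightarrow> 0" by (rule tendsto_eventually)
    qed
  qed (use lyap_integrable excess_integrable in auto)
  then show ?thesis by (simp add: excess_def[abs_def])
qed

end

context stationary_system
begin

lemma singleton_system: "\<beta> \<in> \<Omega> \<Longrightarrow> intermittent_system {\<beta>} (\<lambda>_. 1) \<alpha>"
  using Omega_subset alpha_less_1 by unfold_locales auto

text \<open>Under repeated application of a single map, mass can enter a neighbourhood of the neutral
  fixed point only through the right branch, hence with bounded density.\<close>

lemma run_tau_bound:
  assumes \<beta>: "\<beta> \<in> \<Omega>"
  shows "(\<integral>x. (intermittent_system.pf {\<beta>} (\<lambda>_. 1) ^^ L) ((pf ^^ s) (\<lambda>_. 1)) x * tau r x \<partial>m01)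
    \<le> real M + 2 / right_mass * mean_tau r + 16 * excess M * real L"
proof -
  interpret s: intermittent_system "{\<beta>}" "\<lambda>_. 1" \<alpha> by (rule singleton_system[OF \<beta>])
  note \<beta>b = Omega_bounds[OF \<beta>]
  let ?\<rho> = "(pf ^^ s) (\<lambda>_. 1)"
  let ?g = "\<lambda>j. (s.pf ^^ j) ?\<rho>"
  let ?t = "\<lambda>x. max 0 (tau r x - real M)"
  have g: "dcone 2 {0<..1} (?g j)" for j by (rule s.dcone_pf_pow[OF pf_pow_one(2)])
  have bt: "bdd_meas ?t" by (intro bdd_meas_max bdd_meas_diff bdd_meas_tau bdd_meas_const)
  have mass: "(\<integral>x. ?g j x \<partial>m01) = 1" for j
    using s.pf_pow_dual[OF pf_pow_one(1)[of s] bdd_meas_const[of 1], of j] pf_pow_one(4)[of s]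
    by (simp add: s.koop_pow_linear)
  have step: "(\<integral>x. ?g (Suc j) x * ?t x \<partial>m01) \<le> (\<integral>x. ?g j x * ?t x \<partial>m01) + 16 * excess M" for j
  proof -
    let ?f = "?g j"
    note fD = dconeD[OF g[of j]]
    have f4: "dcone 4 {1/2<..1} ?f" by (rule dcone_weaken[OF dcone_subset[OF g]]) auto
    have ik: "s.kleft ?t x = left_ind x * ?t (imap \<beta> x)" for x
      by (simp add: s.kleft_def s.koop_def)
    \<comment> \<open>A left step moves points towards the right half, so the excess of their
      entrance time does not grow.\<close>
    have le1: "(\<integral>x. s.eop ?f x * ?t x \<partial>m01) \<le> (\<integral>x. ?f x * ?t x \<partial>m01)"
      unfolding s.eop_dual[OF fD(1) bt]
    proof (rule integral_m01_mono)
      fix x :: real assume x: "0 < x" "x \<le> 1"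
      have "s.kleft ?t x \<le> ?t x"
      proof (cases "x \<le> 1/2")
        case True
        have "tau r (imap \<beta> x) \<le> tau r x"
          using x True \<beta>b lbr_ge[of x \<beta>] by (intro tau_antimono imap_unit) (auto simp: imap_left)
        then show ?thesis unfolding ik using True by simp
      qed (simp add: ik)
      then show "?f x * s.kleft ?t x \<le> ?f x * ?t x" using fD(2) by (intro mult_left_mono)
    qed (use fD(1) bt in \<open>auto intro!: bdd_meas_mult s.bdd_meas_kleft\<close>)
    \<comment> \<open>Mass arriving through the right branch has density at most 16, because the
      total mass is 1.\<close>
    have le2: "(\<integral>x. rop ?f x * ?t x \<partial>m01) \<le> (\<integral>x. 16 * max 0 (lyap x - real M) \<partial>m01)"
    proof (rule integrable_m01_mono)
      show "integrable m01 (\<lambda>x. 16 * max 0 (lyap x - real M))" using excess_integrable by simp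
      show "bdd_meas (\<lambda>x. rop ?f x * ?t x)" using fD(1) bt by (intro bdd_meas_mult bdd_meas_rop)
      fix x :: real assume x: "0 < x" "x \<le> 1"
      have "(\<integral>x. ?f x * right_ind x \<partial>m01) \<le> (\<integral>x. ?f x \<partial>m01)"
        using fD(1,2) bdd_meas_right_ind
        by (intro integral_m01_mono bdd_meas_mult) (auto simp: mult_left_le)
      then have "rop ?f x \<le> 16"
        using dcone_upper[OF f4, of "(1 + x) / 2"] x mass[of j] by (simp add: rop_def)
      moreover have "?t x \<le> max 0 (lyap x - real M)" using tau_le_lyap[OF x, of r] by auto
      moreover have "0 \<le> rop ?f x" using fD(2) by (simp add: rop_def)
      ultimately show "rop ?f x * ?t x \<le> 16 * max 0 (lyap x - real M)"
        by (intro mult_mono) auto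
    qed
    have "(\<integral>x. ?g (Suc j) x * ?t x \<partial>m01) = (\<integral>x. s.eop ?f x * ?t x + rop ?f x * ?t x \<partial>m01)"
      by (simp add: s.pf_def distrib_right)
    also have "\<dots> = (\<integral>x. s.eop ?f x * ?t x \<partial>m01) + (\<integral>x. rop ?f x * ?t x \<partial>m01)"
      using fD(1) bt
      by (intro Bochner_Integration.integral_add bdd_meas_integrable_m01 bdd_meas_mult s.bdd_meas_eop bdd_meas_rop)
    finally show ?thesis using le1 le2 by (simp add: excess_def)
  qed
  have iter: "(\<integral>x. ?g L x * ?t x \<partial>m01) \<le> (\<integral>x. ?\<rho> x * ?t x \<partial>m01) + 16 * excess M * real L" for L
  proof (induction L)
    case (Suc L)
    then show ?case using step[of L] by (simp add: distrib_left)
  qed simp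
  note gD = dconeD[OF g[of L]] and \<rho>D = dconeD[OF pf_pow_one(2)[of s]]
  have "(\<integral>x. ?\<rho> x * ?t x \<partial>m01) \<le> (\<integral>x. ?\<rho> x * tau r x \<partial>m01)"
    using \<rho>D(1,2) bt tau_nonneg by (intro integral_m01_mono bdd_meas_mult bdd_meas_tau mult_left_mono) auto
  also have "\<dots> \<le> 2 / right_mass * mean_tau r"
    unfolding mean_tau_def by (rule pf_pow_one_le_mu[OF bdd_meas_tau tau_nonneg])
  finally have 1: "(\<integral>x. ?\<rho> x * ?t x \<partial>m01) \<le> 2 / right_mass * mean_tau r" .
  have "(\<integral>x. ?g L x * tau r x \<partial>m01) \<le> (\<integral>x. real M * ?g L x + ?g L x * ?t x \<partial>m01)"
  proof (rule integral_m01_mono)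
    fix x :: real
    have "?g L x * tau r x \<le> ?g L x * (real M + ?t x)" using gD(2) by (intro mult_left_mono) auto
    then show "?g L x * tau r x \<le> real M * ?g L x + ?g L x * ?t x" by (simp add: algebra_simps)
  qed (use gD(1) bt in \<open>auto intro!: bdd_meas_add bdd_meas_mult bdd_meas_tau\<close>)
  also have "\<dots> = real M * 1 + (\<integral>x. ?g L x * ?t x \<partial>m01)"
  proof -
    have "integrable m01 (\<lambda>x. real M * ?g L x)" "integrable m01 (\<lambda>x. ?g L x * ?t x)"
      using gD(1) bt by (auto intro!: bdd_meas_integrable_m01 bdd_meas_mult)
    then have "(\<integral>x. real M * ?g L x + ?g L x * ?t x \<partial>m01)
      = (\<integral>x. real M * ?g L x \<partial>m01) + (\<integral>x. ?g L x * ?t x \<partial>m01)"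
      by (rule Bochner_Integration.integral_add)
    then show ?thesis using mass[of L] by simp
  qed
  finally show ?thesis using iter[of L] 1 by simp
qed

lemma singleton_koop_pow:
  "(intermittent_system.koop {\<beta>} (\<lambda>_. 1) ^^ j) f x = f ((imap \<beta> ^^ j) x)" if "\<beta> \<in> \<Omega>"
proof -
  interpret s: intermittent_system "{\<beta>}" "\<lambda>_. 1" \<alpha> by (rule singleton_system[OF that])
  have k: "s.koop h y = h (imap \<beta> y)" for h y by (simp add: s.koop_def)
  show ?thesis
  proof (induction j arbitrary: x)
    case (Suc j)
    have "(s.koop ^^ Suc j) f x = s.koop ((s.koop ^^ j) f) x" by simp
    also have "\<dots> = (s.koop ^^ j) f (imap \<beta> x)" by (rule k)
    also have "\<dots> = f ((imap \<beta> ^^ j) (imap \<beta> x))" by (rule Suc)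
    finally show ?case by (simp only: funpow_Suc_right o_apply)
  qed simp
qed

end

context observable_system
begin

text \<open>The coupling bound for the single map: its reference mean grows like \<open>L\<close>
  times the integral against its invariant measure. Its truncated entrance time is compared with
  \<mu>, uniformly in \<open>s\<close>, and is sublinear there.\<close>

lemma orbit_average:
  assumes \<beta>: "\<beta> \<in> \<Omega>" and inv: "ac_invariant \<beta> \<mu>'" and "0 < e"
  obtains L0 where "\<And>L s. L0 \<le> L \<Longrightarrow>
    \<bar>(\<integral>x. (pf ^^ s) (\<lambda>_. 1) x * (\<Sum>j<L. \<phi> ((imap \<beta> ^^ j) x)) \<partial>m01) - real L * (\<integral>x. \<phi> x \<partial>\<mu>')\<bar> \<le> e * real L"
proof -
  interpret s: intermittent_system "{\<beta>}" "\<lambda>_. 1" \<alpha> by (rule singleton_system[OF \<beta>])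
  have ac: "ac_prob \<mu>'" using inv by (simp add: ac_invariant_def)
  then interpret mu': prob_space \<mu>' by (simp add: ac_prob_def)
  interpret st: stationary_system "{\<beta>}" "\<lambda>_. 1" \<alpha> \<mu>'
  proof
    show "ac_prob \<mu>'" by fact
    show "(\<integral>x. s.koop \<psi> x \<partial>\<mu>') = (\<integral>x. \<psi> x \<partial>\<mu>')" if "bdd_meas \<psi>" for \<psi>
      using inv ac that
      by (intro s.integral_koop_stationary mu'.finite_measure_axioms) (auto simp: ac_invariant_def ac_prob_def)
  qed
  have birk: "s.birk \<phi> L x = (\<Sum>j<L. \<phi> ((imap \<beta> ^^ j) x))" for L x
    unfolding s.birk_def by (simp add: singleton_koop_pow[OF \<beta>])
  define a where "a = (\<integral>x. \<phi> x \<partial>\<mu>')"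
  define c where "c = s.coupling_const * \<Phi>"
  define err where "err L = \<bar>s.refK \<phi> L / real L - a\<bar> + (c / real L + 4 * \<Phi> / right_mass * ((\<integral>x. s.tau L x \<partial>\<mu>) / real L))" for L
  have "(\<lambda>L. \<bar>s.refK \<phi> L / real L - a\<bar>) \<longlonglongrightarrow> \<bar>a - a\<bar>"
    unfolding a_def by (intro tendsto_rabs tendsto_diff tendsto_const st.refK_limit[OF bdd_phi])
  moreover have "(\<lambda>L. c / real L) \<longlonglongrightarrow> 0" by (rule lim_const_over_n)
  moreover have "(\<lambda>L. 4 * \<Phi> / right_mass * ((\<integral>x. s.tau L x \<partial>\<mu>) / real L)) \<longlonglongrightarrow> 4 * \<Phi> / right_mass * 0"
    by (intro tendsto_mult tendsto_const s.tau_sublinear[OF mu.prob_space_axioms sets_mu AE_mu_pos])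
  ultimately have "err \<longlonglongrightarrow> \<bar>a - a\<bar> + (0 + 4 * \<Phi> / right_mass * 0)"
    unfolding err_def by (intro tendsto_add)
  then have "\<forall>\<^sub>F L in sequentially. err L < e"
    using \<open>0 < e\<close> by (intro order_tendstoD(2)) auto
  then obtain L0 where L0: "\<And>L. L0 \<le> L \<Longrightarrow> err L < e" by (auto simp: eventually_sequentially)
  show thesis
  proof (rule that[of "max 1 L0"])
    fix L s assume L: "max 1 L0 \<le> L"
    let ?\<rho> = "(pf ^^ s) (\<lambda>_. 1)"
    have "dcone 4 {0<..1} ?\<rho>" by (rule dcone_weaken[OF pf_pow_one(2)]) auto
    then have "\<bar>(\<integral>x. ?\<rho> x * s.birk \<phi> L x \<partial>m01) - s.refK \<phi> L * (\<integral>x. ?\<rho> x \<partial>m01)\<bar>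
        \<le> s.coupling_const * \<Phi> * (\<integral>x. ?\<rho> x \<partial>m01) + 2 * \<Phi> * (\<integral>x. ?\<rho> x * s.tau L x \<partial>m01)"
      by (rule s.coupling_bound[OF bdd_phi phi_le])
    also have "2 * \<Phi> * (\<integral>x. ?\<rho> x * s.tau L x \<partial>m01) \<le> 2 * \<Phi> * (2 / right_mass * (\<integral>x. s.tau L x \<partial>\<mu>))"
      using Phi_nonneg by (intro mult_left_mono pf_pow_one_le_mu s.bdd_meas_tau s.tau_nonneg) auto
    finally have "\<bar>(\<integral>x. ?\<rho> x * s.birk \<phi> L x \<partial>m01) - s.refK \<phi> L\<bar> \<le> c + 4 * \<Phi> / right_mass * (\<integral>x. s.tau L x \<partial>\<mu>)"
      by (simp add: pf_pow_one(4) c_def)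
    moreover have "real L * err L = \<bar>s.refK \<phi> L - real L * a\<bar> + (c + 4 * \<Phi> / right_mass * (\<integral>x. s.tau L x \<partial>\<mu>))"
    proof -
      have "real L * \<bar>s.refK \<phi> L / real L - a\<bar> = \<bar>real L * (s.refK \<phi> L / real L - a)\<bar>" by (simp add: abs_mult)
      also have "real L * (s.refK \<phi> L / real L - a) = s.refK \<phi> L - real L * a"
        using L by (simp add: field_simps)
      finally show ?thesis using L by (simp add: err_def distrib_left)
    qed
    moreover have "real L * err L \<le> real L * e" using L0[of L] L by (intro mult_left_mono) auto
    ultimately show "\<bar>(\<integral>x. ?\<rho> x * (\<Sum>j<L. \<phi> ((imap \<beta> ^^ j) x)) \<partial>m01) - real L * (\<integral>x. \<phi> x \<partial>\<mu>')\<bar> \<le> e * real L"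
      unfolding birk[symmetric] a_def[symmetric] by (simp add: mult.commute) 
  qed
qed

text \<open>Conditioning on a long run of \<open>\<beta>\<close> shifts the mean of the Birkhoff sum by roughly the length of
  the run times \<open>\<integral>\<phi> d\<mu>\<^bsub>\<beta>\<^esub>\<close>, uniformly in the position of the run.\<close>

lemma block_effect:
  assumes \<beta>: "\<beta> \<in> \<Omega>" and inv: "ac_invariant \<beta> \<mu>'" and "0 < e"
    and N: "\<And>m. \<bar>\<phi> 0\<bar> * mean_tau m \<le> N" and B: "\<And>m. \<bar>refK \<phi> m\<bar> \<le> B"
  obtains L where "0 < L" "\<And>n s. s + L \<le> n \<Longrightarrow>
    \<bar>(\<integral>x. (koop ^^ s) (\<lambda>x. p \<beta> ^ L * ((\<Sum>j<L. \<phi> ((imap \<beta> ^^ j) x))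
        + birk \<phi> (n - s - L) ((imap \<beta> ^^ L) x) - birk \<phi> (n - s) x)) x \<partial>m01)
      - p \<beta> ^ L * (real L * (\<integral>x. \<phi> x \<partial>\<mu>'))\<bar> \<le> p \<beta> ^ L * (e * real L)"
proof -
  interpret s: intermittent_system "{\<beta>}" "\<lambda>_. 1" \<alpha> by (rule singleton_system[OF \<beta>])
  define b where "b = \<bar>\<phi> 0\<bar>"
  have b: "0 \<le> b" by (simp add: b_def)
  obtain L0 where L0: "\<And>L s. L0 \<le> L \<Longrightarrow>
    \<bar>(\<integral>x. (pf ^^ s) (\<lambda>_. 1) x * (\<Sum>j<L. \<phi> ((imap \<beta> ^^ j) x)) \<partial>m01) - real L * (\<integral>x. \<phi> x \<partial>\<mu>')\<bar> \<le> e / 4 * real L"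
    using orbit_average[OF \<beta> inv, of "e / 4"] \<open>0 < e\<close> by auto
  \<comment> \<open>The order of choices matters: \<open>M\<close> is fixed first, so that the
    excess costs at most \<open>e / 4\<close> per step of the run, and then \<open>L\<close> so
    large that the bounded remainder \<open>C\<close> is at most \<open>e / 4 * L\<close>.\<close>
  have "(\<lambda>M. b * (16 * excess M)) \<longlonglongrightarrow> b * (16 * 0)" by (intro tendsto_intros excess_tendsto_0)
  then have "\<forall>\<^sub>F M in sequentially. b * (16 * excess M) < e / 4"
    using \<open>0 < e\<close> by (intro order_tendstoD(2)) auto
  then obtain M where M: "b * (16 * excess M) < e / 4" by (auto simp: eventually_sequentially)
  define C where "C = renewal_const + B + (b * real M + 2 / right_mass * N)"
  have N0: "0 \<le> N" using N[of 0] mean_tau_nonneg[of 0] by (simp add: mean_tau_def)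
  obtain L1 :: nat where L1: "4 * C / e \<le> real L1" using real_arch_simple by blast
  define L where "L = max 1 (max L0 L1)"
  have "4 * C / e \<le> real L" using L1 by (simp add: L_def)
  then have CL: "C \<le> e / 4 * real L" using \<open>0 < e\<close> by (simp add: field_simps)
  have Lpos: "0 < L" and LL0: "L0 \<le> L" by (auto simp: L_def)
  show thesis
  proof (rule that[OF Lpos])
    fix n s assume "s + L \<le> n"
    let ?\<rho> = "(pf ^^ s) (\<lambda>_. 1)"
    let ?O = "\<lambda>x. \<Sum>j<L. \<phi> ((imap \<beta> ^^ j) x)"
    let ?A = "\<lambda>x. birk \<phi> (n - s - L) ((imap \<beta> ^^ L) x)"
    have mean: "b * (2 / right_mass * mean_tau m) \<le> 2 / right_mass * N" for m
    proof -
      have "b * (2 / right_mass * mean_tau m) = 2 / right_mass * (b * mean_tau m)" by simp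
      also have "\<dots> \<le> 2 / right_mass * N"
        unfolding b_def using N right_mass_pos by (intro mult_left_mono) auto
      finally show ?thesis .
    qed
    have \<rho>4: "dcone 4 {0<..1} ?\<rho>" by (rule dcone_weaken[OF pf_pow_one(2)]) auto
    note \<rho>D = dconeD[OF \<rho>4]
    have bO: "bdd_meas ?O"
      using s.bdd_meas_birk[OF bdd_phi, of L] by (simp add: s.birk_def[abs_def] singleton_koop_pow[OF \<beta>])
    have bA: "bdd_meas ?A"
      using s.bdd_meas_koop_pow[OF bdd_meas_birk[OF bdd_phi], of L "n - s - L"]
      unfolding singleton_koop_pow[OF \<beta>, abs_def] .
    have bB: "bdd_meas (birk \<phi> (n - s))" by (rule bdd_meas_birk[OF bdd_phi])
    \<comment> \<open>The sum after the run, started from the density that the run leaves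
      behind.\<close>
    have r2: "\<bar>\<integral>x. ?\<rho> x * ?A x \<partial>m01\<bar> \<le> e / 2 * real L"
    proof -
      let ?g = "(s.pf ^^ L) ?\<rho>"
      have g: "dcone 4 {0<..1} ?g" by (rule dcone_weaken[OF s.dcone_pf_pow[OF pf_pow_one(2)]]) auto
      have "(\<integral>x. ?\<rho> x * ?A x \<partial>m01) = (\<integral>x. ?g x * birk \<phi> (n - s - L) x \<partial>m01)"
        using s.pf_pow_dual[OF \<rho>D(1) bdd_meas_birk[OF bdd_phi], of L "n - s - L"]
        by (simp add: singleton_koop_pow[OF \<beta>])
      moreover have "\<bar>\<integral>x. ?g x * birk \<phi> (n - s - L) x \<partial>m01\<bar>
          \<le> (renewal_const + B) * (\<integral>x. ?g x \<partial>m01) + b * (\<integral>x. ?g x * tau (n - s - L) x \<partial>m01)"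
        unfolding b_def by (rule birk_bound[OF B g])
      moreover have "(\<integral>x. ?g x \<partial>m01) = 1"
        using s.pf_pow_dual[OF \<rho>D(1) bdd_meas_const[of 1], of L] pf_pow_one(4)[of s]
        by (simp add: s.koop_pow_linear)
      moreover have "b * (\<integral>x. ?g x * tau (n - s - L) x \<partial>m01) \<le> b * real M + 2 / right_mass * N + e / 4 * real L"
      proof -
        have "b * (\<integral>x. ?g x * tau (n - s - L) x \<partial>m01)
            \<le> b * (real M + 2 / right_mass * mean_tau (n - s - L) + 16 * excess M * real L)"
          by (intro mult_left_mono run_tau_bound[OF \<beta>] b)
        also have "\<dots> = b * real M + b * (2 / right_mass * mean_tau (n - s - L)) + b * (16 * excess M) * real L"
          by (simp add: algebra_simps)
        also have "\<dots> \<le> b * real M + 2 / right_mass * N + e / 4 * real L"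
          using mean M by (intro add_mono mult_right_mono) auto
        finally show ?thesis .
      qed
      ultimately have "\<bar>\<integral>x. ?\<rho> x * ?A x \<partial>m01\<bar> \<le> C + e / 4 * real L" unfolding C_def by simp
      then show ?thesis using CL by simp
    qed
    \<comment> \<open>The unconditioned sum from time \<open>s\<close> on, which has no term linear
      in \<open>L\<close>.\<close>
    have r3: "\<bar>\<integral>x. ?\<rho> x * birk \<phi> (n - s) x \<partial>m01\<bar> \<le> e / 4 * real L"
    proof -
      have "b * (\<integral>x. ?\<rho> x * tau (n - s) x \<partial>m01) \<le> b * (2 / right_mass * mean_tau (n - s))"
        unfolding mean_tau_def by (intro mult_left_mono b pf_pow_one_le_mu bdd_meas_tau tau_nonneg)
      also have "\<dots> \<le> 2 / right_mass * N" by (rule mean)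
      finally have "\<bar>\<integral>x. ?\<rho> x * birk \<phi> (n - s) x \<partial>m01\<bar> \<le> renewal_const + B + 2 / right_mass * N"
        using birk_bound[OF B \<rho>4, of "n - s"] by (simp add: pf_pow_one(4) flip: b_def)
      also have "\<dots> \<le> C" using b by (simp add: C_def)
      finally show ?thesis using CL by simp
    qed
    let ?F = "\<lambda>x. p \<beta> ^ L * (?O x + ?A x - birk \<phi> (n - s) x)"
    have bF: "bdd_meas ?F" using bO bA bB by (intro bdd_meas_cmult bdd_meas_diff bdd_meas_add)
    have i: "integrable m01 (\<lambda>x. ?\<rho> x * ?O x)" "integrable m01 (\<lambda>x. ?\<rho> x * ?A x)"
      "integrable m01 (\<lambda>x. ?\<rho> x * birk \<phi> (n - s) x)"
      using \<rho>D(1) bO bA bB by (auto intro!: bdd_meas_integrable_m01 bdd_meas_mult[OF \<rho>D(1)])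
    have "(\<integral>x. (koop ^^ s) ?F x \<partial>m01) = (\<integral>x. ?\<rho> x * ?F x \<partial>m01)"
      by (rule pf_pow_one(3)[OF bF, symmetric])
    also have "\<dots> = (\<integral>x. p \<beta> ^ L * (?\<rho> x * ?O x + ?\<rho> x * ?A x - ?\<rho> x * birk \<phi> (n - s) x) \<partial>m01)"
      by (intro Bochner_Integration.integral_cong refl) (simp only: algebra_simps)
    also have "\<dots> = p \<beta> ^ L * ((\<integral>x. ?\<rho> x * ?O x \<partial>m01) + (\<integral>x. ?\<rho> x * ?A x \<partial>m01)
        - (\<integral>x. ?\<rho> x * birk \<phi> (n - s) x \<partial>m01))"
      using i by simp
    finally have eq: "(\<integral>x. (koop ^^ s) ?F x \<partial>m01) - p \<beta> ^ L * (real L * (\<integral>x. \<phi> x \<partial>\<mu>'))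
      = p \<beta> ^ L * (((\<integral>x. ?\<rho> x * ?O x \<partial>m01) - real L * (\<integral>x. \<phi> x \<partial>\<mu>')) + (\<integral>x. ?\<rho> x * ?A x \<partial>m01)
        - (\<integral>x. ?\<rho> x * birk \<phi> (n - s) x \<partial>m01))"
      by (simp only: algebra_simps)
    \<comment> \<open>The three errors are \<open>e / 4\<close>, \<open>e / 2\<close> and
      \<open>e / 4\<close> times \<open>L\<close>.\<close>
    have "\<bar>((\<integral>x. ?\<rho> x * ?O x \<partial>m01) - real L * (\<integral>x. \<phi> x \<partial>\<mu>')) + (\<integral>x. ?\<rho> x * ?A x \<partial>m01)
        - (\<integral>x. ?\<rho> x * birk \<phi> (n - s) x \<partial>m01)\<bar> \<le> e * real L"
      using L0[OF LL0, of s] r2 r3 by linarith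
    then show "\<bar>(\<integral>x. (koop ^^ s) ?F x \<partial>m01) - p \<beta> ^ L * (real L * (\<integral>x. \<phi> x \<partial>\<mu>'))\<bar> \<le> p \<beta> ^ L * (e * real L)"
      unfolding eq abs_mult using p_power_01[OF \<beta>, of L] by (simp add: mult_left_mono)
  qed
qed

text \<open>Since \<open>birk \<phi> (Suc r)\<close> contains the term of time 0, doubling the
  correlation counts the diagonal twice; the subtracted square corrects this.\<close>

lemma integral_second_moment:
  "(\<integral>x. second_moment \<phi> n x \<partial>\<mu>) = (\<Sum>r<n. 2 * (\<integral>x. \<phi> x * birk \<phi> (Suc r) x \<partial>\<mu>) - (\<integral>x. \<phi> x * \<phi> x \<partial>\<mu>))"
proof (induction n)
  case (Suc n)
  have i: "integrable \<mu> (\<lambda>x. \<phi> x * birk \<phi> (Suc n) x)" "integrable \<mu> (\<lambda>x. \<phi> x * \<phi> x)"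
    "integrable \<mu> (koop (second_moment \<phi> n))"
    using bdd_phi by (auto intro!: integrable_mu bdd_meas_mult bdd_meas_birk bdd_meas_koop bdd_meas_second_moment)
  have "second_moment \<phi> (Suc n) x = 2 * (\<phi> x * birk \<phi> (Suc n) x) - \<phi> x * \<phi> x + koop (second_moment \<phi> n) x" for x
    unfolding second_moment_Suc[OF bdd_phi] birk_Suc by (simp add: power2_eq_square algebra_simps)
  then have "(\<integral>x. second_moment \<phi> (Suc n) x \<partial>\<mu>)
     = (\<integral>x. 2 * (\<phi> x * birk \<phi> (Suc n) x) - \<phi> x * \<phi> x + koop (second_moment \<phi> n) x \<partial>\<mu>)" by simp
  also have "\<dots> = 2 * (\<integral>x. \<phi> x * birk \<phi> (Suc n) x \<partial>\<mu>) - (\<integral>x. \<phi> x * \<phi> x \<partial>\<mu>) + (\<integral>x. koop (second_moment \<phi> n) x \<partial>\<mu>)"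
    using i by simp
  also have "(\<integral>x. koop (second_moment \<phi> n) x \<partial>\<mu>) = (\<integral>x. second_moment \<phi> n x \<partial>\<mu>)"
    by (rule stationary[OF bdd_meas_second_moment[OF bdd_phi]])
  finally show ?case using Suc by simp
qed (simp add: second_moment_def)

lemma variance_bound:
  assumes "\<And>n. (\<integral>x. second_moment \<phi> n x \<partial>\<mu>) \<le> V * real n"
  shows "(\<Sum>r<n. \<integral>x. \<phi> x * birk \<phi> (Suc r) x \<partial>\<mu>) \<le> (V + \<Phi>\<^sup>2) * real n"
proof -
  have "(\<integral>x. \<phi> x * \<phi> x \<partial>\<mu>) \<le> (\<integral>x. \<Phi>\<^sup>2 \<partial>\<mu>)"
  proof (rule integral_mu_mono)
    fix x
    have "\<bar>\<phi> x\<bar> * \<bar>\<phi> x\<bar> \<le> \<Phi> * \<Phi>" using phi_le[of x] by (intro mult_mono) auto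
    then show "\<phi> x * \<phi> x \<le> \<Phi>\<^sup>2" by (simp add: power2_eq_square)
  qed (use bdd_phi in \<open>auto intro!: bdd_meas_mult\<close>)
  then have "real n * (\<integral>x. \<phi> x * \<phi> x \<partial>\<mu>) \<le> real n * \<Phi>\<^sup>2" using mu.prob_space by (intro mult_left_mono) auto
  moreover have "0 \<le> (\<integral>x. second_moment \<phi> n x \<partial>\<mu>)"
    unfolding second_moment_def by (intro integral_nonneg_AE AE_I2) simp
  moreover have "(\<integral>x. second_moment \<phi> n x \<partial>\<mu>)
     = 2 * (\<Sum>r<n. \<integral>x. \<phi> x * birk \<phi> (Suc r) x \<partial>\<mu>) - real n * (\<integral>x. \<phi> x * \<phi> x \<partial>\<mu>)"
    unfolding integral_second_moment by (simp add: sum_subtractf sum_distrib_left)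
  moreover have "0 \<le> real n * \<Phi>\<^sup>2" by simp
  ultimately have "(\<Sum>r<n. \<integral>x. \<phi> x * birk \<phi> (Suc r) x \<partial>\<mu>) \<le> V * real n + real n * \<Phi>\<^sup>2"
    using assms[of n] by linarith
  then show ?thesis by (simp add: algebra_simps)
qed

end

section \<open>Truncated means and the contradiction\<close>

text \<open>Bounded, continuous and odd: its mean passes to a weak limit and vanishes for a centred
  Gaussian law.\<close>

definition clip :: "real \<Rightarrow> real \<Rightarrow> real" where
  "clip R t = max (- R) (min R t)"

lemma clip_abs_le: "0 \<le> R \<Longrightarrow> \<bar>clip R t\<bar> \<le> R"
  by (auto simp: clip_def)

lemma clip_minus: "clip R (- t) = - clip R t" if "0 \<le> R"
  using that by (auto simp: clip_def max_def min_def)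

lemma isCont_clip: "isCont (clip R) t"
  unfolding clip_def by (intro continuous_intros)

lemma measurable_clip [measurable]: "clip R \<in> borel_measurable borel"
  unfolding clip_def by measurable

text \<open>An error occurs only for \<open>\<bar>t\<bar> > R\<close>, where
  \<open>\<bar>t\<bar> \<le> t\<^sup>2 / R\<close>.\<close>

lemma clip_error: "0 < R \<Longrightarrow> \<bar>t - clip R t\<bar> \<le> t\<^sup>2 / R"
proof -
  assume R: "0 < R"
  show ?thesis
  proof (cases "\<bar>t\<bar> \<le> R")
    case True
    then have "clip R t = t" by (auto simp: clip_def)
    then show ?thesis using R by simp
  next
    case False
    then have "\<bar>t - clip R t\<bar> \<le> \<bar>t\<bar>" using R by (auto simp: clip_def)
    also have "\<bar>t\<bar> * R \<le> \<bar>t\<bar> * \<bar>t\<bar>" using False by (intro mult_left_mono) auto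
    then have "\<bar>t\<bar> \<le> t\<^sup>2 / R" using R by (simp add: field_simps power2_eq_square)
    finally show ?thesis .
  qed
qed

lemma real_distribution_normal_law:
  assumes "0 \<le> v"
  shows "real_distribution (normal_law v)"
proof (cases "v = 0")
  case True
  have "prob_space (return borel (0::real))" by (rule prob_space_return) simp
  then show ?thesis
    using True by (simp add: normal_law_def real_distribution_def real_distribution_axioms_def)
next
  case False
  then have "prob_space (density lborel (normal_density 0 (sqrt v)))"
    using assms by (intro prob_space_normal_density) simp
  then show ?thesis
    using False by (simp add: normal_law_def real_distribution_def real_distribution_axioms_def)
qed

lemma integral_clip_normal_law:
  assumes "0 \<le> R"
  shows "(\<integral>t. clip R t \<partial>normal_law v) = 0"
proof (cases "v = 0")
  case True
  have "clip R 0 = 0" using assms by (simp add: clip_def)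
  then show ?thesis using True by (simp add: normal_law_def integral_return)
next
  case False
  let ?d = "normal_density 0 (sqrt v)"
  have "(\<integral>t. clip R t \<partial>normal_law v) = (\<integral>t. ?d t * clip R t \<partial>lborel)"
    using False by (simp add: normal_law_def integral_density)
  moreover have "(\<integral>t. ?d t * clip R t \<partial>lborel) = - (\<integral>t. ?d t * clip R t \<partial>lborel)"
  proof -
    have "(\<integral>t. ?d t * clip R t \<partial>lborel) = (\<integral>t. ?d (0 + (- 1) * t) * clip R (0 + (- 1) * t) \<partial>lborel)"
      using lborel_integral_real_affine[of "- 1" "\<lambda>t. ?d t * clip R t" 0] by simp
    also have "\<dots> = (\<integral>t. - (?d t * clip R t) \<partial>lborel)"
      using clip_minus[OF assms] by (intro Bochner_Integration.integral_cong) (auto simp: normal_density_def)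
    finally show ?thesis by simp
  qed
  ultimately show ?thesis by simp
qed

context intermittent_system
begin

lemma rcomp_unit:
  assumes "\<omega> \<in> space nu" "0 \<le> x" "x \<le> 1"
  shows "0 \<le> rcomp \<omega> k x \<and> rcomp \<omega> k x \<le> 1"
proof (induction k)
  case (Suc k)
  then show ?case using space_nu[OF assms(1), of k] Omega_bounds imap_unit by simp
qed (use assms in simp)

definition nsum :: "(real \<Rightarrow> real) \<Rightarrow> (nat \<Rightarrow> real) \<Rightarrow> nat \<Rightarrow> real \<Rightarrow> real" where
  "nsum \<phi> \<omega> n x = 1 / sqrt (real n) * (\<Sum>j=1..n. \<phi> (rcomp \<omega> j x))"

text \<open>The limit theorem sums over the times 1 to \<open>n\<close>, \<open>bsum\<close> over 0
  to \<open>n - 1\<close>; the bounded boundary terms disappear under the normalization.\<close>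

lemma nsum_eq: "nsum \<phi> \<omega> n x = (bsum \<phi> \<omega> n x + (\<phi> (rcomp \<omega> n x) - \<phi> x)) / sqrt (real n)"
proof -
  have "(\<Sum>j=1..n. \<phi> (rcomp \<omega> j x)) = (\<Sum>j\<in>{0..<n}. \<phi> (rcomp \<omega> (Suc j) x))"
    by (simp only: sum.atLeast_Suc_atMost_Suc_shift sum.shift_bounds_Suc_ivl One_nat_def
        atLeastLessThanSuc_atLeastAtMost[symmetric] o_def)
  also have "\<dots> = bsum \<phi> \<omega> (Suc n) x - \<phi> x"
  proof -
    have "bsum \<phi> \<omega> (Suc n) x = \<phi> x + (\<Sum>j<n. \<phi> (rcomp \<omega> (Suc j) x))"
      unfolding bsum_def sum.lessThan_Suc_shift by simp
    then show ?thesis by (simp only: lessThan_atLeast0 add_diff_cancel_left')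
  qed
  finally show ?thesis by (simp add: nsum_def bsum_def)
qed

lemma measurable_nsum:
  assumes "bdd_meas \<phi>" "sets M = sets m01"
  shows "(\<lambda>z. nsum \<phi> (fst z) n (snd z)) \<in> borel_measurable (nu \<Otimes>\<^sub>M M)"
  unfolding nsum_def
  by (intro borel_measurable_times borel_measurable_const borel_measurable_sum
      measurable_compose[OF measurable_rcomp[OF assms(2)] bdd_meas_measurable[OF assms(1)]])

text \<open>Orbits stay in the unit interval, so the given observable \<open>\<phi>'\<close> may be
  exchanged for its bounded extension \<phi>.\<close>

lemma quenched_clt_clip:
  assumes \<phi>: "bdd_meas \<phi>" and eq: "\<And>x. 0 \<le> x \<Longrightarrow> x \<le> 1 \<Longrightarrow> \<phi>' x = \<phi> x"
    and \<omega>: "\<omega> \<in> space nu" and clt: "quenched_clt \<phi>' \<omega> v" and "0 \<le> v" "0 \<le> R"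
  shows "(\<lambda>n. \<integral>x. clip R (nsum \<phi> \<omega> n x) \<partial>m01) \<longlonglongrightarrow> 0"
proof -
  have m: "nsum \<phi> \<omega> n \<in> borel_measurable m01" for n
    using measurable_compose[OF measurable_Pair1'[OF \<omega>] measurable_nsum[OF \<phi> refl]] by simp
  have d: "distr m01 borel (\<lambda>x. 1 / sqrt (real n) * (\<Sum>j=1..n. \<phi>' (rcomp \<omega> j x))) = distr m01 borel (nsum \<phi> \<omega> n)" for n
    using rcomp_unit[OF \<omega>] eq by (intro distr_cong refl) (simp add: nsum_def)
  have c: "weak_conv_m (\<lambda>n. distr m01 borel (nsum \<phi> \<omega> n)) (normal_law v)"
    using clt unfolding quenched_clt_def d .
  have "(\<lambda>n. \<integral>t. clip R t \<partial>distr m01 borel (nsum \<phi> \<omega> n)) \<longlonglongrightarrow> (\<integral>t. clip R t \<partial>normal_law v)"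
    using clip_abs_le[OF \<open>0 \<le> R\<close>] m
    by (intro weak_conv_imp_integral_bdd_continuous_conv[OF _ _ c, where B = R] isCont_clip
        real_distribution_normal_law[OF \<open>0 \<le> v\<close>] m01.real_distribution_distr) auto
  then show ?thesis
    using m by (simp add: integral_distr integral_clip_normal_law[OF \<open>0 \<le> R\<close>])
qed

end

context observable_system
begin

definition mean_sum :: "nat \<Rightarrow> (nat \<Rightarrow> real) \<Rightarrow> real" where
  "mean_sum n \<omega> = (\<integral>x. bsum \<phi> \<omega> n x \<partial>m01)"

lemma bsum_swap:
  "bdd_nu (mean_sum n)"
  "bdd_nu (\<lambda>\<omega>. \<integral>x. (bsum \<phi> \<omega> n x)\<^sup>2 \<partial>m01)"
  "(\<integral>\<omega>. (\<integral>x. (bsum \<phi> \<omega> n x)\<^sup>2 \<partial>m01) \<partial>nu) = (\<integral>x. second_moment \<phi> n x \<partial>m01)"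
proof -
  have b: "\<bar>bsum \<phi> \<omega> n x\<bar> \<le> real n * \<Phi>" for \<omega> x by (rule bsum_abs_le[OF phi_le])
  have b2: "\<bar>(bsum \<phi> \<omega> n x)\<^sup>2\<bar> \<le> (real n * \<Phi>)\<^sup>2" for \<omega> x
    using power_mono[OF b[of \<omega> x] abs_ge_zero, of 2] by simp
  note m = measurable_bsum[OF bdd_phi refl, of n]
  have m2: "(\<lambda>z. (bsum \<phi> (fst z) n (snd z))\<^sup>2) \<in> borel_measurable (nu \<Otimes>\<^sub>M m01)"
    using m by (rule borel_measurable_power)
  show "bdd_nu (mean_sum n)"
    unfolding mean_sum_def[abs_def] by (rule integral_nu_swap(2)[OF prob_space_m01 refl m b])
  show "bdd_nu (\<lambda>\<omega>. \<integral>x. (bsum \<phi> \<omega> n x)\<^sup>2 \<partial>m01)"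
    by (rule integral_nu_swap(2)[OF prob_space_m01 refl m2 b2])
  show "(\<integral>\<omega>. (\<integral>x. (bsum \<phi> \<omega> n x)\<^sup>2 \<partial>m01) \<partial>nu) = (\<integral>x. second_moment \<phi> n x \<partial>m01)"
    unfolding second_moment_def by (rule integral_nu_swap(1)[OF prob_space_m01 refl m2 b2])
qed

text \<open>The variance is taken with respect to \<mu>, the limit theorem with respect to Lebesgue
  measure; \<open>lebesgue_le_mu\<close> bridges the two.\<close>

lemma second_moment_lebesgue:
  assumes "\<And>n. (\<integral>x. second_moment \<phi> n x \<partial>\<mu>) \<le> V * real n"
  shows "(\<integral>x. second_moment \<phi> n x \<partial>m01) \<le> 2 / right_mass * V * real n"
proof -
  have "(\<integral>x. second_moment \<phi> n x \<partial>m01) \<le> 2 / right_mass * (\<integral>x. second_moment \<phi> n x \<partial>\<mu>)"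
    using bdd_phi by (intro lebesgue_le_mu bdd_meas_second_moment) (simp_all add: second_moment_def)
  also have "\<dots> \<le> 2 / right_mass * (V * real n)"
    using assms right_mass_pos by (intro mult_left_mono) auto
  finally show ?thesis by simp
qed

lemma integrable_bsum_m01:
  assumes "\<omega> \<in> space nu"
  shows "integrable m01 (bsum \<phi> \<omega> n)" "integrable m01 (\<lambda>x. (bsum \<phi> \<omega> n x)\<^sup>2)"
proof -
  have m: "bsum \<phi> \<omega> n \<in> borel_measurable m01"
    using measurable_compose[OF measurable_Pair1'[OF assms] measurable_bsum[OF bdd_phi refl]] by simp
  have b: "\<bar>bsum \<phi> \<omega> n x\<bar> \<le> real n * \<Phi>" for x by (rule bsum_abs_le[OF phi_le])
  have b2: "\<bar>(bsum \<phi> \<omega> n x)\<^sup>2\<bar> \<le> (real n * \<Phi>)\<^sup>2" for x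
    using power_mono[OF b[of x] abs_ge_zero, of 2] by simp
  show "integrable m01 (bsum \<phi> \<omega> n)" using b m by (intro m01.integrable_const_bound[of _ "real n * \<Phi>"]) auto
  show "integrable m01 (\<lambda>x. (bsum \<phi> \<omega> n x)\<^sup>2)"
    using b2 m by (intro m01.integrable_const_bound[of _ "(real n * \<Phi>)\<^sup>2"]) auto
qed

lemma mean_sum_sq_le:
  assumes "\<omega> \<in> space nu"
  shows "(mean_sum n \<omega>)\<^sup>2 \<le> (\<integral>x. (bsum \<phi> \<omega> n x)\<^sup>2 \<partial>m01)"
proof -
  have "0 \<le> (\<integral>x. (bsum \<phi> \<omega> n x - mean_sum n \<omega>)\<^sup>2 \<partial>m01)" by simp
  also have "\<dots> = (\<integral>x. (bsum \<phi> \<omega> n x)\<^sup>2 \<partial>m01) - (mean_sum n \<omega>)\<^sup>2"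
    unfolding mean_sum_def by (rule m01.variance_eq[OF integrable_bsum_m01[OF assms]])
  finally show ?thesis by simp
qed

text \<open>Truncation turns convergence in distribution to a symmetric law into convergence of means;
  the truncation error is controlled by the second moment.\<close>

lemma mean_sum_L1:
  assumes V: "\<And>n. (\<integral>x. second_moment \<phi> n x \<partial>\<mu>) \<le> V * real n"
    and clt: "AE \<omega> in nu. \<forall>R\<ge>0. (\<lambda>n. \<integral>x. clip R (nsum \<phi> \<omega> n x) \<partial>m01) \<longlonglongrightarrow> 0"
  shows "(\<lambda>n. (\<integral>\<omega>. \<bar>mean_sum n \<omega>\<bar> \<partial>nu) / sqrt (real n)) \<longlonglongrightarrow> 0"
proof -
  \<comment> \<open>Twice the bound for the second moment under Lebesgue measure, plus
    \<open>2 * (2 * \<Phi>)\<^sup>2\<close> for the boundary terms, from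
    \<open>(s + d)\<^sup>2 \<le> 2 * s\<^sup>2 + 2 * d\<^sup>2\<close>.\<close>
  define C where "C = 2 * (2 / right_mass * V) + 8 * \<Phi>\<^sup>2"
  let ?T = "\<lambda>R n \<omega>. \<integral>x. clip R (nsum \<phi> \<omega> n x) \<partial>m01"
  have bT: "bdd_nu (?T R n)" if "0 \<le> R" for R n
    by (rule integral_nu_swap(2)[OF prob_space_m01 refl
          measurable_compose[OF measurable_nsum[OF bdd_phi refl] measurable_clip] clip_abs_le[OF that]])
  have T0: "(\<lambda>n. \<integral>\<omega>. \<bar>?T R n \<omega>\<bar> \<partial>nu) \<longlonglongrightarrow> 0" if R: "0 \<le> R" for R
  proof -
    have "(\<lambda>n. \<integral>\<omega>. \<bar>?T R n \<omega>\<bar> \<partial>nu) \<longlonglongrightarrow> (\<integral>\<omega>. 0 \<partial>nu)"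
    proof (rule integral_dominated_convergence[where w = "\<lambda>_. R"])
      show "AE \<omega> in nu. (\<lambda>n. \<bar>?T R n \<omega>\<bar>) \<longlonglongrightarrow> 0"
        using clt R by (auto elim!: eventually_mono intro!: tendsto_rabs_zero)
      show "AE \<omega> in nu. norm \<bar>?T R n \<omega>\<bar> \<le> R" for n
      proof (rule AE_I2)
        fix \<omega> assume \<omega>: "\<omega> \<in> space nu"
        have "nsum \<phi> \<omega> n \<in> borel_measurable m01"
          using measurable_compose[OF measurable_Pair1'[OF \<omega>] measurable_nsum[OF bdd_phi refl]] by simp
        then have "integrable m01 (\<lambda>x. clip R (nsum \<phi> \<omega> n x))"
          using clip_abs_le[OF R] by (intro m01.integrable_const_bound[of _ R]) auto
        then have "(\<integral>x. \<bar>clip R (nsum \<phi> \<omega> n x)\<bar> \<partial>m01) \<le> (\<integral>x. R \<partial>m01)"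
          using clip_abs_le[OF R] by (intro integral_mono) auto
        then have "(\<integral>x. \<bar>clip R (nsum \<phi> \<omega> n x)\<bar> \<partial>m01) \<le> R"
          using m01.prob_space[unfolded space_m01] by simp
        then show "norm \<bar>?T R n \<omega>\<bar> \<le> R"
          using order_trans[OF integral_abs_bound] by simp
      qed
    qed (use bdd_nuD[OF bT[OF R]] in auto)
    then show ?thesis by simp
  qed
  have bound: "(\<integral>\<omega>. \<bar>mean_sum n \<omega>\<bar> \<partial>nu) / sqrt (real n)
      \<le> (\<integral>\<omega>. \<bar>?T R n \<omega>\<bar> \<partial>nu) + C / R + 2 * \<Phi> / sqrt (real n)" if "0 < R" "0 < n" for R n
  proof -
    let ?q = "sqrt (real n)"
    have q: "0 < ?q" "?q * ?q = real n" using \<open>0 < n\<close> by auto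
    let ?S = "\<lambda>\<omega>. \<integral>x. (bsum \<phi> \<omega> n x)\<^sup>2 \<partial>m01"
    have pt: "\<bar>mean_sum n \<omega>\<bar> / ?q \<le> \<bar>?T R n \<omega>\<bar> + (2 / (real n * R) * ?S \<omega> + 8 * \<Phi>\<^sup>2 / R) + 2 * \<Phi> / ?q"
      if \<omega>: "\<omega> \<in> space nu" for \<omega>
    proof -
      note i = integrable_bsum_m01[OF \<omega>, of n]
      have m: "nsum \<phi> \<omega> n \<in> borel_measurable m01"
        using measurable_compose[OF measurable_Pair1'[OF \<omega>] measurable_nsum[OF bdd_phi refl]] by simp
      have ic: "integrable m01 (\<lambda>x. clip R (nsum \<phi> \<omega> n x))"
        using clip_abs_le[of R] \<open>0 < R\<close> m by (intro m01.integrable_const_bound[of _ R]) auto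
      have "\<bar>mean_sum n \<omega> / ?q - ?T R n \<omega>\<bar> = \<bar>\<integral>x. bsum \<phi> \<omega> n x / ?q - clip R (nsum \<phi> \<omega> n x) \<partial>m01\<bar>"
        using i ic by (simp add: mean_sum_def)
      also have "\<dots> \<le> (\<integral>x. 2 / (real n * R) * (bsum \<phi> \<omega> n x)\<^sup>2 + (8 * \<Phi>\<^sup>2 / R + 2 * \<Phi> / ?q) \<partial>m01)"
      proof (rule order_trans[OF integral_abs_bound], rule integral_mono)
        fix x
        define s where "s = bsum \<phi> \<omega> n x"
        define d where "d = \<phi> (rcomp \<omega> n x) - \<phi> x"
        have d: "\<bar>d\<bar> \<le> 2 * \<Phi>" using phi_le[of "rcomp \<omega> n x"] phi_le[of x] unfolding d_def by linarith
        have ns: "nsum \<phi> \<omega> n x = (s + d) / ?q" unfolding nsum_eq s_def d_def by simp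
        have "\<bar>s / ?q - clip R ((s + d) / ?q)\<bar> \<le> \<bar>(s + d) / ?q - clip R ((s + d) / ?q)\<bar> + \<bar>d / ?q\<bar>"
        proof -
          have "s / ?q - clip R ((s + d) / ?q) = ((s + d) / ?q - clip R ((s + d) / ?q)) - d / ?q"
            by (simp add: add_divide_distrib)
          then show ?thesis by (simp only: abs_triangle_ineq4)
        qed
        also have "\<bar>d / ?q\<bar> \<le> 2 * \<Phi> / ?q" using d q by (simp add: divide_right_mono)
        also have "\<bar>(s + d) / ?q - clip R ((s + d) / ?q)\<bar> \<le> ((s + d) / ?q)\<^sup>2 / R" by (rule clip_error[OF \<open>0 < R\<close>])
        also have "((s + d) / ?q)\<^sup>2 / R = (s + d)\<^sup>2 / (real n * R)" using q by (simp add: power_divide)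
        also have "(s + d)\<^sup>2 / (real n * R) \<le> (2 * s\<^sup>2 + 8 * \<Phi>\<^sup>2) / (real n * R)"
        proof (rule divide_right_mono)
          have "0 \<le> (s - d)\<^sup>2" by simp
          then have "(s + d)\<^sup>2 \<le> 2 * s\<^sup>2 + 2 * d\<^sup>2" by (simp add: power2_sum power2_diff)
          moreover have "d\<^sup>2 \<le> (2 * \<Phi>)\<^sup>2" using power_mono[OF d abs_ge_zero, of 2] by simp
          ultimately show "(s + d)\<^sup>2 \<le> 2 * s\<^sup>2 + 8 * \<Phi>\<^sup>2" by (simp add: power_mult_distrib)
        qed (use \<open>0 < R\<close> in simp)
        also have "\<dots> \<le> 2 / (real n * R) * s\<^sup>2 + 8 * \<Phi>\<^sup>2 / R"
        proof -
          have "8 * \<Phi>\<^sup>2 / (real n * R) \<le> 8 * \<Phi>\<^sup>2 / R"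
            using \<open>0 < R\<close> \<open>0 < n\<close> by (intro divide_left_mono) auto
          then show ?thesis by (simp add: add_divide_distrib)
        qed
        finally show "\<bar>bsum \<phi> \<omega> n x / ?q - clip R (nsum \<phi> \<omega> n x)\<bar>
            \<le> 2 / (real n * R) * (bsum \<phi> \<omega> n x)\<^sup>2 + (8 * \<Phi>\<^sup>2 / R + 2 * \<Phi> / ?q)"
          unfolding ns s_def by simp
      qed (use i ic in auto)
      also have "\<dots> = 2 / (real n * R) * ?S \<omega> + (8 * \<Phi>\<^sup>2 / R + 2 * \<Phi> / ?q)"
        using i m01.prob_space[unfolded space_m01] by simp
      finally have "\<bar>mean_sum n \<omega> / ?q - ?T R n \<omega>\<bar> \<le> 2 / (real n * R) * ?S \<omega> + (8 * \<Phi>\<^sup>2 / R + 2 * \<Phi> / ?q)" .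
      moreover have "\<bar>mean_sum n \<omega>\<bar> / ?q = \<bar>mean_sum n \<omega> / ?q\<bar>" using q by simp
      ultimately show ?thesis by linarith
    qed
    have iN: "integrable nu (\<lambda>\<omega>. \<bar>mean_sum n \<omega>\<bar> / ?q)" "integrable nu (\<lambda>\<omega>. \<bar>?T R n \<omega>\<bar>)" "integrable nu ?S"
      using bdd_nu_integrable[OF bsum_swap(1)] bdd_nu_integrable[OF bT] bdd_nu_integrable[OF bsum_swap(2)] \<open>0 < R\<close>
      by auto
    have "(\<integral>\<omega>. \<bar>mean_sum n \<omega>\<bar> / ?q \<partial>nu)
      \<le> (\<integral>\<omega>. \<bar>?T R n \<omega>\<bar> + (2 / (real n * R) * ?S \<omega> + 8 * \<Phi>\<^sup>2 / R) + 2 * \<Phi> / ?q \<partial>nu)"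
      using iN by (intro integral_mono pt) auto
    also have "\<dots> = (\<integral>\<omega>. \<bar>?T R n \<omega>\<bar> \<partial>nu) + (2 / (real n * R) * (\<integral>x. second_moment \<phi> n x \<partial>m01) + 8 * \<Phi>\<^sup>2 / R) + 2 * \<Phi> / ?q"
      using iN nu.prob_space by (simp add: bsum_swap(3))
    also have "2 / (real n * R) * (\<integral>x. second_moment \<phi> n x \<partial>m01) + 8 * \<Phi>\<^sup>2 / R \<le> C / R"
    proof -
      have "2 / (real n * R) * (\<integral>x. second_moment \<phi> n x \<partial>m01) \<le> 2 / (real n * R) * (2 / right_mass * V * real n)"
        using \<open>0 < R\<close> by (intro mult_left_mono second_moment_lebesgue[OF V]) auto
      also have "\<dots> = 2 * (2 / right_mass * V) / R" using \<open>0 < n\<close> by simp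
      finally show ?thesis by (simp add: C_def add_divide_distrib)
    qed
    finally show ?thesis by simp
  qed
  have "0 \<le> (\<integral>x. second_moment \<phi> 1 x \<partial>\<mu>)"
    by (intro integral_nonneg_AE AE_I2) (simp add: second_moment_def)
  then have V0: "0 \<le> V" using V[of 1] by simp
  have C0: "0 \<le> C" using V0 right_mass_pos by (simp add: C_def)
  show ?thesis unfolding LIMSEQ_iff
  proof (intro allI impI)
    fix e :: real assume "0 < e"
    define R where "R = 4 * (C + 1) / e"
    have R: "0 < R" "C / R \<le> e / 4" using C0 \<open>0 < e\<close> by (auto simp: R_def field_simps)
    have "(\<lambda>n. (\<integral>\<omega>. \<bar>?T R n \<omega>\<bar> \<partial>nu) + 2 * \<Phi> / sqrt (real n)) \<longlonglongrightarrow> 0 + 0"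
    proof (intro tendsto_add T0)
      have "filterlim (\<lambda>n. sqrt (real n)) at_top sequentially"
        by (intro filterlim_compose[OF sqrt_at_top] filterlim_real_sequentially)
      then show "(\<lambda>n. 2 * \<Phi> / sqrt (real n)) \<longlonglongrightarrow> 0"
        by (intro tendsto_divide_0[OF tendsto_const] filterlim_at_top_imp_at_infinity)
    qed (use R in auto)
    then have "\<forall>\<^sub>F n in sequentially. (\<integral>\<omega>. \<bar>?T R n \<omega>\<bar> \<partial>nu) + 2 * \<Phi> / sqrt (real n) < e / 2"
      using \<open>0 < e\<close> by (intro order_tendstoD(2)) auto
    then obtain N where N: "\<And>n. N \<le> n \<Longrightarrow> (\<integral>\<omega>. \<bar>?T R n \<omega>\<bar> \<partial>nu) + 2 * \<Phi> / sqrt (real n) < e / 2"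
      by (auto simp: eventually_sequentially)
    have "norm ((\<integral>\<omega>. \<bar>mean_sum n \<omega>\<bar> \<partial>nu) / sqrt (real n) - 0) < e" if n: "max 1 N \<le> n" for n
    proof -
      have "0 \<le> (\<integral>\<omega>. \<bar>mean_sum n \<omega>\<bar> \<partial>nu) / sqrt (real n)" by simp
      moreover have "(\<integral>\<omega>. \<bar>mean_sum n \<omega>\<bar> \<partial>nu) / sqrt (real n) < e"
        using bound[OF R(1), of n] N[of n] R(2) n \<open>0 < e\<close> by linarith
      ultimately show ?thesis by simp
    qed
    then show "\<exists>N. \<forall>n\<ge>N. norm ((\<integral>\<omega>. \<bar>mean_sum n \<omega>\<bar> \<partial>nu) / sqrt (real n) - 0) < e" by blast
  qed
qed

end

text \<open>If \<open>\<bar>z\<bar>\<close> exceeds \<open>R\<close>, a factor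
  \<open>\<bar>z\<bar> / R\<close> is inserted to reach
  \<open>\<bar>a\<bar> * z\<^sup>2 / R\<close>, and the arithmetic-geometric mean inequality
  finishes. The first term uses smallness of \<open>a\<close> in the first moment, the second only
  bounded moments and a large \<open>R\<close>.\<close>

lemma truncated_product:
  fixes a z R :: real
  assumes "0 < R"
  shows "\<bar>a\<bar> * \<bar>z\<bar> \<le> R * \<bar>a\<bar> + (a\<^sup>2 + z ^ 4) / (2 * R)"
proof (cases "\<bar>z\<bar> \<le> R")
  case True
  then have "\<bar>a\<bar> * \<bar>z\<bar> \<le> R * \<bar>a\<bar>" using mult_right_mono[of "\<bar>z\<bar>" R "\<bar>a\<bar>"] by (simp add: mult.commute)
  moreover have "0 \<le> (a\<^sup>2 + z ^ 4) / (2 * R)" using assms by simp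
  ultimately show ?thesis by linarith
next
  case False
  have "R * (\<bar>a\<bar> * \<bar>z\<bar>) \<le> \<bar>z\<bar> * (\<bar>a\<bar> * \<bar>z\<bar>)" using False by (intro mult_right_mono) auto
  also have "\<dots> = \<bar>a\<bar> * z\<^sup>2" by (simp add: power2_eq_square)
  also have "\<dots> \<le> (a\<^sup>2 + z ^ 4) / 2"
  proof -
    have "0 \<le> (\<bar>a\<bar> - z\<^sup>2)\<^sup>2" by simp
    then show ?thesis by (simp add: power2_diff power_even_abs flip: power_mult)
  qed
  finally have "\<bar>a\<bar> * \<bar>z\<bar> \<le> (a\<^sup>2 + z ^ 4) / (2 * R)" using assms by (simp add: field_simps)
  moreover have "0 \<le> R * \<bar>a\<bar>" using assms by simp
  ultimately show ?thesis by linarith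
qed

context observable_system
begin

lemma quenched_clt_imp_mean_zero:
  assumes V: "\<And>n. (\<integral>x. second_moment \<phi> n x \<partial>\<mu>) \<le> V * real n"
    and clt: "AE \<omega> in nu. \<forall>R\<ge>0. (\<lambda>n. \<integral>x. clip R (nsum \<phi> \<omega> n x) \<partial>m01) \<longlonglongrightarrow> 0"
    and \<beta>: "\<beta> \<in> \<Omega>" "0 < p \<beta>" and inv: "ac_invariant \<beta> \<mu>'"
  shows "(\<integral>x. \<phi> x \<partial>\<mu>') = 0"
proof (rule ccontr)
  define a where "a = (\<integral>x. \<phi> x \<partial>\<mu>')"
  assume "(\<integral>x. \<phi> x \<partial>\<mu>') \<noteq> 0"
  then have a: "0 < \<bar>a\<bar> / 2" by (simp add: a_def)
  have "0 \<le> (\<integral>x. second_moment \<phi> 1 x \<partial>\<mu>)"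
    by (intro integral_nonneg_AE AE_I2) (simp add: second_moment_def)
  then have V0: "0 \<le> V" using V[of 1] by simp
  \<comment> \<open>The variance bound keeps \<open>\<bar>\<phi> 0\<bar> * mean_tau m\<close>
    bounded and thereby \<open>refK\<close> too, the two inputs of
    \<open>block_effect\<close>.\<close>
  obtain N0 where N0: "\<And>m. \<bar>\<phi> 0\<bar> * mean_tau m \<le> N0"
    using mean_tau_bounded[OF _ variance_bound[OF V]] V0 by auto
  obtain B where B: "\<And>m. \<bar>refK \<phi> m\<bar> \<le> B" using refK_bounded[OF N0] by blast
  define D where "D L n s = (\<integral>x. (koop ^^ s) (\<lambda>x. p \<beta> ^ L * ((\<Sum>j<L. \<phi> ((imap \<beta> ^^ j) x))
        + birk \<phi> (n - s - L) ((imap \<beta> ^^ L) x) - birk \<phi> (n - s) x)) x \<partial>m01)" for L n s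
  \<comment> \<open>A relative error of 1/2 suffices: each block still contributes at least
    \<open>t * (real L * \<bar>a\<bar>) / 2\<close>, with the sign of \<open>a\<close>.\<close>
  obtain L where L: "0 < L" "\<And>n s. s + L \<le> n \<Longrightarrow>
      \<bar>D L n s - p \<beta> ^ L * (real L * a)\<bar> \<le> p \<beta> ^ L * (\<bar>a\<bar> / 2 * real L)"
    using block_effect[OF \<beta>(1) inv a N0 B] unfolding D_def[symmetric] a_def[symmetric] by metis
  define t where "t = p \<beta> ^ L"
  have t: "0 < t" using \<beta>(2) by (simp add: t_def)
  define C where "C = 2 / right_mass * V"
  have C: "0 \<le> C" using V0 right_mass_pos by (simp add: C_def)
  \<comment> \<open>The guaranteed contribution per time step; \<open>N\<close> blocks give at least
    \<open>\<delta> * real n\<close> for \<open>n = N * L\<close>.\<close>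
  define \<delta> where "\<delta> = t * \<bar>a\<bar> / 2"
  have \<delta>: "0 < \<delta>" using t a by (simp add: \<delta>_def)
  \<comment> \<open>Pushes \<open>(C + 3) / (2 * R)\<close> below \<delta>; after normalization
    \<open>C\<close> bounds the second moment of the mean sum and 3 the fourth moment of the number
    of blocks.\<close>
  define R where "R = (C + 4) / \<delta>"
  have R: "0 < R" "(C + 3) / (2 * R) < \<delta> / 2 + \<delta> / 4"
    using C \<delta> by (auto simp: R_def field_simps intro!: add_nonneg_pos)
  let ?Z = "\<lambda>N. blocks \<beta> L N"
  have key: "\<delta> \<le> R * ((\<integral>\<omega>. \<bar>mean_sum (N * L) \<omega>\<bar> \<partial>nu) / sqrt (real (N * L))) + (C + 3) / (2 * R)"
    if N: "0 < N" for N
  proof -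
    define n where "n = N * L"
    have n: "0 < n" "real n = real N * real L" "N \<le> n" using N L(1) by (auto simp: n_def)
    let ?q = "sqrt (real n)"
    have q: "0 < ?q" "?q * ?q = real n" using n by auto
    have sc: "real n * (R * (I / ?q)) = R * ?q * I" for I
    proof -
      have "Q * Q * (R * (I / Q)) = R * Q * I" if "0 < Q" for Q :: real using that by simp
      from this[OF q(1)] show ?thesis by (simp only: q(2))
    qed
    note bZ = bdd_nu_blocks[of \<beta> L N]
    have cov: "(\<integral>\<omega>. mean_sum n \<omega> * ?Z N \<omega> \<partial>nu) = (\<Sum>k<N. D L n (k * L))"
    proof -
      have "(\<integral>\<omega>. mean_sum n \<omega> * block \<beta> L s \<omega> \<partial>nu) = D L n s" if "s + L \<le> n" for s
      proof -
        obtain M where M: "0 \<le> M" "\<And>\<omega>. \<bar>block \<beta> L s \<omega>\<bar> \<le> M" using bdd_nu_block by (metis bdd_nuE)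
        have "(\<integral>\<omega>. mean_sum n \<omega> * block \<beta> L s \<omega> \<partial>nu) = (\<integral>\<omega>. (\<integral>x. bsum \<phi> \<omega> n x * block \<beta> L s \<omega> \<partial>m01) \<partial>nu)"
          by (simp add: mean_sum_def)
        also have "\<dots> = (\<integral>x. (\<integral>\<omega>. bsum \<phi> \<omega> n x * block \<beta> L s \<omega> \<partial>nu) \<partial>m01)"
        proof (rule integral_nu_swap(1)[OF prob_space_m01 refl])
          show "(\<lambda>z. bsum \<phi> (fst z) n (snd z) * block \<beta> L s (fst z)) \<in> borel_measurable (nu \<Otimes>\<^sub>M m01)"
            by (intro borel_measurable_times measurable_bsum[OF bdd_phi refl]
                measurable_compose[OF measurable_fst bdd_nuD[OF bdd_nu_block]])
          show "\<bar>bsum \<phi> \<omega> n x * block \<beta> L s \<omega>\<bar> \<le> (real n * \<Phi>) * M" for \<omega> x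
            unfolding abs_mult using bsum_abs_le[OF phi_le, where \<omega> = \<omega> and n = n and x = x] M Phi_nonneg
            by (intro mult_mono) auto
        qed
        also have "\<dots> = D L n s" by (simp only: integral_bsum_block[OF bdd_phi \<beta>(1) that] D_def)
        finally show ?thesis .
      qed
      moreover have "k * L + L \<le> n" if "k < N" for k
        using mult_le_mono1[of "Suc k" N L] that by (simp add: n_def)
      ultimately have "(\<integral>\<omega>. mean_sum n \<omega> * block \<beta> L (k * L) \<omega> \<partial>nu) = D L n (k * L)" if "k < N" for k
        using that by blast
      moreover have "integrable nu (\<lambda>\<omega>. mean_sum n \<omega> * block \<beta> L s \<omega>)" for s
        by (intro bdd_nu_integrable bdd_nu_mult bsum_swap(1) bdd_nu_block)
      ultimately show ?thesis unfolding blocks_def sum_distrib_left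
        by (subst Bochner_Integration.integral_sum) simp_all
    qed
    have low: "\<delta> * real n \<le> \<bar>\<integral>\<omega>. mean_sum n \<omega> * ?Z N \<omega> \<partial>nu\<bar>"
    proof -
      have "\<bar>(\<Sum>k<N. D L n (k * L)) - real N * (t * (real L * a))\<bar> = \<bar>\<Sum>k<N. D L n (k * L) - t * (real L * a)\<bar>"
        by (simp add: sum_subtractf)
      also have "\<dots> \<le> (\<Sum>k<N. t * (\<bar>a\<bar> / 2 * real L))"
      proof (rule order_trans[OF sum_abs sum_mono])
        fix k assume "k \<in> {..<N}"
        then have "k * L + L \<le> n" using mult_le_mono1[of "Suc k" N L] by (simp add: n_def)
        from L(2)[OF this] show "\<bar>D L n (k * L) - t * (real L * a)\<bar> \<le> t * (\<bar>a\<bar> / 2 * real L)"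
          by (simp add: t_def)
      qed
      also have "\<dots> = \<delta> * real n" by (simp add: \<delta>_def n(2))
      finally have "\<bar>(\<Sum>k<N. D L n (k * L)) - real N * (t * (real L * a))\<bar> \<le> \<delta> * real n" .
      moreover have "\<bar>real N * (t * (real L * a))\<bar> = 2 * (\<delta> * real n)"
        using t by (simp add: \<delta>_def n(2) abs_mult)
      ultimately show ?thesis unfolding cov by linarith
    qed
    have i: "integrable nu (\<lambda>\<omega>. \<bar>mean_sum n \<omega>\<bar>)" "integrable nu (\<lambda>\<omega>. (mean_sum n \<omega>)\<^sup>2)"
      "integrable nu (\<lambda>\<omega>. ?Z N \<omega> ^ 4)" "integrable nu (\<lambda>\<omega>. \<bar>mean_sum n \<omega> * ?Z N \<omega>\<bar>)"
      using bdd_nu_integrable[OF bsum_swap(1)] bdd_nu_integrable[OF bdd_nu_power[OF bsum_swap(1)]]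
        bdd_nu_integrable[OF bdd_nu_power[OF bZ]] bdd_nu_integrable[OF bdd_nu_mult[OF bsum_swap(1) bZ]]
      by auto
    have "\<bar>\<integral>\<omega>. mean_sum n \<omega> * ?Z N \<omega> \<partial>nu\<bar> \<le> (\<integral>\<omega>. \<bar>mean_sum n \<omega> * ?Z N \<omega>\<bar> \<partial>nu)"
      by (rule integral_abs_bound)
    also have "\<dots> \<le> (\<integral>\<omega>. R * ?q * \<bar>mean_sum n \<omega>\<bar> + (1 / (2 * R) * (mean_sum n \<omega>)\<^sup>2 + 1 / (2 * R * real n) * ?Z N \<omega> ^ 4) \<partial>nu)"
    proof (rule integral_mono)
      fix \<omega>
      define m where "m = mean_sum n \<omega>"
      define z where "z = ?Z N \<omega>"
      have q4: "?q ^ 4 = real n * real n" using q(2) by (simp add: power4_eq_xxxx mult.assoc)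
      \<comment> \<open>Both factors are divided by the square root of \<open>n\<close> before the
        truncation, which makes the choice of \<open>R\<close> independent of
        \<open>n\<close>.\<close>
      have "\<bar>m * z\<bar> = real n * (\<bar>m / ?q\<bar> * \<bar>z / ?q\<bar>)" using q by (simp add: abs_mult field_simps)
      also have "\<dots> \<le> real n * (R * \<bar>m / ?q\<bar> + ((m / ?q)\<^sup>2 + (z / ?q) ^ 4) / (2 * R))"
        by (intro mult_left_mono truncated_product R(1)) simp
      also have "\<dots> = R * ?q * \<bar>m\<bar> + (1 / (2 * R) * m\<^sup>2 + 1 / (2 * R * real n) * z ^ 4)"
      proof -
        have "real n * (R * \<bar>m / ?q\<bar>) = R * ?q * \<bar>m\<bar>"
          using sc[of "\<bar>m\<bar>"] q(1) by (simp add: abs_divide)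
        moreover have "real n * (((m / ?q)\<^sup>2 + (z / ?q) ^ 4) / (2 * R)) = 1 / (2 * R) * m\<^sup>2 + 1 / (2 * R * real n) * z ^ 4"
          unfolding power_divide q4 using R(1) n(1) by (simp add: field_simps)
        ultimately show ?thesis by (simp only: distrib_left)
      qed
      finally show "\<bar>mean_sum n \<omega> * ?Z N \<omega>\<bar>
        \<le> R * ?q * \<bar>mean_sum n \<omega>\<bar> + (1 / (2 * R) * (mean_sum n \<omega>)\<^sup>2 + 1 / (2 * R * real n) * ?Z N \<omega> ^ 4)"
        by (simp add: m_def z_def)
    qed (use i in auto)
    also have "\<dots> = R * ?q * (\<integral>\<omega>. \<bar>mean_sum n \<omega>\<bar> \<partial>nu)
        + (1 / (2 * R) * (\<integral>\<omega>. (mean_sum n \<omega>)\<^sup>2 \<partial>nu) + 1 / (2 * R * real n) * (\<integral>\<omega>. ?Z N \<omega> ^ 4 \<partial>nu))"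
      using i by simp
    also have "\<dots> \<le> R * ?q * (\<integral>\<omega>. \<bar>mean_sum n \<omega>\<bar> \<partial>nu) + (1 / (2 * R) * (C * real n) + 1 / (2 * R * real n) * (3 * (real n)\<^sup>2))"
    proof (intro add_left_mono add_mono mult_left_mono)
      have "(\<integral>\<omega>. (mean_sum n \<omega>)\<^sup>2 \<partial>nu) \<le> (\<integral>\<omega>. (\<integral>x. (bsum \<phi> \<omega> n x)\<^sup>2 \<partial>m01) \<partial>nu)"
        by (intro integral_mono mean_sum_sq_le i bdd_nu_integrable bsum_swap(2))
      also have "\<dots> \<le> C * real n" unfolding bsum_swap(3) C_def by (rule second_moment_lebesgue[OF V])
      finally show "(\<integral>\<omega>. (mean_sum n \<omega>)\<^sup>2 \<partial>nu) \<le> C * real n" .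
      have "(\<integral>\<omega>. ?Z N \<omega> ^ 4 \<partial>nu) \<le> 3 * (real N)\<^sup>2" using blocks_moments[OF \<beta>(1)] by blast
      also have "\<dots> \<le> 3 * (real n)\<^sup>2" using n(3) by (intro mult_left_mono power_mono) auto
      finally show "(\<integral>\<omega>. ?Z N \<omega> ^ 4 \<partial>nu) \<le> 3 * (real n)\<^sup>2" .
    qed (use R(1) in auto)
    finally have "\<delta> * real n \<le> R * ?q * (\<integral>\<omega>. \<bar>mean_sum n \<omega>\<bar> \<partial>nu)
        + (1 / (2 * R) * (C * real n) + 1 / (2 * R * real n) * (3 * (real n)\<^sup>2))"
      using low by linarith
    also have "\<dots> = real n * (R * ((\<integral>\<omega>. \<bar>mean_sum n \<omega>\<bar> \<partial>nu) / ?q) + (C + 3) / (2 * R))"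
    proof -
      have "1 / (2 * R) * (C * real n) + 1 / (2 * R * real n) * (3 * (real n)\<^sup>2) = real n * ((C + 3) / (2 * R))"
        using R(1) n(1) by (simp add: field_simps power2_eq_square)
      then show ?thesis by (simp only: distrib_left sc)
    qed
    finally have "real n * \<delta> \<le> real n * (R * ((\<integral>\<omega>. \<bar>mean_sum n \<omega>\<bar> \<partial>nu) / ?q) + (C + 3) / (2 * R))"
      by (simp only: mult.commute)
    then show ?thesis using n(1) unfolding n_def[symmetric] by (simp only: mult_le_cancel_left_pos of_nat_0_less_iff)
  qed
  have "(\<lambda>N. R * ((\<integral>\<omega>. \<bar>mean_sum (N * L) \<omega>\<bar> \<partial>nu) / sqrt (real (N * L))) + (C + 3) / (2 * R)) \<longlonglongrightarrow> R * 0 + (C + 3) / (2 * R)"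
  proof (intro tendsto_add tendsto_mult tendsto_const)
    have "filterlim (\<lambda>N. N * L) at_top sequentially"
      using L(1) by (intro mult_nat_right_at_top)
    then show "(\<lambda>N. (\<integral>\<omega>. \<bar>mean_sum (N * L) \<omega>\<bar> \<partial>nu) / sqrt (real (N * L))) \<longlonglongrightarrow> 0"
      by (rule filterlim_compose[OF mean_sum_L1[OF V clt]])
  qed
  then have "\<delta> \<le> R * 0 + (C + 3) / (2 * R)"
    by (rule LIMSEQ_le_const) (intro exI[of _ 1] allI impI key, simp)
  then show False using R(2) \<delta> by simp
qed

end

section \<open>Extension of the observable and conclusion\<close>

lemma C1_unit_lipschitz:
  assumes "C1_unit \<phi>"
  obtains \<Lambda> where "\<And>x y. x \<in> {0..1} \<Longrightarrow> y \<in> {0..1} \<Longrightarrow> \<bar>\<phi> x - \<phi> y\<bar> \<le> \<Lambda> * \<bar>x - y\<bar>" "0 \<le> \<Lambda>"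
proof -
  from assms obtain \<phi>' where c: "continuous_on {0..1} \<phi>'"
    and d: "\<And>x. x \<in> {0..1} \<Longrightarrow> (\<phi> has_real_derivative \<phi>' x) (at x within {0..1})"
    unfolding C1_unit_def by blast
  have "compact (\<phi>' ` {0..1})" using c by (intro compact_continuous_image) auto
  then obtain \<Lambda> where \<Lambda>: "\<And>x. x \<in> {0..1} \<Longrightarrow> norm (\<phi>' x) \<le> \<Lambda>"
    using compact_imp_bounded bounded_iff by (metis imageI)
  have "norm (\<phi> x - \<phi> y) \<le> \<Lambda> * norm (x - y)" if "x \<in> {0..1}" "y \<in> {0..1}" for x y
    using that by (intro field_differentiable_bound[OF _ d \<Lambda>]) auto
  moreover have "0 \<le> \<Lambda>" using \<Lambda>[of 0] norm_ge_zero[of "\<phi>' 0"] by (simp del: norm_ge_zero)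
  ultimately show thesis using that[of \<Lambda>] by simp
qed

theorem theorem5p3:
  fixes \<alpha> \<beta>\<^sub>1 \<beta>\<^sub>2 \<sigma>2 :: real
    and \<Omega> :: "real set" and p :: "real \<Rightarrow> real"
    and \<mu> :: "real measure" and \<mu>\<^sub>T :: "real \<Rightarrow> real measure"
    and \<phi> :: "real \<Rightarrow> real"
  assumes "0 < \<alpha>" and "\<alpha> < 1"
    and "finite \<Omega>" and "\<Omega> \<subseteq> {0<..<\<alpha>}"
    and "\<And>\<beta>. \<beta> \<in> \<Omega> \<Longrightarrow> 0 < p \<beta>" and "(\<Sum>\<beta>\<in>\<Omega>. p \<beta>) = 1"
    and "ac_stationary \<Omega> p \<mu>"
    and "\<And>\<beta>. \<beta> \<in> \<Omega> \<Longrightarrow> ac_invariant \<beta> (\<mu>\<^sub>T \<beta>)"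
    and "C1_unit \<phi>" and "(\<integral>x. \<phi> x \<partial>\<mu>) = 0"
    and "\<beta>\<^sub>1 \<in> \<Omega>" and "\<beta>\<^sub>2 \<in> \<Omega>"
    and "(\<integral>x. \<phi> x \<partial>\<mu>\<^sub>T \<beta>\<^sub>1) \<noteq> (\<integral>x. \<phi> x \<partial>\<mu>\<^sub>T \<beta>\<^sub>2)"
    and "annealed_variance \<Omega> p \<mu> \<phi> \<sigma>2"
  shows "\<not> (AE \<omega> in seq_measure \<Omega> p. quenched_clt \<phi> \<omega> \<sigma>2)"
proof
  assume clt: "AE \<omega> in seq_measure \<Omega> p. quenched_clt \<phi> \<omega> \<sigma>2"
  interpret intermittent_system \<Omega> p \<alpha>
    using assms(2-6) by unfold_locales (auto simp: less_imp_le)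
  obtain \<Lambda> where \<Lambda>: "\<And>x y. x \<in> {0..1} \<Longrightarrow> y \<in> {0..1} \<Longrightarrow> \<bar>\<phi> x - \<phi> y\<bar> \<le> \<Lambda> * \<bar>x - y\<bar>" "0 \<le> \<Lambda>"
    using C1_unit_lipschitz[OF assms(9)] by blast
  \<comment> \<open>Clamping the argument extends \<phi> to the whole line with the same Lipschitz
    constant, and integrals over the unit interval do not change.\<close>
  define cl where "cl = (\<lambda>x::real. max 0 (min 1 x))"
  define \<psi> where "\<psi> = (\<lambda>x. \<phi> (cl x))"
  define \<Phi> where "\<Phi> = \<bar>\<phi> 0\<bar> + \<Lambda>"
  have cl: "cl x \<in> {0..1}" "\<bar>cl x - cl y\<bar> \<le> \<bar>x - y\<bar>" for x y by (auto simp: cl_def)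
  have \<psi>\<phi>: "\<psi> x = \<phi> x" if "0 \<le> x" "x \<le> 1" for x using that by (simp add: \<psi>_def cl_def)
  have lip: "\<bar>\<psi> x - \<psi> y\<bar> \<le> \<Lambda> * \<bar>x - y\<bar>" for x y
    using \<Lambda>(1)[OF cl(1) cl(1), of x y] mult_left_mono[OF cl(2) \<Lambda>(2), of x y] unfolding \<psi>_def by linarith
  have le: "\<bar>\<psi> x\<bar> \<le> \<Phi>" for x
  proof -
    have "\<Lambda> * \<bar>cl x - 0\<bar> \<le> \<Lambda> * 1" using cl(1)[of x] \<Lambda>(2) by (intro mult_left_mono) auto
    then show ?thesis using \<Lambda>(1)[OF cl(1), of 0 x] unfolding \<psi>_def \<Phi>_def by (simp add: abs_if split: if_splits)
  qed
  have "continuous_on UNIV \<psi>"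
    using lip \<Lambda>(2) by (intro lipschitz_on_continuous_on[of \<Lambda>] lipschitz_onI) (auto simp: dist_real_def)
  then have bdd: "bdd_meas \<psi>"
    using le by (intro bdd_measI[of _ \<Phi>] borel_measurable_continuous_onI) auto
  have ac: "ac_prob \<mu>" using assms(7) by (simp add: ac_stationary_def)
  then interpret mu: prob_space \<mu> by (simp add: ac_prob_def)
  have eqint: "(\<integral>x. \<psi> x \<partial>\<eta>) = (\<integral>x. \<phi> x \<partial>\<eta>)" if "ac_prob \<eta>" for \<eta>
  proof (intro Bochner_Integration.integral_cong refl)
    have "space \<eta> = {0..1}"
      using that sets_eq_imp_space_eq[of \<eta> m01] by (simp add: ac_prob_def)
    then show "x \<in> space \<eta> \<Longrightarrow> \<psi> x = \<phi> x" for x using \<psi>\<phi> by simp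
  qed
  interpret observable_system \<Omega> p \<alpha> \<mu> \<psi> \<Phi> \<Lambda>
  proof
    show "ac_prob \<mu>" by (rule ac)
    show "(\<integral>x. koop f x \<partial>\<mu>) = (\<integral>x. f x \<partial>\<mu>)" if "bdd_meas f" for f
      using assms(7) ac that
      by (intro integral_koop_stationary mu.finite_measure_axioms) (auto simp: ac_stationary_def ac_prob_def)
    show "(\<integral>x. \<psi> x \<partial>\<mu>) = 0" using eqint[OF ac] assms(10) by simp
  qed (use bdd le lip in auto)
  define X where "X n = (\<integral>\<omega>. (\<integral>x. (\<Sum>k<n. \<phi> (rcomp \<omega> k x))\<^sup>2 \<partial>\<mu>) \<partial>nu)" for n
  have X: "X n = (\<integral>x. second_moment \<psi> n x \<partial>\<mu>)" for n
  proof -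
    have b: "\<bar>(bsum \<psi> \<omega> n x)\<^sup>2\<bar> \<le> (real n * \<Phi>)\<^sup>2" for \<omega> x
      using power_mono[OF bsum_abs_le[OF le, where \<omega> = \<omega> and n = n and x = x] abs_ge_zero, where n = 2] by simp
    have "X n = (\<integral>\<omega>. (\<integral>x. (bsum \<psi> \<omega> n x)\<^sup>2 \<partial>\<mu>) \<partial>nu)"
      unfolding X_def bsum_def using rcomp_unit \<psi>\<phi>
      by (intro Bochner_Integration.integral_cong refl) (simp add: space_mu)
    also have "\<dots> = (\<integral>x. second_moment \<psi> n x \<partial>\<mu>)"
      unfolding second_moment_def
      by (rule integral_nu_swap(1)[OF mu.prob_space_axioms sets_mu
            borel_measurable_power[OF measurable_bsum[OF bdd sets_mu]] b])
    finally show ?thesis .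
  qed
  have lim: "(\<lambda>n. 1 / real n * X n) \<longlonglongrightarrow> \<sigma>2"
    using assms(14) by (simp add: annealed_variance_def X_def)
  have X0: "0 \<le> X n" for n
    unfolding X second_moment_def by (intro integral_nonneg_AE AE_I2) simp
  have \<sigma>: "0 \<le> \<sigma>2" using X0 by (intro LIMSEQ_le_const[OF lim]) auto
  \<comment> \<open>The annealed variance enters through the boundedness of the convergent sequence,
    besides the sign of its limit.\<close>
  obtain V where V: "\<And>n. norm (1 / real n * X n) \<le> V"
    using convergent_imp_Bseq[OF convergentI[OF lim]] unfolding Bseq_def by blast
  have "(\<integral>x. second_moment \<psi> n x \<partial>\<mu>) \<le> V * real n" for n
  proof (cases "n = 0")
    case False
    then show ?thesis using V[of n] X0[of n] by (simp add: X field_simps)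
  qed (simp add: second_moment_def)
  moreover have "AE \<omega> in nu. \<forall>R\<ge>0. (\<lambda>n. \<integral>x. clip R (nsum \<psi> \<omega> n x) \<partial>m01) \<longlonglongrightarrow> 0"
    using clt AE_space
  proof eventually_elim
    case (elim \<omega>)
    then show ?case using quenched_clt_clip[OF bdd _ elim(2) elim(1) \<sigma>] \<psi>\<phi> by auto
  qed
  \<comment> \<open>Positivity of \<open>p \<beta>\<close> makes blocks of each parameter occur, so
    every single-map integral vanishes and no two of them can differ.\<close>
  ultimately have zero: "(\<integral>x. \<psi> x \<partial>\<mu>\<^sub>T \<beta>) = 0" if "\<beta> \<in> \<Omega>" for \<beta>
    using quenched_clt_imp_mean_zero[OF _ _ that assms(5)[OF that] assms(8)[OF that]] by blast
  have "ac_prob (\<mu>\<^sub>T \<beta>)" if "\<beta> \<in> \<Omega>" for \<beta>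
    using assms(8)[OF that] by (simp add: ac_invariant_def)
  then show False using zero eqint assms(11-13) by auto
qed

end
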